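(* Let $\mathcal H=L^2(\mathbb R_+,dx)$ and $N\in\mathbb N$. Then for each $n\ge0$ and $\alpha\in S_0(n)$, the matrix-valued process $t\mapsto H_\alpha(X(\mathbf 1_{[0,t]}))$ (all $n$ arguments equal to $X(\mathbf 1_{[0,t]})$) is a martingale (with respect to the filtration generated by $\{X(h):h\in L^2([0,t],dx)\text{ real-valued}\}$, $t\ge0$).
   Context: $\mathcal H_{\mathbb R}=L^2(\mathbb R_+,dx;\mathbb R)$. $\{X(h):h\in\mathcal H_{\mathbb R}\}$ is the $N\times N$ Hermitian Gaussian process: Hermitian random matrices on one probability space, real-linear in $h$, with jointly Gaussian centered entries and $\mathbb E[X(f)_{ij}X(g)_{k\ell}]=\frac1N\delta_{i=\ell}\delta_{j=k}\langle f,g\rangle$ (so $X(\mathbf 1_{[0,t]})$ is the Hermitian Brownian motion). Conditional expectations of matrices are taken entrywise. $[n]=\{1,\dots,n\}$, $[0,n]=\{0,\dots,n\}$; $S_0(n)$ is the permutation group of $[0,n]$, products composed right to left. $\mathrm{cyc}_0(\alpha)$ is the number of cycles of $\alpha\in S_0(n)$ (fixed points are cycles) not containing $0$. $\mathcal P_{1,2}(n)$ is the set of partitions $\pi$ of $[n]$ into blocks of size 1 and 2, identified with the involution swapping the elements of each pair; $|\pi|$ is the number of pairs, $\mathrm{supp}(\pi)$ their union. For $S\subset[n]$, $\alpha|_{S^c}$ is the permutation of $[0,n]\setminus S$, $x\mapsto\alpha^m(x)$, $m=\min\{j>0:\alpha^j(x)\notin S\}$. With $q=1/N$ and $p=|\pi|$,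 $$C_\pi(\alpha)=q^{\mathrm{cyc}_0((\pi\alpha)|_{\mathrm{supp}(\pi)^c})-\mathrm{cyc}_0(\pi\alpha)+p}\,P\big((\pi\alpha)|_{\mathrm{supp}(\pi)^c}\big)\in\mathbb C[S_0(n-2p)],$$ $P$ relabelling $[0,n]\setminus\mathrm{supp}(\pi)$ by $[0,n-2p]$ order-preservingly. For matrices, $\mathrm{Tr}_\alpha(A_1,\dots,A_n)=A_{\alpha(0)}A_{\alpha^2(0)}\cdots A_{\alpha^{-1}(0)}\prod_{\text{other cycles }(i_1\dots i_m)}\mathrm{Tr}[A_{i_1}\cdots A_{i_m}]$ (un-normalized trace; first product is $I_N$ if $\alpha(0)=0$), extended linearly to $\mathbb C[S_0(n)]$. The $\alpha$-Hermite trace polynomial is $$H_\alpha(X(h_1),\dots,X(h_n))=\sum_{\pi\in\mathcal P_{1,2}(n)}(-1)^{|\pi|}\prod_{\{i,j\}\text{ pair of }\pi}\langle h_i,h_j\rangle\ \mathrm{Tr}_{C_\pi(\alpha)}\big(X(h_{u_1}),\dots,X(h_{u_{n-2|\pi|}})\big),$$ $u_1<\dots<u_{n-2|\pi|}$ being the singletons of $\pi$, and $H_\alpha(X(h))=H_\alpha(X(h),\dots,X(h))$. *)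

theory Defs
  imports
    "HOL-Probability.Probability"
    "HOL-Combinatorics.Combinatorics"
    "HOL-Combinatorics.Orbits"
    "HOL-Library.Disjoint_Sets"
    "HOL-Library.Poly_Mapping"
begin

section \<open>The real Hilbert space of square-integrable functions on the half-line\<close>

text \<open>Elements of the space are represented by functions; only their values on \<open>{0..}\<close> up to
  null sets are relevant.\<close>

definition L2_Rplus :: "(real \<Rightarrow> real) set" where
  "L2_Rplus = {h. h \<in> borel_measurable (lebesgue_on {0..}) \<and>
                  integrable (lebesgue_on {0..}) (\<lambda>x. (h x)\<^sup>2)}"

definition L2_inner :: "(real \<Rightarrow> real) \<Rightarrow> (real \<Rightarrow> real) \<Rightarrow> real" where
  "L2_inner f g = (LINT x|lebesgue_on {0..}. f x * g x)"

text \<open>The subspace of functions supported in \<open>{0..t}\<close> (extension by zero).\<close>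

definition L2_upto :: "real \<Rightarrow> (real \<Rightarrow> real) set" where
  "L2_upto t = {h \<in> L2_Rplus. AE x in lebesgue_on {0..}. t < x \<longrightarrow> h x = 0}"


section \<open>The Hermitian Gaussian process\<close>

text \<open>Normal distributions may be degenerate: a constant counts as Gaussian.\<close>

definition gaussian_rv :: "'a measure \<Rightarrow> ('a \<Rightarrow> real) \<Rightarrow> bool" where
  "gaussian_rv M Y \<longleftrightarrow> Y \<in> borel_measurable M \<and>
     ((\<exists>\<mu>. AE \<omega> in M. Y \<omega> = \<mu>) \<or>
      (\<exists>\<mu> \<sigma>. 0 < \<sigma> \<and> distributed M lborel Y (normal_density \<mu> \<sigma>)))"

definition jointly_gaussian :: "'a measure \<Rightarrow> ('a \<Rightarrow> real) set \<Rightarrow> bool" where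
  "jointly_gaussian M G \<longleftrightarrow>
     (\<forall>F c. finite F \<and> F \<subseteq> G \<longrightarrow> gaussian_rv M (\<lambda>\<omega>. \<Sum>Y\<in>F. c Y * Y \<omega>))"

definition hermitian :: "complex^'n^'n \<Rightarrow> bool" where
  "hermitian A \<longleftrightarrow> (\<forall>i j. A $ i $ j = cnj (A $ j $ i))"

text \<open>The matrix size \<open>N\<close> is \<open>CARD('n)\<close>. Since arguments are functions rather than
  classes, \<open>X_cong\<close> says that the process is defined on classes; identities between random
  matrices are almost sure.\<close>

locale hermitian_gaussian_process = prob_space M for M :: "'a measure" +
  fixes X :: "(real \<Rightarrow> real) \<Rightarrow> 'a \<Rightarrow> complex^'n^'n"
  assumes X_measurable: "h \<in> L2_Rplus \<Longrightarrow> X h \<in> borel_measurable M"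
    and X_hermitian: "h \<in> L2_Rplus \<Longrightarrow> AE \<omega> in M. hermitian (X h \<omega>)"
    and X_cong: "f \<in> L2_Rplus \<Longrightarrow> g \<in> L2_Rplus \<Longrightarrow> AE x in lebesgue_on {0..}. f x = g x \<Longrightarrow>
          AE \<omega> in M. X f \<omega> = X g \<omega>"
    and X_linear: "f \<in> L2_Rplus \<Longrightarrow> g \<in> L2_Rplus \<Longrightarrow>
          AE \<omega> in M. X (\<lambda>x. a * f x + b * g x) \<omega> = a *\<^sub>R X f \<omega> + b *\<^sub>R X g \<omega>"
    and X_gaussian: "jointly_gaussian M
          ({(\<lambda>\<omega>. Re (X h \<omega> $ i $ j)) | h i j. h \<in> L2_Rplus} \<union>
           {(\<lambda>\<omega>. Im (X h \<omega> $ i $ j)) | h i j. h \<in> L2_Rplus})"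
    and X_centered: "h \<in> L2_Rplus \<Longrightarrow> (LINT \<omega>|M. X h \<omega> $ i $ j) = 0"
    and X_covariance: "f \<in> L2_Rplus \<Longrightarrow> g \<in> L2_Rplus \<Longrightarrow>
          (LINT \<omega>|M. X f \<omega> $ i $ j * X g \<omega> $ k $ l) =
            (if i = l \<and> j = k then complex_of_real (L2_inner f g / real CARD('n)) else 0)"

definition natural_filtration ::
    "'a measure \<Rightarrow> ((real \<Rightarrow> real) \<Rightarrow> 'a \<Rightarrow> complex^'n^'n) \<Rightarrow> real \<Rightarrow> 'a measure" where
  "natural_filtration M X t =
     sigma (space M) {X h -` B \<inter> space M | h B. h \<in> L2_upto t \<and> B \<in> sets borel}"


section \<open>Matrix-valued martingales\<close>

definition complex_cond_exp :: "'a measure \<Rightarrow> 'a measure \<Rightarrow> ('a \<Rightarrow> complex) \<Rightarrow> 'a \<Rightarrow> complex" where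
  "complex_cond_exp M F f \<omega> =
     Complex (real_cond_exp M F (\<lambda>x. Re (f x)) \<omega>) (real_cond_exp M F (\<lambda>x. Im (f x)) \<omega>)"

definition matrix_cond_exp ::
    "'a measure \<Rightarrow> 'a measure \<Rightarrow> ('a \<Rightarrow> complex^'n^'n) \<Rightarrow> 'a \<Rightarrow> complex^'n^'n" where
  "matrix_cond_exp M F Y \<omega> = (\<chi> i j. complex_cond_exp M F (\<lambda>x. Y x $ i $ j) \<omega>)"

definition matrix_martingale ::
    "'a measure \<Rightarrow> real set \<Rightarrow> (real \<Rightarrow> 'a measure) \<Rightarrow> (real \<Rightarrow> 'a \<Rightarrow> complex^'n^'n) \<Rightarrow> bool" where
  "matrix_martingale M T F Y \<longleftrightarrow>
     (\<forall>t\<in>T. subalgebra M (F t)) \<and>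
     (\<forall>s\<in>T. \<forall>t\<in>T. s \<le> t \<longrightarrow> subalgebra (F t) (F s)) \<and>
     (\<forall>t\<in>T. Y t \<in> borel_measurable (F t)) \<and>
     (\<forall>t\<in>T. \<forall>i j. integrable M (\<lambda>\<omega>. Y t \<omega> $ i $ j)) \<and>
     (\<forall>s\<in>T. \<forall>t\<in>T. s \<le> t \<longrightarrow> (AE \<omega> in M. matrix_cond_exp M (F s) (Y t) \<omega> = Y s \<omega>))"


section \<open>Permutations\<close>

definition S0 :: "nat \<Rightarrow> (nat \<Rightarrow> nat) set" where
  "S0 n = {\<alpha>. \<alpha> permutes {0..n}}"

text \<open>The cycles not containing 0, as sets of points, of a permutation of \<open>A\<close>.\<close>

definition cycles0 :: "nat set \<Rightarrow> (nat \<Rightarrow> nat) \<Rightarrow> nat set set" where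
  "cycles0 A \<alpha> = {orbit \<alpha> x | x. x \<in> A \<and> 0 \<notin> orbit \<alpha> x}"

definition cyc0 :: "nat set \<Rightarrow> (nat \<Rightarrow> nat) \<Rightarrow> nat" where
  "cyc0 A \<alpha> = card (cycles0 A \<alpha>)"

text \<open>The first-return permutation on the complement of \<open>S\<close>; by convention it is the
  identity on \<open>S\<close>.\<close>

definition restrict_compl :: "nat set \<Rightarrow> (nat \<Rightarrow> nat) \<Rightarrow> nat \<Rightarrow> nat" where
  "restrict_compl S \<alpha> x =
     (if x \<in> S then x else (\<alpha> ^^ (LEAST j. 0 < j \<and> (\<alpha> ^^ j) x \<notin> S)) x)"

text \<open>Order-preserving relabelling of a permutation of a finite set \<open>A\<close> as a permutation
  of \<open>{0..<card A}\<close>.\<close>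

definition relabel :: "nat set \<Rightarrow> (nat \<Rightarrow> nat) \<Rightarrow> nat \<Rightarrow> nat" where
  "relabel A \<beta> k =
     (let e = (\<lambda>m. sorted_list_of_set A ! m)
      in if k < card A then the_inv_into {0..<card A} e (\<beta> (e k)) else k)"


section \<open>Partitions into pairs and singletons\<close>

definition partitions12 :: "nat \<Rightarrow> nat set set set" where
  "partitions12 n = {\<pi>. partition_on {1..n} \<pi> \<and> (\<forall>B\<in>\<pi>. card B = 1 \<or> card B = 2)}"

definition pairs :: "nat set set \<Rightarrow> nat set set" where
  "pairs \<pi> = {B \<in> \<pi>. card B = 2}"

definition supp :: "nat set set \<Rightarrow> nat set" where
  "supp \<pi> = \<Union> (pairs \<pi>)"

definition invol :: "nat set set \<Rightarrow> nat \<Rightarrow> nat" where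
  "invol \<pi> x = (if x \<in> supp \<pi> then (THE y. y \<noteq> x \<and> {x, y} \<in> \<pi>) else x)"

text \<open>The \<open>k\<close>-th smallest singleton, counting from 1.\<close>

definition nth_singleton :: "nat set set \<Rightarrow> nat \<Rightarrow> nat" where
  "nth_singleton \<pi> k = sorted_list_of_set {i. {i} \<in> \<pi>} ! (k - 1)"


section \<open>Hermite trace polynomials\<close>

text \<open>Elements of a complex group algebra are finitely supported functions on permutations.
  Only the vector space structure is used. The exponent of \<open>q\<close> may be negative.\<close>

definition contraction ::
    "real \<Rightarrow> nat \<Rightarrow> nat set set \<Rightarrow> (nat \<Rightarrow> nat) \<Rightarrow> (nat \<Rightarrow> nat) \<Rightarrow>\<^sub>0 complex" where
  "contraction q n \<pi> \<alpha> =
     (let A = {0..n} - supp \<pi>;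
          \<beta> = restrict_compl (supp \<pi>) (invol \<pi> \<circ> \<alpha>)
      in Poly_Mapping.single (relabel A \<beta>)
           (complex_of_real
             (q powi (int (cyc0 A \<beta>) - int (cyc0 {0..n} (invol \<pi> \<circ> \<alpha>)) + int (card (pairs \<pi>))))))"

definition mat_prod_list :: "(complex^'n^'n) list \<Rightarrow> complex^'n^'n" where
  "mat_prod_list As = foldr (**) As (mat 1)"

text \<open>A cycle not containing 0 is read off starting from its least element; the trace does not
  depend on this choice.\<close>

definition Tr_perm :: "nat \<Rightarrow> (nat \<Rightarrow> nat) \<Rightarrow> (nat \<Rightarrow> complex^'n^'n) \<Rightarrow> complex^'n^'n" where
  "Tr_perm n \<alpha> A =
     map_matrix
       ((*) (\<Prod>C\<in>cycles0 {0..n} \<alpha>.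
          trace (mat_prod_list (map (\<lambda>j. A ((\<alpha> ^^ j) (Min C))) [0..<card C]))))
       (mat_prod_list (map (\<lambda>j. A ((\<alpha> ^^ j) 0)) [1..<card (orbit \<alpha> 0)]))"

definition Tr_alg ::
    "nat \<Rightarrow> ((nat \<Rightarrow> nat) \<Rightarrow>\<^sub>0 complex) \<Rightarrow> (nat \<Rightarrow> complex^'n^'n) \<Rightarrow> complex^'n^'n" where
  "Tr_alg n a A =
     (\<Sum>\<sigma>\<in>Poly_Mapping.keys a. map_matrix ((*) (Poly_Mapping.lookup a \<sigma>)) (Tr_perm n \<sigma> A))"

text \<open>The matrix \<open>H\<^sub>\<alpha>(X(h 1), \<dots>, X(h n))\<close> at the sample point \<open>\<omega>\<close>;
  a pair \<open>{i, j}\<close> is \<open>{Min B, Max B}\<close>.\<close>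

definition hermite_trace ::
    "((real \<Rightarrow> real) \<Rightarrow> 'a \<Rightarrow> complex^'n^'n) \<Rightarrow> nat \<Rightarrow> (nat \<Rightarrow> nat) \<Rightarrow> (nat \<Rightarrow> real \<Rightarrow> real)
      \<Rightarrow> 'a \<Rightarrow> complex^'n^'n" where
  "hermite_trace X n \<alpha> h \<omega> =
     (\<Sum>\<pi>\<in>partitions12 n.
        ((- 1) ^ card (pairs \<pi>) * (\<Prod>B\<in>pairs \<pi>. L2_inner (h (Min B)) (h (Max B)))) *\<^sub>R
        Tr_alg (n - 2 * card (pairs \<pi>)) (contraction (1 / real CARD('n)) n \<pi> \<alpha>)
          (\<lambda>k. X (h (nth_singleton \<pi> k)) \<omega>))"

end

theory Submission
  imports Defs
begin

text \<open>
  Fix a matrix position \<open>(a, b)\<close>.  Writing out all matrix products, the \<open>(a, b)\<close> entry of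
  \<open>Tr\<^sub>\<alpha>(A\<^sub>1, \<dots>, A\<^sub>n)\<close> is a sum over assignments \<open>r\<close> of a matrix index to each point of
  \<open>{0..n}\<close>, of the product of the entries of \<open>A\<^sub>k\<close> at row \<open>r k\<close> and column \<open>r (\<alpha> k)\<close>, subject to
  \<open>r 0 = b\<close> and \<open>r (\<alpha> 0) = a\<close>.  (The two constraints amount to putting the matrix unit at
  \<open>(b, a)\<close> at the point \<open>0\<close>; after that, all cycles are traces.)  In this form contracting a pair
  \<open>{i, j}\<close> replaces the two entries belonging to \<open>i\<close> and \<open>j\<close> by their covariance
  \<open>q [r i = r (\<alpha> j)] [r (\<alpha> i) = r j]\<close>: such Kronecker symbols delete \<open>i\<close> and \<open>j\<close> from the
  cycles of \<open>\<alpha> \<circ> \<pi>\<close>, and each cycle deleted completely leaves a free index and hence a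
  factor \<open>N\<close>.  This is exactly the exponent of \<open>q\<close> in the contraction
  (\<open>index_sum_identity_on\<close>, \<open>Tr_contraction_entry\<close>).  Therefore the entries of the Hermite trace
  polynomial are sums of Wick polynomials of the Gaussian variables
  \<open>Y\<^sub>k(t) = X(1\<^bsub>[0,t]\<^esub>)\<close> at \<open>(r k, r (\<alpha> k))\<close> (\<open>hermite_trace_entry\<close>).

  For jointly Gaussian centered \<open>Y\<^sub>k\<close> and a real variable \<open>\<zeta>\<close> in the same Gaussian space,
  \<open>E[:Y\<^sub>1 \<dots> Y\<^sub>n: exp(i \<zeta>)] = (\<Prod>k. i E[Y\<^sub>k \<zeta>]) E[exp(i \<zeta>)]\<close> (\<open>wick_iexp\<close>).  It follows by
  induction on \<open>n\<close>: the Wick recursion removes one factor, and multiplication by a Gaussian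
  variable \<open>Z\<close> is differentiation in \<open>\<theta>\<close> after replacing \<open>\<zeta>\<close> by \<open>\<zeta> + \<theta> Z\<close>.  If \<open>\<zeta>\<close> is built from
  \<open>X(h)\<close> with \<open>h\<close> supported in \<open>[0,s]\<close>, then \<open>E[Y\<^sub>k(t) \<zeta>]\<close> is the same for all \<open>t \<ge> s\<close>, because
  the inner product of \<open>h\<close> with the indicator of \<open>[0,t]\<close> is.  So the increment of the Hermite trace
  polynomial from \<open>s\<close> to \<open>t\<close> has vanishing expectation against every \<open>exp(i \<zeta>)\<close> from the past
  of \<open>s\<close>.  By uniqueness of Fourier transforms, applied one coordinate at a time, it has vanishing
  expectation on every event of the past (\<open>fourier_unique_sigma\<close>), which is the martingale property.
\<close>

section \<open>Sums over index assignments\<close>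

text \<open>The trace of a product along every cycle of \<open>\<gamma>\<close>, multiplied over the cycles and written out
  in matrix entries: \<open>r k\<close> is the row index of the factor at \<open>k\<close>, and its column index is the row
  index of the factor that follows it.\<close>

definition index_sum :: "'k set \<Rightarrow> ('k \<Rightarrow> 'k) \<Rightarrow> ('k \<Rightarrow> complex^'n^'n) \<Rightarrow> complex" where
  "index_sum V \<gamma> A = (\<Sum>r \<in> V \<rightarrow>\<^sub>E UNIV. \<Prod>k\<in>V. A k $ r k $ r (\<gamma> k))"

lemma index_sum_cong:
  assumes "V = V'" "\<And>k. k \<in> V \<Longrightarrow> \<gamma> k = \<gamma>' k" "\<And>k. k \<in> V \<Longrightarrow> A k = A' k"
  shows "index_sum V \<gamma> A = index_sum V' \<gamma>' A'"
  unfolding index_sum_def using assms by (auto intro!: sum.cong prod.cong)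

lemma index_sum_reindex:
  assumes e: "bij_betw e V' V" and maps: "\<And>k. k \<in> V' \<Longrightarrow> \<gamma>' k \<in> V'"
    and comm: "\<And>k. k \<in> V' \<Longrightarrow> e (\<gamma>' k) = \<gamma> (e k)"
  shows "index_sum V \<gamma> A = index_sum V' \<gamma>' (A \<circ> e)"
proof -
  have inj: "inj_on e V'" and im: "e ` V' = V" using e by (auto simp: bij_betw_def)
  define d where "d = the_inv_into V' e"
  have de: "d (e k) = k" if "k \<in> V'" for k unfolding d_def using that inj by (rule the_inv_into_f_f[rotated])
  have ed: "e (d k) = k" "d k \<in> V'" if "k \<in> V" for k
    using that im de by auto
  have \<gamma>V: "\<gamma> k \<in> V" if "k \<in> V" for k
    using comm[of "d k"] maps[of "d k"] ed[OF that] im by force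
  show ?thesis unfolding index_sum_def
  proof (rule sum.reindex_bij_witness[where i="\<lambda>r. restrict (r \<circ> d) V" and j="\<lambda>r. restrict (r \<circ> e) V'"])
    fix r :: "'b \<Rightarrow> 'c" assume r: "r \<in> V \<rightarrow>\<^sub>E UNIV"
    show "restrict (restrict (r \<circ> e) V' \<circ> d) V = r"
      using r ed by (auto simp: fun_eq_iff restrict_def PiE_def extensional_def)
    show "restrict (r \<circ> e) V' \<in> V' \<rightarrow>\<^sub>E UNIV" by auto
    have "(\<Prod>k\<in>V. A k $ r k $ r (\<gamma> k)) = (\<Prod>k\<in>V'. A (e k) $ r (e k) $ r (\<gamma> (e k)))"
      using prod.reindex[OF inj, of "\<lambda>k. A k $ r k $ r (\<gamma> k)"] im by simp
    also have "\<dots> = (\<Prod>k\<in>V'. (A \<circ> e) k $ restrict (r \<circ> e) V' k $ restrict (r \<circ> e) V' (\<gamma>' k))"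
      using maps comm by (intro prod.cong) auto
    finally show "(\<Prod>k\<in>V'. (A \<circ> e) k $ restrict (r \<circ> e) V' k $ restrict (r \<circ> e) V' (\<gamma>' k)) = (\<Prod>k\<in>V. A k $ r k $ r (\<gamma> k))" ..
  next
    fix r :: "'a \<Rightarrow> 'c" assume r: "r \<in> V' \<rightarrow>\<^sub>E UNIV"
    show "restrict (restrict (r \<circ> d) V \<circ> e) V' = r"
      using r de im by (auto simp: fun_eq_iff restrict_def PiE_def extensional_def)
    show "restrict (r \<circ> d) V \<in> V \<rightarrow>\<^sub>E UNIV" by auto
  qed
qed

text \<open>Index assignments on two invariant pieces can be chosen independently.\<close>

lemma index_sum_Un:
  assumes fin: "finite V" "finite W" and disj: "V \<inter> W = {}"
    and V: "\<And>k. k \<in> V \<Longrightarrow> \<gamma> k \<in> V" and W: "\<And>k. k \<in> W \<Longrightarrow> \<gamma> k \<in> W"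
  shows "index_sum (V \<union> W) \<gamma> A = index_sum V \<gamma> A * index_sum W \<gamma> (A :: _ \<Rightarrow> complex^'n^'n)"
proof -
  have "index_sum V \<gamma> A * index_sum W \<gamma> A =
     (\<Sum>(r,r') \<in> (V \<rightarrow>\<^sub>E UNIV) \<times> (W \<rightarrow>\<^sub>E UNIV).
        (\<Prod>k\<in>V. A k $ r k $ r (\<gamma> k)) * (\<Prod>k\<in>W. A k $ r' k $ r' (\<gamma> k)))"
    by (simp add: index_sum_def sum_product sum.cartesian_product)
  also have "\<dots> = index_sum (V \<union> W) \<gamma> A" unfolding index_sum_def
  proof (rule sum.reindex_bij_witness[where
        j="\<lambda>(r,r'). \<lambda>k. if k \<in> V then r k else r' k"
        and i="\<lambda>r. (restrict r V, restrict r W)"])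
    fix rr :: "('a \<Rightarrow> 'n) \<times> ('a \<Rightarrow> 'n)" assume "rr \<in> (V \<rightarrow>\<^sub>E UNIV) \<times> (W \<rightarrow>\<^sub>E UNIV)"
    then obtain r r' where rr: "rr = (r,r')" "r \<in> V \<rightarrow>\<^sub>E UNIV" "r' \<in> W \<rightarrow>\<^sub>E UNIV" by auto
    let ?s = "\<lambda>k. if k \<in> V then r k else r' k"
    show "(restrict (case rr of (r,r') \<Rightarrow> \<lambda>k. if k \<in> V then r k else r' k) V,
        restrict (case rr of (r,r') \<Rightarrow> \<lambda>k. if k \<in> V then r k else r' k) W) = rr"
      using rr disj by (auto simp: fun_eq_iff PiE_def extensional_def)
    show "(case rr of (r,r') \<Rightarrow> \<lambda>k. if k \<in> V then r k else r' k) \<in> V \<union> W \<rightarrow>\<^sub>E UNIV"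
      using rr by (auto simp: PiE_def extensional_def)
    have notV: "k \<notin> V" if "k \<in> W" for k using that disj by auto
    have "(\<Prod>k\<in>V \<union> W. A k $ ?s k $ ?s (\<gamma> k)) = (\<Prod>k\<in>V. A k $ ?s k $ ?s (\<gamma> k)) * (\<Prod>k\<in>W. A k $ ?s k $ ?s (\<gamma> k))"
      using fin disj by (rule prod.union_disjoint)
    also have "\<dots> = (\<Prod>k\<in>V. A k $ r k $ r (\<gamma> k)) * (\<Prod>k\<in>W. A k $ r' k $ r' (\<gamma> k))"
      by (intro arg_cong2[where f="(*)"] prod.cong) (use V W notV in auto)
    finally show "(\<Prod>k\<in>V \<union> W. A k $ (case rr of (r,r') \<Rightarrow> \<lambda>k. if k \<in> V then r k else r' k) k $
        (case rr of (r,r') \<Rightarrow> \<lambda>k. if k \<in> V then r k else r' k) (\<gamma> k)) =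
        (case rr of (r, r') \<Rightarrow> (\<Prod>k\<in>V. A k $ r k $ r (\<gamma> k)) * (\<Prod>k\<in>W. A k $ r' k $ r' (\<gamma> k)))"
      using rr by simp
  next
    fix r :: "'a \<Rightarrow> 'n" assume r: "r \<in> V \<union> W \<rightarrow>\<^sub>E UNIV"
    show "(case (restrict r V, restrict r W) of (r,r') \<Rightarrow> \<lambda>k. if k \<in> V then r k else r' k) = r"
      using r by (auto simp: fun_eq_iff PiE_def extensional_def)
    show "(restrict r V, restrict r W) \<in> (V \<rightarrow>\<^sub>E UNIV) \<times> (W \<rightarrow>\<^sub>E UNIV)" by auto
  qed
  finally show ?thesis ..
qed

lemma index_sum_Union:
  assumes "finite \<C>" and "\<And>C. C \<in> \<C> \<Longrightarrow> finite C" and "disjoint \<C>"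
    and "\<And>C k. C \<in> \<C> \<Longrightarrow> k \<in> C \<Longrightarrow> \<gamma> k \<in> C"
  shows "index_sum (\<Union>\<C>) \<gamma> (A :: _ \<Rightarrow> complex^'n^'n) = (\<Prod>C\<in>\<C>. index_sum C \<gamma> A)"
  using assms
proof (induction \<C> rule: finite_induct)
  case empty
  then show ?case by (simp add: index_sum_def)
next
  case (insert C \<C>)
  have "C \<inter> \<Union>\<C> = {}"
    using insert.prems(2) insert.hyps(2) by (auto simp: disjoint_def)
  then have "index_sum (C \<union> \<Union>\<C>) \<gamma> A = index_sum C \<gamma> A * index_sum (\<Union>\<C>) \<gamma> A"
  proof (intro index_sum_Un)
    show "\<gamma> k \<in> \<Union>\<C>" if "k \<in> \<Union>\<C>" for k using that insert.prems(3) by blast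
    show "\<gamma> k \<in> C" if "k \<in> C" for k using that insert.prems(3) by blast
    show "finite C" "finite (\<Union>\<C>)" using insert.prems(1) insert.hyps(1) by blast+
  qed
  moreover have "index_sum (\<Union>\<C>) \<gamma> A = (\<Prod>C\<in>\<C>. index_sum C \<gamma> A)"
  proof (rule insert.IH)
    show "finite D" if "D \<in> \<C>" for D using that insert.prems(1) by blast
    show "disjoint \<C>" using insert.prems(2) by (auto simp: disjoint_def)
    show "\<gamma> k \<in> D" if "D \<in> \<C>" "k \<in> D" for D k using that insert.prems(3) by blast
  qed
  ultimately show ?case using insert.hyps by simp
qed

lemma sum_PiE_insert:
  assumes "x \<notin> S"
  shows "(\<Sum>r \<in> PiE (insert x S) T. f r) = (\<Sum>y\<in>T x. \<Sum>r \<in> PiE S T. f (r(x := y)))"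
proof -
  have "(\<Sum>r \<in> PiE (insert x S) T. f r) = (\<Sum>(y,r) \<in> T x \<times> PiE S T. f (r(x := y)))"
    unfolding PiE_insert_eq
    by (subst sum.reindex) (use inj_combinator[OF assms] in \<open>auto simp: case_prod_unfold\<close>)
  then show ?thesis by (simp add: sum.cartesian_product)
qed

lemma mat_prod_list_snoc: "mat_prod_list (As @ [B]) = mat_prod_list As ** B"
proof -
  have "foldr (**) As C = foldr (**) As (mat 1) ** C" for C
    by (induction As) (simp_all, metis matrix_mul_assoc)
  from this[of B] show ?thesis by (simp add: mat_prod_list_def)
qed

text \<open>An open chain of matrices: \<open>r j\<close> for \<open>j < m\<close> are the row indices, and the final column index
  \<open>b\<close> is placed at position \<open>m\<close> by the update, so that the product is uniform in \<open>j\<close>.\<close>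

lemma mat_prod_list_entry:
  fixes A :: "nat \<Rightarrow> complex^'n^'n"
  assumes "0 < m"
  shows "mat_prod_list (map A [0..<m]) $ a $ b =
    (\<Sum>r \<in> {0..<m} \<rightarrow>\<^sub>E UNIV. (if r 0 = a then 1 else 0) * (\<Prod>j<m. A j $ r j $ (r(m := b)) (Suc j)))"
  using assms
proof (induction m arbitrary: b rule: nat_induct_non_zero)
  case 1
  have "{0..<Suc 0} = insert 0 {}" by auto
  then show ?case
    by (simp add: sum_PiE_insert mat_prod_list_def if_distrib[of "\<lambda>x. x * _"] cong: if_cong)
next
  case (Suc m)
  have ins: "{0..<Suc m} = insert m {0..<m}" by auto
  have "mat_prod_list (map A [0..<Suc m]) $ a $ b
     = (\<Sum>c\<in>UNIV. mat_prod_list (map A [0..<m]) $ a $ c * A m $ c $ b)"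
    by (simp add: mat_prod_list_snoc matrix_matrix_mult_def)
  also have "\<dots> = (\<Sum>c\<in>UNIV. \<Sum>r \<in> {0..<m} \<rightarrow>\<^sub>E UNIV. (if r 0 = a then 1 else 0) *
       ((\<Prod>j<m. A j $ r j $ (r(m := c)) (Suc j)) * A m $ c $ b))"
    by (simp add: Suc.IH sum_distrib_right mult.assoc)
  also have "\<dots> = (\<Sum>c\<in>UNIV. \<Sum>r \<in> {0..<m} \<rightarrow>\<^sub>E UNIV. (if (r(m:=c)) 0 = a then 1 else 0) *
       (\<Prod>j<Suc m. A j $ (r(m := c)) j $ ((r(m:=c))(Suc m := b)) (Suc j)))"
    using Suc.hyps by (intro sum.cong refl) (auto intro!: prod.cong)
  also have "\<dots> = (\<Sum>r \<in> {0..<Suc m} \<rightarrow>\<^sub>E UNIV. (if r 0 = a then 1 else 0) *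
       (\<Prod>j<Suc m. A j $ r j $ (r(Suc m := b)) (Suc j)))"
    unfolding ins by (subst sum_PiE_insert) auto
  finally show ?case .
qed

lemma trace_mat_prod_list:
  fixes A :: "nat \<Rightarrow> complex^'n^'n"
  assumes m: "0 < m"
  shows "trace (mat_prod_list (map A [0..<m])) = index_sum {0..<m} (\<lambda>j. Suc j mod m) A"
proof -
  have "trace (mat_prod_list (map A [0..<m])) =
    (\<Sum>r \<in> {0..<m} \<rightarrow>\<^sub>E UNIV. \<Sum>a\<in>UNIV. (if r 0 = a then 1 else 0) * (\<Prod>j<m. A j $ r j $ (r(m := a)) (Suc j)))"
    unfolding trace_def mat_prod_list_entry[OF m] by (rule sum.swap)
  also have "\<dots> = (\<Sum>r \<in> {0..<m} \<rightarrow>\<^sub>E UNIV. (\<Prod>j<m. A j $ r j $ (r(m := r 0)) (Suc j)))"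
    by (simp add: if_distrib[of "\<lambda>x. x * _"] cong: if_cong)
  also have "\<dots> = index_sum {0..<m} (\<lambda>j. Suc j mod m) A"
    unfolding index_sum_def
  proof (intro sum.cong prod.cong refl)
    fix r :: "nat \<Rightarrow> 'n" and j assume "j \<in> {0..<m}"
    then consider "Suc j < m" | "Suc j = m" by force
    then have "(r(m := r 0)) (Suc j) = r (Suc j mod m)" by cases auto
    then show "A j $ r j $ (r(m := r 0)) (Suc j) = A j $ r j $ r (Suc j mod m)" by simp
  qed auto
  finally show ?thesis .
qed

lemma index_sum_orbit:
  fixes A :: "'k \<Rightarrow> complex^'n^'n"
  assumes x: "x \<in> orbit \<gamma> x"
  shows "index_sum (orbit \<gamma> x) \<gamma> A = trace (mat_prod_list (map (\<lambda>j. A ((\<gamma> ^^ j) x)) [0..<card (orbit \<gamma> x)]))"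
proof -
  define m where "m = funpow_dist1 \<gamma> x x"
  have im: "orbit \<gamma> x = (\<lambda>j. (\<gamma> ^^ j) x) ` {0..<m}" unfolding m_def by (rule orbit_conv_funpow_dist1[OF x])
  have inj: "inj_on (\<lambda>j. (\<gamma> ^^ j) x) {0..<m}" unfolding m_def by (rule inj_on_funpow_dist1[OF x])
  have card: "card (orbit \<gamma> x) = m" by (simp add: im card_image[OF inj])
  have pm: "(\<gamma> ^^ m) x = x" unfolding m_def by (rule funpow_dist1_prop[OF x])
  have m: "0 < m" by (simp add: m_def)
  have "index_sum (orbit \<gamma> x) \<gamma> A = index_sum {0..<m} (\<lambda>j. Suc j mod m) (A \<circ> (\<lambda>j. (\<gamma> ^^ j) x))"
  proof (rule index_sum_reindex)
    show "bij_betw (\<lambda>j. (\<gamma> ^^ j) x) {0..<m} (orbit \<gamma> x)" using im inj by (simp add: bij_betw_def)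
    fix j assume "j \<in> {0..<m}"
    then consider "Suc j < m" | "Suc j = m" by force
    then show "(\<gamma> ^^ (Suc j mod m)) x = \<gamma> ((\<gamma> ^^ j) x)"
    proof cases
      case 2
      have "\<gamma> ((\<gamma> ^^ j) x) = x" using pm unfolding 2[symmetric] by simp
      then show ?thesis using 2 by simp
    qed auto
  qed (use m in auto)
  also have "\<dots> = trace (mat_prod_list (map (A \<circ> (\<lambda>j. (\<gamma> ^^ j) x)) [0..<m]))"
    by (rule trace_mat_prod_list[OF m, symmetric])
  finally show ?thesis by (simp add: card comp_def)
qed

text \<open>A trace against this matrix unit reads off the entry at \<open>(a, b)\<close>, which turns the open product
  along the cycle of \<open>0\<close> into a trace.\<close>

definition unit_mat :: "'n \<Rightarrow> 'n \<Rightarrow> complex^'n^'n" where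
  "unit_mat b a = (\<chi> i j. if i = b \<and> j = a then 1 else 0)"

lemma trace_unit_mat: "trace (unit_mat b a ** B) = B $ a $ b"
proof -
  have "trace (unit_mat b a ** B) = (\<Sum>i\<in>UNIV. \<Sum>k\<in>UNIV. (if i = b then if k = a then B $ k $ i else 0 else 0))"
    by (auto simp: trace_def matrix_matrix_mult_def unit_mat_def intro!: sum.cong)
  also have "\<dots> = (\<Sum>i\<in>UNIV. if i = b then B $ a $ i else 0)" by (intro sum.cong) auto
  finally show ?thesis by simp
qed

lemma permutes_in_orbit:
  assumes "\<gamma> permutes V" "finite V" shows "x \<in> orbit \<gamma> x"
proof (rule permutation_self_in_orbit)
  show "permutation \<gamma>" unfolding permutation_permutes using assms by blast
qed

text \<open>With the matrix unit placed at \<open>0\<close>, every orbit contributes the trace of a cyclic product, and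
  the sum over index assignments factorizes over the orbits.\<close>

lemma Tr_perm_entry:
  fixes A :: "nat \<Rightarrow> complex^'n^'n"
  assumes perm: "\<gamma> permutes {0..n}"
  shows "Tr_perm n \<gamma> A $ a $ b = index_sum {0..n} \<gamma> (A(0 := unit_mat b a))"
proof -
  let ?A = "A(0 := unit_mat b a)"
  have self: "x \<in> orbit \<gamma> x" for x by (rule permutes_in_orbit[OF perm]) simp
  have sub: "orbit \<gamma> x \<subseteq> {0..n}" if "x \<in> {0..n}" for x using permutes_orbit_subset[OF perm that] .
  have fin: "finite (orbit \<gamma> x)" if "x \<in> {0..n}" for x using sub[OF that] finite_subset by blast
  have eqI: "orbit \<gamma> y = orbit \<gamma> x" if "y \<in> orbit \<gamma> x" for x y
    by (rule orbit_cyclic_eq3[OF cyclic_on_orbit[OF perm] that]) simp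
  have cyc: "cycles0 {0..n} \<gamma> = {C \<in> orbit \<gamma> ` {0..n}. 0 \<notin> C}" by (auto simp: cycles0_def)
  have im: "orbit \<gamma> ` {0..n} = insert (orbit \<gamma> 0) (cycles0 {0..n} \<gamma>)"
  proof (intro equalityI subsetI)
    fix C assume "C \<in> orbit \<gamma> ` {0..n}"
    then obtain x where x: "x \<in> {0..n}" "C = orbit \<gamma> x" by blast
    show "C \<in> insert (orbit \<gamma> 0) (cycles0 {0..n} \<gamma>)"
    proof (cases "0 \<in> C")
      case True
      then show ?thesis using eqI[of 0 x] x by simp
    next
      case False
      then show ?thesis using x by (auto simp: cyc)
    qed
  qed (auto simp: cyc)
  have notin: "orbit \<gamma> 0 \<notin> cycles0 {0..n} \<gamma>" using self by (auto simp: cyc)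
  have fincyc: "finite (cycles0 {0..n} \<gamma>)" by (simp add: cyc)
  have un: "\<Union>(orbit \<gamma> ` {0..n}) = {0..n}" using self sub by blast
  have disj: "disjoint (orbit \<gamma> ` {0..n})"
  proof (rule disjointI, rule ccontr)
    fix C D assume "C \<in> orbit \<gamma> ` {0..n}" "D \<in> orbit \<gamma> ` {0..n}" and ne: "C \<noteq> D" "C \<inter> D \<noteq> {}"
    then obtain x y where xy: "C = orbit \<gamma> x" "D = orbit \<gamma> y" by blast
    obtain z where "z \<in> C" "z \<in> D" using ne by blast
    then show False using ne(1) eqI[of z x] eqI[of z y] xy by simp
  qed
  have "index_sum {0..n} \<gamma> ?A = (\<Prod>C\<in>orbit \<gamma> ` {0..n}. index_sum C \<gamma> ?A)"
    by (subst un[symmetric], rule index_sum_Union) (use fin disj in \<open>auto intro: orbit.step\<close>)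
  also have "\<dots> = index_sum (orbit \<gamma> 0) \<gamma> ?A * (\<Prod>C\<in>cycles0 {0..n} \<gamma>. index_sum C \<gamma> ?A)"
    unfolding im using notin fincyc by simp
  also have "index_sum (orbit \<gamma> 0) \<gamma> ?A = mat_prod_list (map (\<lambda>j. A ((\<gamma> ^^ j) 0)) [1..<card (orbit \<gamma> 0)]) $ a $ b"
  proof -
    define m where "m = card (orbit \<gamma> 0)"
    have "0 < m" using self fin[of 0] by (auto simp: m_def card_gt_0_iff)
    then have up: "[0..<m] = 0 # [1..<m]" by (simp add: upt_conv_Cons)
    have nz: "(\<gamma> ^^ j) 0 \<noteq> 0" if "j \<in> {1..<m}" for j
    proof
      assume "(\<gamma> ^^ j) 0 = 0"
      moreover have "m = funpow_dist1 \<gamma> 0 0"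
        using arg_cong[OF orbit_conv_funpow_dist1[OF self, of 0], of card]
          card_image[OF inj_on_funpow_dist1[OF self, of 0]] unfolding m_def by simp
      ultimately show False using funpow_dist1_least[of j \<gamma> 0 0] that by auto
    qed
    have "index_sum (orbit \<gamma> 0) \<gamma> ?A = trace (mat_prod_list (map (\<lambda>j. ?A ((\<gamma> ^^ j) 0)) [0..<m]))"
      unfolding m_def by (rule index_sum_orbit[OF self])
    also have "map (\<lambda>j. ?A ((\<gamma> ^^ j) 0)) [0..<m] = unit_mat b a # map (\<lambda>j. A ((\<gamma> ^^ j) 0)) [1..<m]"
    proof -
      have "map (\<lambda>j. ?A ((\<gamma> ^^ j) 0)) [1..<m] = map (\<lambda>j. A ((\<gamma> ^^ j) 0)) [1..<m]"
        by (intro map_cong refl fun_upd_other nz) simp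
      then show ?thesis unfolding up by simp
    qed
    also have "trace (mat_prod_list \<dots>) = mat_prod_list (map (\<lambda>j. A ((\<gamma> ^^ j) 0)) [1..<m]) $ a $ b"
      by (simp add: mat_prod_list_def trace_unit_mat)
    finally show ?thesis unfolding m_def .
  qed
  also have "(\<Prod>C\<in>cycles0 {0..n} \<gamma>. index_sum C \<gamma> ?A) =
    (\<Prod>C\<in>cycles0 {0..n} \<gamma>. trace (mat_prod_list (map (\<lambda>j. A ((\<gamma> ^^ j) (Min C))) [0..<card C])))"
  proof (rule prod.cong[OF refl])
    fix C assume C: "C \<in> cycles0 {0..n} \<gamma>"
    then obtain x where x: "x \<in> {0..n}" "C = orbit \<gamma> x" "0 \<notin> C" by (auto simp: cyc)
    have "Min C \<in> C" using x fin[of x] self[of x] by (intro Min_in) auto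
    then have CM: "C = orbit \<gamma> (Min C)" using eqI x by simp
    have pow: "(\<gamma> ^^ j) (Min C) \<noteq> 0" for j
    proof -
      have "(\<gamma> ^^ j) (Min C) \<in> orbit \<gamma> (Min C)" using self by (rule funpow_in_orbit)
      then show ?thesis using CM x(3) by metis
    qed
    have "index_sum C \<gamma> ?A = trace (mat_prod_list (map (\<lambda>j. ?A ((\<gamma> ^^ j) (Min C))) [0..<card C]))"
      using index_sum_orbit[OF self, of "Min C" ?A] CM by simp
    then show "index_sum C \<gamma> ?A = trace (mat_prod_list (map (\<lambda>j. A ((\<gamma> ^^ j) (Min C))) [0..<card C]))"
      by (simp add: pow)
  qed
  finally have "index_sum {0..n} \<gamma> ?A = Tr_perm n \<gamma> A $ a $ b"
    by (simp only: Tr_perm_def map_matrix_def vec_lambda_beta mult.commute)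
  then show ?thesis ..
qed

section \<open>Deleting points from a permutation\<close>

text \<open>The first point outside \<open>S\<close> on the forward path of \<open>x\<close>, where \<open>x\<close> itself counts.  For \<open>x\<close>
  outside \<open>S\<close>, the restricted permutation sends \<open>x\<close> to the first point outside \<open>S\<close> seen from \<open>\<gamma> x\<close>.\<close>

definition first_out :: "nat set \<Rightarrow> (nat \<Rightarrow> nat) \<Rightarrow> nat \<Rightarrow> nat" where
  "first_out S \<gamma> x = (\<gamma> ^^ (LEAST j. (\<gamma> ^^ j) x \<notin> S)) x"

lemma first_out_outside: "x \<notin> S \<Longrightarrow> first_out S \<gamma> x = x"
  by (simp add: first_out_def)

lemma first_out_step:
  assumes "x \<in> S" "(\<gamma> ^^ j) x \<notin> S"
  shows "first_out S \<gamma> (\<gamma> x) = first_out S \<gamma> x"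
proof -
  have "(LEAST j. (\<gamma> ^^ j) x \<notin> S) = Suc (LEAST j. (\<gamma> ^^ Suc j) x \<notin> S)"
    by (rule Least_Suc[where n=j]) (use assms in auto)
  then show ?thesis by (simp add: first_out_def funpow_swap1)
qed

lemma restrict_compl_eq_first_out:
  assumes "x \<notin> S" "0 < j" "(\<gamma> ^^ j) x \<notin> S"
  shows "restrict_compl S \<gamma> x = first_out S \<gamma> (\<gamma> x)"
proof -
  have "(LEAST j. 0 < j \<and> (\<gamma> ^^ j) x \<notin> S) = Suc (LEAST j. 0 < Suc j \<and> (\<gamma> ^^ Suc j) x \<notin> S)"
    by (rule Least_Suc[where n=j]) (use assms in auto)
  then show ?thesis using assms(1) by (simp add: first_out_def restrict_compl_def funpow_swap1)
qed

lemma first_out_notin: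
  assumes "(\<gamma> ^^ j) x \<notin> S" shows "first_out S \<gamma> x \<notin> S"
  unfolding first_out_def by (rule LeastI[where P="\<lambda>j. (\<gamma> ^^ j) x \<notin> S", OF assms])

locale permutation_deletion =
  fixes V S :: "nat set" and \<gamma> :: "nat \<Rightarrow> nat"
  assumes fin: "finite V" and perm: "\<gamma> permutes V" and SV: "S \<subseteq> V"
begin

lemma self_in_orbit: "x \<in> orbit \<gamma> x" by (rule permutes_in_orbit[OF perm fin])

lemma orbit_eqI: "y \<in> orbit \<gamma> x \<Longrightarrow> orbit \<gamma> y = orbit \<gamma> x"
  by (rule orbit_cyclic_eq3[OF cyclic_on_orbit[OF perm fin]])

lemma orbit_apply: "orbit \<gamma> (\<gamma> x) = orbit \<gamma> x"
  by (intro orbit_eqI orbit.base)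

lemma orbit_sub: "x \<in> V \<Longrightarrow> orbit \<gamma> x \<subseteq> V"
  by (rule permutes_orbit_subset[OF perm])

lemma in_orbitD: "y \<in> orbit \<gamma> x \<Longrightarrow> \<exists>j>0. y = (\<gamma> ^^ j) x"
  by (auto simp: orbit_altdef)

lemma escapes: "\<not> orbit \<gamma> x \<subseteq> S \<Longrightarrow> \<exists>j. (\<gamma> ^^ j) x \<notin> S"
  using in_orbitD by blast

lemma first_out_in_orbit: "first_out S \<gamma> x \<in> orbit \<gamma> x"
  unfolding first_out_def by (rule funpow_in_orbit[OF self_in_orbit])

lemma first_out_mem:
  assumes "x \<in> V" "\<not> orbit \<gamma> x \<subseteq> S" shows "first_out S \<gamma> x \<in> V - S"
  using assms escapes[OF assms(2)] first_out_notin first_out_in_orbit orbit_sub by blast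

lemma restrict_compl_first_out:
  assumes "x \<notin> S" shows "restrict_compl S \<gamma> x = first_out S \<gamma> (\<gamma> x)"
proof -
  obtain j where "0 < j" "x = (\<gamma> ^^ j) x" using in_orbitD[OF self_in_orbit] by blast
  then show ?thesis using restrict_compl_eq_first_out[of x S j \<gamma>] assms by simp
qed

lemma not_orbit_sub: "x \<notin> S \<Longrightarrow> \<not> orbit \<gamma> x \<subseteq> S"
  using self_in_orbit by blast

lemma restrict_compl_mem:
  assumes "x \<in> V - S" shows "restrict_compl S \<gamma> x \<in> V - S" "restrict_compl S \<gamma> x \<in> orbit \<gamma> x"
proof -
  have "\<not> orbit \<gamma> (\<gamma> x) \<subseteq> S" using not_orbit_sub assms by (simp add: orbit_apply)
  moreover have "\<gamma> x \<in> V" using assms perm by (simp add: permutes_in_image)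
  ultimately show "restrict_compl S \<gamma> x \<in> V - S"
    using first_out_mem assms restrict_compl_first_out by simp
  show "restrict_compl S \<gamma> x \<in> orbit \<gamma> x"
    using first_out_in_orbit[of "\<gamma> x"] assms restrict_compl_first_out by (simp add: orbit_apply)
qed

text \<open>A return to the complement of \<open>S\<close> after \<open>j\<close> steps passes through the first return, so that
  induction on \<open>j\<close> reaches every point of the orbit outside \<open>S\<close>.\<close>

lemma orbit_restrict_compl:
  assumes "x \<in> V - S"
  shows "orbit (restrict_compl S \<gamma>) x = orbit \<gamma> x - S"
proof (intro equalityI subsetI)
  fix y assume "y \<in> orbit (restrict_compl S \<gamma>) x"
  then have "y \<in> V - S \<and> y \<in> orbit \<gamma> x"
  proof induction
    case base
    then show ?case using restrict_compl_mem[OF assms] by blast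
  next
    case (step y)
    then show ?case using restrict_compl_mem[of y] orbit_eqI[of y x] by blast
  qed
  then show "y \<in> orbit \<gamma> x - S" by blast
next
  have "(\<gamma> ^^ j) x \<in> orbit (restrict_compl S \<gamma>) x" if "0 < j" "(\<gamma> ^^ j) x \<notin> S" "x \<in> V - S" for j x
    using that
  proof (induction j arbitrary: x rule: less_induct)
    case (less j)
    define m where "m = (LEAST j. 0 < j \<and> (\<gamma> ^^ j) x \<notin> S)"
    have m: "0 < m \<and> (\<gamma> ^^ m) x \<notin> S" unfolding m_def by (rule LeastI[where k=j]) (use less.prems in blast)
    have mj: "m \<le> j" unfolding m_def by (rule Least_le) (use less.prems in blast)
    have \<beta>: "restrict_compl S \<gamma> x = (\<gamma> ^^ m) x" using less.prems by (simp add: restrict_compl_def m_def)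
    show ?case
    proof (cases "j = m")
      case True
      then show ?thesis using \<beta> orbit.base[of "restrict_compl S \<gamma>" x] by simp
    next
      case False
      have split: "(\<gamma> ^^ j) x = (\<gamma> ^^ (j - m)) (restrict_compl S \<gamma> x)"
        unfolding \<beta> using mj by (metis add_diff_cancel_left' comp_apply funpow_add le_add_diff_inverse2)
      have "(\<gamma> ^^ (j - m)) (restrict_compl S \<gamma> x) \<in> orbit (restrict_compl S \<gamma>) (restrict_compl S \<gamma> x)"
        by (rule less.IH) (use m mj False less.prems split restrict_compl_mem in auto)
      then show ?thesis unfolding split by (rule orbit_trans) (rule orbit.base)
    qed
  qed
  then show "y \<in> orbit (restrict_compl S \<gamma>) x" if "y \<in> orbit \<gamma> x - S" for y
    using that in_orbitD assms by blast
qed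

lemma restrict_compl_permutes: "restrict_compl S \<gamma> permutes V - S"
proof (rule bij_imp_permutes)
  have "V - S \<subseteq> restrict_compl S \<gamma> ` (V - S)"
  proof
    fix x assume x: "x \<in> V - S"
    then have "x \<in> orbit (restrict_compl S \<gamma>) x" using orbit_restrict_compl self_in_orbit by blast
    then show "x \<in> restrict_compl S \<gamma> ` (V - S)"
    proof cases
      case base
      then show ?thesis using x by auto
    next
      case (step y)
      then have "y \<in> V - S" using orbit_restrict_compl[OF x] orbit_sub x by blast
      then show ?thesis using step by blast
    qed
  qed
  then have "restrict_compl S \<gamma> ` (V - S) = V - S" using restrict_compl_mem by blast
  then show "bij_betw (restrict_compl S \<gamma>) (V - S) (V - S)"
    using fin by (simp add: bij_betw_def finite_surj_inj)
next
  fix x assume "x \<notin> V - S"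
  then consider "x \<in> S" | "x \<notin> S" "x \<notin> V" by blast
  then show "restrict_compl S \<gamma> x = x"
  proof cases
    case 2
    then have "\<gamma> x = x" using perm by (simp add: permutes_not_in)
    then show ?thesis using 2 restrict_compl_first_out first_out_outside by simp
  qed (simp add: restrict_compl_def)
qed

text \<open>A cycle either disappears inside \<open>S\<close> or survives as its part outside \<open>S\<close>, and different cycles have
  different surviving parts.\<close>

lemma cyc0_restrict_compl:
  assumes "0 \<notin> S"
  shows "cyc0 V \<gamma> = card {C \<in> orbit \<gamma> ` V. C \<subseteq> S} + cyc0 (V - S) (restrict_compl S \<gamma>)"
proof -
  let ?L = "{C \<in> orbit \<gamma> ` V. C \<subseteq> S}" and ?K = "{C \<in> orbit \<gamma> ` V. 0 \<notin> C \<and> \<not> C \<subseteq> S}"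
  have "cycles0 V \<gamma> = ?L \<union> ?K" using assms by (auto simp: cycles0_def)
  then have "cyc0 V \<gamma> = card ?L + card ?K"
    unfolding cyc0_def using fin by (simp, subst card_Un_disjoint) auto
  moreover have "bij_betw (\<lambda>C. C - S) ?K (cycles0 (V - S) (restrict_compl S \<gamma>))"
  proof (rule bij_betw_imageI)
    show "inj_on (\<lambda>C. C - S) ?K"
    proof (rule inj_onI)
      fix C D assume C: "C \<in> ?K" and D: "D \<in> ?K" and eq: "C - S = D - S"
      then obtain z where "z \<in> C - S" "z \<in> D - S" by blast
      then show "C = D" using C D orbit_eqI by blast
    qed
    show "(\<lambda>C. C - S) ` ?K = cycles0 (V - S) (restrict_compl S \<gamma>)"
    proof (intro equalityI subsetI)
      fix D assume "D \<in> (\<lambda>C. C - S) ` ?K"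
      then obtain x where x: "x \<in> V" "0 \<notin> orbit \<gamma> x" "\<not> orbit \<gamma> x \<subseteq> S" "D = orbit \<gamma> x - S" by blast
      then obtain z where z: "z \<in> orbit \<gamma> x" "z \<notin> S" by blast
      then have "z \<in> V - S" "orbit \<gamma> z = orbit \<gamma> x" using orbit_sub orbit_eqI x by blast+
      then show "D \<in> cycles0 (V - S) (restrict_compl S \<gamma>)"
        using x orbit_restrict_compl[of z] unfolding cycles0_def by blast
    next
      fix D assume "D \<in> cycles0 (V - S) (restrict_compl S \<gamma>)"
      then obtain x where x: "x \<in> V - S" "D = orbit \<gamma> x - S" "0 \<notin> D"
        unfolding cycles0_def using orbit_restrict_compl by auto
      then have "orbit \<gamma> x \<in> ?K" using assms not_orbit_sub by auto
      then show "D \<in> (\<lambda>C. C - S) ` ?K" using x by blast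
    qed
  qed
  ultimately show ?thesis unfolding cyc0_def by (simp add: bij_betw_same_card)
qed

text \<open>An identity matrix at \<open>k\<close> forces \<open>r k = r (\<gamma> k)\<close>.  Hence an index assignment that contributes is
  determined by its values outside \<open>S\<close>, each propagated backwards through \<open>S\<close>, together with one
  free value for every cycle contained in \<open>S\<close>.\<close>

lemma index_sum_identity_on:
  fixes A :: "nat \<Rightarrow> complex^'n^'n"
  shows "index_sum V \<gamma> (\<lambda>k. if k \<in> S then mat 1 else A k) =
    of_nat (CARD('n) ^ card {C \<in> orbit \<gamma> ` V. C \<subseteq> S}) * index_sum (V - S) (restrict_compl S \<gamma>) A"
proof -
  let ?L = "{C \<in> orbit \<gamma> ` V. C \<subseteq> S}" and ?\<beta> = "restrict_compl S \<gamma>"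
  define R where "R = {r \<in> V \<rightarrow>\<^sub>E (UNIV::'n set). \<forall>k\<in>S. r k = r (\<gamma> k)}"
  have finS: "finite S" using fin SV by (rule rev_finite_subset)
  have "index_sum V \<gamma> (\<lambda>k. if k \<in> S then mat 1 else A k) =
     (\<Sum>r \<in> V \<rightarrow>\<^sub>E UNIV. (\<Prod>k\<in>S. mat 1 $ r k $ r (\<gamma> k)) * (\<Prod>k\<in>V - S. A k $ r k $ r (\<gamma> k)))"
    unfolding index_sum_def using fin SV
    by (intro sum.cong refl) (simp add: prod.subset_diff mult.commute)
  also have "\<dots> = (\<Sum>r\<in>V \<rightarrow>\<^sub>E UNIV. if r \<in> R then (\<Prod>k\<in>V - S. A k $ r k $ r (\<gamma> k)) else 0)"
  proof (rule sum.cong[OF refl])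
    fix r :: "nat \<Rightarrow> 'n" assume r: "r \<in> V \<rightarrow>\<^sub>E UNIV"
    have "(\<Prod>k\<in>S. (mat 1 :: complex^'n^'n) $ r k $ r (\<gamma> k)) = (\<Prod>k\<in>S. if r k = r (\<gamma> k) then 1 else 0)"
      by (simp add: mat_def)
    also have "\<dots> = (if r \<in> R then 1 else 0)"
      using r finS by (auto simp: R_def)
    finally show "(\<Prod>k\<in>S. mat 1 $ r k $ r (\<gamma> k)) * (\<Prod>k\<in>V - S. A k $ r k $ r (\<gamma> k)) =
      (if r \<in> R then (\<Prod>k\<in>V - S. A k $ r k $ r (\<gamma> k)) else 0)" by simp
  qed
  also have "\<dots> = (\<Sum>r\<in>R. (\<Prod>k\<in>V - S. A k $ r k $ r (\<gamma> k)))"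
  proof -
    have "(V \<rightarrow>\<^sub>E UNIV) \<inter> R = R" by (auto simp: R_def)
    moreover have "finite (V \<rightarrow>\<^sub>E (UNIV::'n set))" using fin by (intro finite_PiE) auto
    ultimately show ?thesis by (simp flip: sum.inter_restrict)
  qed
  also have "\<dots> = (\<Sum>(c,r) \<in> (?L \<rightarrow>\<^sub>E (UNIV::'n set)) \<times> ((V - S) \<rightarrow>\<^sub>E UNIV). \<Prod>k\<in>V - S. A k $ r k $ r (?\<beta> k))"
  proof (rule sum.reindex_bij_witness[where
      i="\<lambda>(c,r'). restrict (\<lambda>k. if orbit \<gamma> k \<subseteq> S then c (orbit \<gamma> k) else r' (first_out S \<gamma> k)) V" and
      j="\<lambda>r. (restrict (\<lambda>C. r (SOME k. k \<in> C)) ?L, restrict r (V - S))"])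
    fix r assume r: "r \<in> R"
    then have rS: "r k = r (\<gamma> k)" if "k \<in> S" for k using that by (auto simp: R_def)
    have const: "r y = r x" if "y \<in> orbit \<gamma> x" "orbit \<gamma> x \<subseteq> S" for x y
      using that
    proof induction
      case base
      then show ?case using rS[of x] self_in_orbit[of x] by auto
    next
      case (step y)
      then show ?case using rS[of y] by auto
    qed
    have out: "r (first_out S \<gamma> x) = r x" for x
    proof -
      have "r ((\<gamma> ^^ j) x) = r x" if "j \<le> (LEAST j. (\<gamma> ^^ j) x \<notin> S)" for j
        using that
      proof (induction j)
        case (Suc j)
        have "(\<gamma> ^^ j) x \<in> S" using not_less_Least[of j "\<lambda>j. (\<gamma> ^^ j) x \<notin> S"] Suc.prems by simp
        then show ?case using rS[of "(\<gamma> ^^ j) x"] Suc by simp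
      qed simp
      then show ?thesis unfolding first_out_def by blast
    qed
    have some: "(SOME k. k \<in> orbit \<gamma> x) \<in> orbit \<gamma> x" for x using self_in_orbit[of x] by (rule someI)
    show "(case (restrict (\<lambda>C. r (SOME k. k \<in> C)) ?L, restrict r (V - S)) of (c, r') \<Rightarrow>
        restrict (\<lambda>k. if orbit \<gamma> k \<subseteq> S then c (orbit \<gamma> k) else r' (first_out S \<gamma> k)) V) = r"
    proof
      fix k
      show "(case (restrict (\<lambda>C. r (SOME k. k \<in> C)) ?L, restrict r (V - S)) of (c, r') \<Rightarrow>
        restrict (\<lambda>k. if orbit \<gamma> k \<subseteq> S then c (orbit \<gamma> k) else r' (first_out S \<gamma> k)) V) k = r k"
      proof (cases "k \<in> V")
        case False
        then show ?thesis using r by (auto simp: R_def PiE_def extensional_def)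
      next
        case True
        then show ?thesis using const[OF some[of k]] out[of k] first_out_mem[of k] by auto
      qed
    qed
    show "(restrict (\<lambda>C. r (SOME k. k \<in> C)) ?L, restrict r (V - S)) \<in> (?L \<rightarrow>\<^sub>E UNIV) \<times> ((V - S) \<rightarrow>\<^sub>E UNIV)"
      by auto
    show "(case (restrict (\<lambda>C. r (SOME k. k \<in> C)) ?L, restrict r (V - S)) of (c, r) \<Rightarrow>
       \<Prod>k\<in>V - S. A k $ r k $ r (?\<beta> k)) = (\<Prod>k\<in>V - S. A k $ r k $ r (\<gamma> k))"
      using restrict_compl_mem(1) by (auto intro!: prod.cong simp: restrict_compl_first_out out)
  next
    fix cr assume "cr \<in> (?L \<rightarrow>\<^sub>E (UNIV::'n set)) \<times> ((V - S) \<rightarrow>\<^sub>E (UNIV::'n set))"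
    then obtain c r' where cr: "cr = (c, r')" and c: "c \<in> ?L \<rightarrow>\<^sub>E UNIV" and r': "r' \<in> (V - S) \<rightarrow>\<^sub>E UNIV" by auto
    define r where "r = restrict (\<lambda>k. if orbit \<gamma> k \<subseteq> S then c (orbit \<gamma> k) else r' (first_out S \<gamma> k)) V"
    have rdef: "(case cr of (c, r') \<Rightarrow> restrict (\<lambda>k. if orbit \<gamma> k \<subseteq> S then c (orbit \<gamma> k) else r' (first_out S \<gamma> k)) V) = r"
      by (simp add: cr r_def)
    have "restrict (\<lambda>C. r (SOME k. k \<in> C)) ?L = c"
    proof
      fix C show "restrict (\<lambda>C. r (SOME k. k \<in> C)) ?L C = c C"
      proof (cases "C \<in> ?L")
        case True
        then obtain x where x: "x \<in> V" "C = orbit \<gamma> x" "C \<subseteq> S" by blast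
        define z where "z = (SOME k. k \<in> C)"
        have zC: "z \<in> C" unfolding z_def x(2) by (rule someI[where P="\<lambda>k. k \<in> orbit \<gamma> x", OF self_in_orbit])
        then have "z \<in> V" using orbit_sub[OF x(1)] x(2) by blast
        moreover have "orbit \<gamma> z = C" using zC orbit_eqI[of z x] x(2) by simp
        ultimately have "z \<in> V" "orbit \<gamma> z = C" by auto
        then have "r z = c C" using x by (simp add: r_def)
        then show ?thesis using True by (simp add: z_def)
      next
        case False
        then show ?thesis using c by (auto simp: PiE_def extensional_def)
      qed
    qed
    moreover have "restrict r (V - S) = r'"
    proof
      fix k show "restrict r (V - S) k = r' k"
        using r' not_orbit_sub[of k] by (auto simp: PiE_def extensional_def r_def first_out_outside)
    qed
    ultimately show "(restrict (\<lambda>C. (case cr of (c, r') \<Rightarrow> restrict (\<lambda>k. if orbit \<gamma> k \<subseteq> S then c (orbit \<gamma> k) else r' (first_out S \<gamma> k)) V) (SOME k. k \<in> C)) ?L,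
       restrict (case cr of (c, r') \<Rightarrow> restrict (\<lambda>k. if orbit \<gamma> k \<subseteq> S then c (orbit \<gamma> k) else r' (first_out S \<gamma> k)) V) (V - S)) = cr"
      unfolding rdef by (simp add: cr)
    have "r k = r (\<gamma> k)" if "k \<in> S" for k
    proof -
      have kV: "k \<in> V" "\<gamma> k \<in> V" using that SV perm by (auto simp: permutes_in_image)
      show ?thesis
      proof (cases "orbit \<gamma> k \<subseteq> S")
        case True
        then show ?thesis using kV by (simp add: r_def orbit_apply)
      next
        case False
        then obtain j where "(\<gamma> ^^ j) k \<notin> S" using escapes by blast
        then show ?thesis using kV False first_out_step[OF that] by (simp add: r_def orbit_apply)
      qed
    qed
    then show "(case cr of (c, r') \<Rightarrow> restrict (\<lambda>k. if orbit \<gamma> k \<subseteq> S then c (orbit \<gamma> k) else r' (first_out S \<gamma> k)) V) \<in> R"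
      unfolding rdef R_def by (auto simp: r_def)
  qed
  also have "\<dots> = of_nat (CARD('n) ^ card ?L) * index_sum (V - S) ?\<beta> A"
  proof -
    have "finite ?L" using fin by simp
    then show ?thesis unfolding index_sum_def
      by (simp add: sum.cartesian_product[symmetric] card_PiE)
  qed
  finally show ?thesis .
qed

end

text \<open>\<open>\<pi> \<circ> \<alpha>\<close> and \<open>\<alpha> \<circ> \<pi>\<close> are conjugate under the involution \<open>\<pi>\<close>.  The paths of the two permutations from
  a point outside \<open>S\<close> agree at the times when they are outside \<open>S\<close>, since \<open>\<pi>\<close> does not move
  points there.  The contraction is defined with \<open>\<pi> \<circ> \<alpha>\<close>, whereas the Kronecker symbols of a
  pairing describe the cycles of \<open>\<alpha> \<circ> \<pi>\<close>.\<close>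

locale involution_conjugation =
  fixes S :: "nat set" and \<pi> \<alpha> :: "nat \<Rightarrow> nat"
  assumes involutive: "\<And>x. \<pi> (\<pi> x) = x" and fixed_outside: "\<And>x. x \<notin> S \<Longrightarrow> \<pi> x = x"
    and recurrent: "\<And>x. x \<in> orbit (\<alpha> \<circ> \<pi>) x"
begin

lemma involution_mem: "\<pi> x \<in> S \<longleftrightarrow> x \<in> S"
  by (metis involutive fixed_outside)

lemma funpow_conj: "((\<pi> \<circ> \<alpha>) ^^ j) (\<pi> x) = \<pi> (((\<alpha> \<circ> \<pi>) ^^ j) x)"
  by (induction j) (simp_all add: involutive)

lemma restrict_compl_conj: "restrict_compl S (\<pi> \<circ> \<alpha>) = restrict_compl S (\<alpha> \<circ> \<pi>)"
proof
  fix x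
  show "restrict_compl S (\<pi> \<circ> \<alpha>) x = restrict_compl S (\<alpha> \<circ> \<pi>) x"
  proof (cases "x \<in> S")
    case False
    then have pw: "((\<pi> \<circ> \<alpha>) ^^ j) x = \<pi> (((\<alpha> \<circ> \<pi>) ^^ j) x)" for j using funpow_conj[of j x] fixed_outside by simp
    define P where "P j \<longleftrightarrow> 0 < j \<and> ((\<alpha> \<circ> \<pi>) ^^ j) x \<notin> S" for j
    obtain j where "0 < j" "x = ((\<alpha> \<circ> \<pi>) ^^ j) x" using recurrent[of x] by (auto simp: orbit_altdef)
    then have "P j" using False by (simp add: P_def)
    then have "P (LEAST j. P j)" by (rule LeastI)
    then have "((\<alpha> \<circ> \<pi>) ^^ (LEAST j. P j)) x \<notin> S" by (simp add: P_def)
    then show ?thesis using False by (simp add: restrict_compl_def pw involution_mem fixed_outside flip: P_def)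
  qed (simp add: restrict_compl_def)
qed

lemma orbit_conj: "orbit (\<pi> \<circ> \<alpha>) (\<pi> x) = \<pi> ` orbit (\<alpha> \<circ> \<pi>) x"
  unfolding orbit_altdef by (auto simp: funpow_conj)

lemma cyc0_conj:
  assumes V: "\<pi> ` V = V" and "0 \<notin> S"
  shows "cyc0 V (\<pi> \<circ> \<alpha>) = cyc0 V (\<alpha> \<circ> \<pi>)"
proof -
  have inj: "inj \<pi>" by (metis involutive injI)
  have 0: "0 \<in> \<pi> ` C \<longleftrightarrow> 0 \<in> C" for C
    using fixed_outside[OF assms(2)] involutive by (metis image_iff)
  have "cycles0 V (\<pi> \<circ> \<alpha>) = {orbit (\<pi> \<circ> \<alpha>) (\<pi> x) |x. x \<in> V \<and> 0 \<notin> orbit (\<pi> \<circ> \<alpha>) (\<pi> x)}"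
    unfolding cycles0_def using V by (metis (no_types, lifting) image_eqI imageE)
  also have "\<dots> = (`) \<pi> ` cycles0 V (\<alpha> \<circ> \<pi>)"
    unfolding orbit_conj 0 cycles0_def by blast
  finally show ?thesis unfolding cyc0_def
    by (simp add: card_image inj_image_eq_iff[OF inj] inj_on_def)
qed

end

section \<open>Matrix entries of contracted traces\<close>

lemma index_sum_relabel:
  fixes B :: "nat \<Rightarrow> complex^'n^'n"
  assumes fin: "finite A" and perm: "\<beta> permutes A"
  shows "relabel A \<beta> permutes {0..<card A}"
    and "index_sum A \<beta> B = index_sum {0..<card A} (relabel A \<beta>) (\<lambda>k. B (sorted_list_of_set A ! k))"
proof -
  define e where "e m = sorted_list_of_set A ! m" for m
  have e: "bij_betw e {0..<card A} A"
    unfolding e_def by (rule bij_betw_nth) (use fin in \<open>auto simp: atLeast0LessThan\<close>)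
  then have inj: "inj_on e {0..<card A}" and im: "e ` {0..<card A} = A" by (auto simp: bij_betw_def)
  have rel: "relabel A \<beta> k = (if k < card A then the_inv_into {0..<card A} e (\<beta> (e k)) else k)" for k
    unfolding relabel_def Let_def e_def[abs_def] by simp
  have e\<beta>: "e (relabel A \<beta> k) = \<beta> (e k)" "relabel A \<beta> k \<in> {0..<card A}" if "k \<in> {0..<card A}" for k
  proof -
    have "\<beta> (e k) \<in> e ` {0..<card A}" using im that perm by (metis imageI permutes_in_image)
    then show "e (relabel A \<beta> k) = \<beta> (e k)" "relabel A \<beta> k \<in> {0..<card A}"
      using that f_the_inv_into_f[OF inj] the_inv_into_into[OF inj, of "\<beta> (e k)" "{0..<card A}"] by (simp_all add: rel)
  qed
  have "inj_on (relabel A \<beta>) {0..<card A}"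
  proof (rule inj_onI)
    fix k l assume kl: "k \<in> {0..<card A}" "l \<in> {0..<card A}" "relabel A \<beta> k = relabel A \<beta> l"
    then have "\<beta> (e k) = \<beta> (e l)" using e\<beta>(1) by metis
    then have "e k = e l" using permutes_inj[OF perm] by (simp add: inj_eq)
    then show "k = l" using inj kl by (simp add: inj_on_eq_iff)
  qed
  moreover have "relabel A \<beta> ` {0..<card A} \<subseteq> {0..<card A}" using e\<beta>(2) by blast
  ultimately have "bij_betw (relabel A \<beta>) {0..<card A} {0..<card A}"
    by (simp add: bij_betw_def endo_inj_surj)
  then show "relabel A \<beta> permutes {0..<card A}"
    by (rule bij_imp_permutes) (simp add: rel)
  have "index_sum A \<beta> B = index_sum {0..<card A} (relabel A \<beta>) (B \<circ> e)"
    by (rule index_sum_reindex[OF e]) (use e\<beta> in auto)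
  then show "index_sum A \<beta> B = index_sum {0..<card A} (relabel A \<beta>) (\<lambda>k. B (sorted_list_of_set A ! k))"
    by (simp add: comp_def e_def)
qed

lemma Tr_alg_single:
  assumes "c \<noteq> 0"
  shows "Tr_alg m (Poly_Mapping.single \<sigma> c) B $ a $ b = c * Tr_perm m \<sigma> B $ a $ b"
  using assms by (simp add: Tr_alg_def map_matrix_def)

lemma sorted_list_of_set_insert_0:
  assumes "finite U" "\<And>x. x \<in> U \<Longrightarrow> 0 < x"
  shows "sorted_list_of_set (insert 0 U) = 0 # sorted_list_of_set (U :: nat set)"
proof -
  have "0 \<notin> U" using assms(2) by blast
  then show ?thesis using assms(1) by (simp add: insort_is_Cons)
qed

definition singles :: "nat set set \<Rightarrow> nat set" where
  "singles \<pi> = {i. {i} \<in> \<pi>}"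

context
  fixes n :: nat and \<pi> :: "nat set set"
  assumes \<pi>: "\<pi> \<in> partitions12 n"
begin

lemma blocks_partition: "partition_on {1..n} \<pi>" and block_card: "B \<in> \<pi> \<Longrightarrow> card B = 1 \<or> card B = 2"
  using \<pi> by (auto simp: partitions12_def)

lemma disjoint_blocks: "B \<in> \<pi> \<Longrightarrow> C \<in> \<pi> \<Longrightarrow> x \<in> B \<Longrightarrow> x \<in> C \<Longrightarrow> B = C"
  using partition_onD2[OF blocks_partition] by (auto simp: disjoint_def)

lemma pairs_sub: "pairs \<pi> \<subseteq> \<pi>" by (auto simp: pairs_def)

lemma supp_sub: "supp \<pi> \<subseteq> {1..n}"
  using partition_onD1[OF blocks_partition] pairs_sub by (auto simp: supp_def)

lemma pairE:
  assumes "P \<in> pairs \<pi>"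
  obtains i j where "P = {i, j}" "i < j" "Min P = i" "Max P = j" "{i,j} \<in> \<pi>"
proof -
  obtain x y where xy: "P = {x,y}" "x \<noteq> y" using assms by (auto simp: pairs_def card_2_iff)
  have P: "P \<in> \<pi>" using assms pairs_sub by blast
  show ?thesis
  proof (cases "x < y")
    case True then show ?thesis using that[of x y] xy P by simp
  next
    case False then show ?thesis using that[of y x] xy P by (auto simp: insert_commute)
  qed
qed

lemma singles_compl: "{1..n} - supp \<pi> = singles \<pi>"
proof (intro equalityI subsetI)
  fix x assume x: "x \<in> {1..n} - supp \<pi>"
  then obtain B where B: "B \<in> \<pi>" "x \<in> B" using partition_onD1[OF blocks_partition] by blast
  then have "card B = 1" using x block_card[of B] by (auto simp: supp_def pairs_def)
  then show "x \<in> singles \<pi>" using B by (auto simp: singles_def card_1_singleton_iff)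
next
  fix x assume "x \<in> singles \<pi>"
  then have x: "{x} \<in> \<pi>" by (simp add: singles_def)
  have "x \<notin> supp \<pi>"
  proof
    assume "x \<in> supp \<pi>"
    then obtain B where "B \<in> \<pi>" "card B = 2" "x \<in> B" by (auto simp: supp_def pairs_def)
    then show False using disjoint_blocks[OF x, of B x] by auto
  qed
  then show "x \<in> {1..n} - supp \<pi>" using x partition_onD1[OF blocks_partition] by blast
qed

lemma invol_pair:
  assumes "{i, j} \<in> \<pi>" "i \<noteq> j" shows "invol \<pi> i = j"
proof -
  have "i \<in> supp \<pi>" using assms by (auto simp: supp_def pairs_def card_insert_if intro!: bexI[of _ "{i,j}"])
  moreover have "(THE y. y \<noteq> i \<and> {i, y} \<in> \<pi>) = j"
  proof (rule the_equality)
    fix y assume y: "y \<noteq> i \<and> {i, y} \<in> \<pi>"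
    then have "{i, y} = {i, j}" using disjoint_blocks[of "{i,y}" "{i,j}" i] assms by blast
    then show "y = j" using y by (auto simp: doubleton_eq_iff)
  qed (use assms in auto)
  ultimately show ?thesis by (simp add: invol_def)
qed

lemma invol_fix: "x \<notin> supp \<pi> \<Longrightarrow> invol \<pi> x = x"
  by (simp add: invol_def)

lemma invol_invol: "invol \<pi> (invol \<pi> x) = x"
proof (cases "x \<in> supp \<pi>")
  case True
  then obtain P where "P \<in> pairs \<pi>" "x \<in> P" by (auto simp: supp_def)
  then obtain i j where "P = {i, j}" "i < j" "{i,j} \<in> \<pi>" "x \<in> {i,j}" using pairE by metis
  then show ?thesis using invol_pair[of i j] invol_pair[of j i] by (auto simp: insert_commute)
qed (simp add: invol_fix)

lemma invol_supp: "x \<in> supp \<pi> \<Longrightarrow> invol \<pi> x \<in> supp \<pi>"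
  using invol_fix invol_invol by metis

lemma invol_permutes: "invol \<pi> permutes {0..n}"
  by (rule bij_imp_permutes)
    (use invol_supp supp_sub invol_fix invol_invol in
      \<open>auto intro!: bij_betw_byWitness[where f'="invol \<pi>"], (metis atLeastAtMost_iff subsetD)+\<close>)

lemma card_supp: "card (supp \<pi>) = 2 * card (pairs \<pi>)"
proof -
  have "card (supp \<pi>) = (\<Sum>P\<in>pairs \<pi>. card P)" unfolding supp_def
    by (rule card_Union_disjoint)
      (auto simp: pairs_def disjoint_def dest: disjoint_blocks intro: card_ge_0_finite)
  also have "\<dots> = (\<Sum>P\<in>pairs \<pi>. 2)" by (intro sum.cong) (auto simp: pairs_def)
  finally show ?thesis by simp
qed

lemma prod_supp: "(\<Prod>k\<in>supp \<pi>. f k) = (\<Prod>P\<in>pairs \<pi>. f (Min P) * f (Max P))"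
  for f :: "nat \<Rightarrow> 'b::comm_monoid_mult"
proof -
  have "(\<Prod>k\<in>supp \<pi>. f k) = (\<Prod>P\<in>pairs \<pi>. \<Prod>k\<in>P. f k)"
    unfolding supp_def
    by (subst prod.Union_disjoint) (auto simp: pairs_def dest: disjoint_blocks intro: card_ge_0_finite)
  also have "\<dots> = (\<Prod>P\<in>pairs \<pi>. f (Min P) * f (Max P))"
    by (intro prod.cong refl) (erule pairE, simp)
  finally show ?thesis .
qed

text \<open>The contraction is the index sum for \<open>\<alpha>\<close> in which the entries at the two ends of every pair are
  replaced by the covariance of the corresponding entries of a Gaussian matrix.\<close>

lemma Tr_contraction_entry:
  fixes B :: "nat \<Rightarrow> complex^'n^'n"
  assumes \<alpha>: "\<alpha> permutes {0..n}"
  shows "Tr_alg (n - 2 * card (pairs \<pi>)) (contraction (1 / real CARD('n)) n \<pi> \<alpha>)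
      (\<lambda>k. B (nth_singleton \<pi> k)) $ a $ b =
    (\<Sum>r \<in> {0..n} \<rightarrow>\<^sub>E UNIV. (if r 0 = b \<and> r (\<alpha> 0) = a then 1 else 0) *
      ((\<Prod>P\<in>pairs \<pi>. if r (Min P) = r (\<alpha> (Max P)) \<and> r (\<alpha> (Min P)) = r (Max P) then 1 / of_nat CARD('n) else 0) *
       (\<Prod>k\<in>singles \<pi>. B k $ r k $ r (\<alpha> k))))"
proof -
  let ?S = "supp \<pi>" and ?p = "card (pairs \<pi>)" and ?N = "real CARD('n)" and ?V = "{0..n}"
  \<comment> \<open>\<open>r (\<gamma> k)\<close> is the column index at the partner of \<open>k\<close>; the Kronecker symbol of the pair equates it
    with the row index at \<open>k\<close>.\<close>
  define \<gamma> where "\<gamma> = \<alpha> \<circ> invol \<pi>"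
  define \<beta> where "\<beta> = restrict_compl ?S \<gamma>"
  define A where "A = ?V - ?S"
  define L where "L = {C \<in> orbit \<gamma> ` ?V. C \<subseteq> ?S}"
  define B' where "B' = B(0 := unit_mat b a)"
  have \<gamma>: "\<gamma> permutes ?V" unfolding \<gamma>_def by (rule permutes_compose[OF invol_permutes \<alpha>])
  interpret permutation_deletion ?V ?S \<gamma>
    using \<gamma> supp_sub by unfold_locales auto
  interpret involution_conjugation ?S "invol \<pi>" \<alpha>
    by unfold_locales (simp_all add: invol_invol invol_fix self_in_orbit flip: \<gamma>_def)
  have zero: "0 \<notin> ?S" using supp_sub by auto
  have rc: "restrict_compl ?S (invol \<pi> \<circ> \<alpha>) = \<beta>" unfolding \<beta>_def \<gamma>_def by (rule restrict_compl_conj)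
  have cyc: "cyc0 ?V (invol \<pi> \<circ> \<alpha>) = card L + cyc0 A \<beta>"
    using cyc0_conj[of ?V] permutes_image[OF invol_permutes] cyc0_restrict_compl zero
    by (simp add: L_def A_def \<beta>_def \<gamma>_def)
  have finS: "finite ?S" using supp_sub finite_subset by blast
  have V0: "?V = insert 0 {1..n}" by auto
  have Aeq: "A = insert 0 (singles \<pi>)"
    unfolding A_def V0 singles_compl[symmetric] using zero by (simp add: insert_Diff_if)
  have finU: "finite (singles \<pi>)" unfolding singles_compl[symmetric] by simp
  have U0: "0 < x" if "x \<in> singles \<pi>" for x using that unfolding singles_compl[symmetric] by simp
  have "card A = Suc n - 2 * ?p" unfolding A_def using supp_sub finS card_supp
    by (subst card_Diff_subset) auto
  moreover have "2 * ?p \<le> n" using card_mono[OF _ supp_sub] card_supp by simp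
  ultimately have cardA: "card A = Suc (n - 2 * ?p)" by simp
  have perm\<beta>: "\<beta> permutes A" unfolding \<beta>_def A_def by (rule restrict_compl_permutes)
  have finA: "finite A" by (simp add: A_def)
  have ival: "{0..<card A} = {0..n - 2 * ?p}" unfolding cardA by auto
  have sl: "sorted_list_of_set A = 0 # sorted_list_of_set (singles \<pi>)"
    unfolding Aeq by (rule sorted_list_of_set_insert_0[OF finU U0])
  have nth0: "sorted_list_of_set A ! 0 = 0" by (simp add: sl)
  have nth: "sorted_list_of_set A ! k = nth_singleton \<pi> k" if "k \<noteq> 0" for k
    using that by (cases k) (simp_all add: sl nth_singleton_def singles_def)
  have nths0: "nth_singleton \<pi> k \<noteq> 0" if "k \<in> {0..n - 2 * ?p}" "k \<noteq> 0" for k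
  proof -
    have "k < length (sorted_list_of_set A)" "0 < length (sorted_list_of_set A)"
      using that finA unfolding ival[symmetric] by auto
    then show ?thesis using that nth[OF that(2)] nth0 nth_eq_iff_index_eq[OF distinct_sorted_list_of_set, of k A 0] by simp
  qed
  \<comment> \<open>The exponent of \<open>q = 1 / N\<close> is the number of pairs minus the number of cycles that disappear.\<close>
  have coeff: "?N powi (int (card L) - int ?p) = ?N ^ card L * (1 / ?N) ^ ?p"
    by (simp add: power_int_diff power_one_over)
  have "contraction (1 / ?N) n \<pi> \<alpha> = Poly_Mapping.single (relabel A \<beta>)
     (complex_of_real (?N ^ card L * (1 / ?N) ^ ?p))"
  proof -
    have "(1 / ?N) powi (int (cyc0 A \<beta>) - int (cyc0 ?V (invol \<pi> \<circ> \<alpha>)) + int ?p) = ?N powi (int (card L) - int ?p)"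
      unfolding cyc using power_int_minus[of ?N "int ?p - int (card L)"]
      by (simp add: divide_inverse power_int_inverse)
    then show ?thesis unfolding contraction_def Let_def rc A_def[symmetric] coeff by simp
  qed
  then have "Tr_alg (n - 2 * ?p) (contraction (1 / ?N) n \<pi> \<alpha>) (\<lambda>k. B (nth_singleton \<pi> k)) $ a $ b =
    complex_of_real (?N ^ card L * (1 / ?N) ^ ?p) * Tr_perm (n - 2 * ?p) (relabel A \<beta>) (\<lambda>k. B (nth_singleton \<pi> k)) $ a $ b"
    by (simp only: Tr_alg_single) (subst Tr_alg_single, auto)
  also have "Tr_perm (n - 2 * ?p) (relabel A \<beta>) (\<lambda>k. B (nth_singleton \<pi> k)) $ a $ b =
     index_sum {0..n - 2 * ?p} (relabel A \<beta>) ((\<lambda>k. B (nth_singleton \<pi> k))(0 := unit_mat b a))"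
    using index_sum_relabel(1)[OF finA perm\<beta>] by (intro Tr_perm_entry) (simp add: ival)
  also have "\<dots> = index_sum {0..<card A} (relabel A \<beta>) (\<lambda>k. B' (sorted_list_of_set A ! k))"
  proof (rule index_sum_cong)
    fix k assume k: "k \<in> {0..n - 2 * ?p}"
    show "((\<lambda>k. B (nth_singleton \<pi> k))(0 := unit_mat b a)) k = B' (sorted_list_of_set A ! k)"
    proof (cases "k = 0")
      case False
      then show ?thesis using nths0[OF k] nth[of k] by (simp add: B'_def)
    qed (simp add: nth0 B'_def)
  qed (simp_all add: ival)
  also have "\<dots> = index_sum A \<beta> B'" by (rule index_sum_relabel(2)[OF finA perm\<beta>, symmetric])
  also have "complex_of_real (?N ^ card L * (1 / ?N) ^ ?p) * index_sum A \<beta> B' =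
     (1 / of_nat CARD('n)) ^ ?p * (of_nat (CARD('n) ^ card L) * index_sum A \<beta> B')" by simp
  also have "of_nat (CARD('n) ^ card L) * index_sum A \<beta> B' = index_sum ?V \<gamma> (\<lambda>k. if k \<in> ?S then mat 1 else B' k)"
    unfolding A_def \<beta>_def L_def by (rule index_sum_identity_on[symmetric])
  also have "(1 / of_nat CARD('n)) ^ ?p * \<dots> =
    (\<Sum>r \<in> ?V \<rightarrow>\<^sub>E UNIV. (if r 0 = b \<and> r (\<alpha> 0) = a then 1 else 0) *
      ((\<Prod>P\<in>pairs \<pi>. if r (Min P) = r (\<alpha> (Max P)) \<and> r (\<alpha> (Min P)) = r (Max P) then 1 / of_nat CARD('n) else 0) *
       (\<Prod>k\<in>singles \<pi>. B k $ r k $ r (\<alpha> k))))"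
    unfolding index_sum_def sum_distrib_left
  proof (rule sum.cong[OF refl])
    fix r :: "nat \<Rightarrow> 'n"
    let ?g = "\<lambda>k. (if k \<in> ?S then mat 1 else B' k) $ r k $ r (\<gamma> k)"
    have V: "?V = insert 0 (?S \<union> singles \<pi>)" using singles_compl supp_sub by force
    have disj: "?S \<inter> singles \<pi> = {}" using singles_compl by blast
    have "(\<Prod>k\<in>?V. ?g k) = ?g 0 * ((\<Prod>k\<in>?S. ?g k) * (\<Prod>k\<in>singles \<pi>. ?g k))"
      unfolding V using finS finU zero U0 disj by (subst prod.insert) (auto simp: prod.union_disjoint)
    also have "?g 0 = (if r 0 = b \<and> r (\<alpha> 0) = a then 1 else 0)"
      using zero by (simp add: B'_def unit_mat_def \<gamma>_def invol_fix)
    also have "(\<Prod>k\<in>singles \<pi>. ?g k) = (\<Prod>k\<in>singles \<pi>. B k $ r k $ r (\<alpha> k))"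
    proof (rule prod.cong[OF refl])
      fix k assume "k \<in> singles \<pi>"
      then have "k \<notin> ?S" "k \<noteq> 0" using disj U0 by auto
      then show "?g k = B k $ r k $ r (\<alpha> k)" by (simp add: B'_def \<gamma>_def invol_fix)
    qed
    also have "(\<Prod>k\<in>?S. ?g k) = (\<Prod>P\<in>pairs \<pi>. if r (Min P) = r (\<alpha> (Max P)) \<and> r (\<alpha> (Min P)) = r (Max P) then 1 else 0)"
      unfolding prod_supp
    proof (rule prod.cong[OF refl])
      fix P assume P: "P \<in> pairs \<pi>"
      then obtain i j where ij: "P = {i, j}" "i < j" "Min P = i" "Max P = j" "{i,j} \<in> \<pi>" by (rule pairE)
      have "i \<in> ?S" "j \<in> ?S" using P ij(1) by (auto simp: supp_def)
      moreover have "invol \<pi> i = j" "invol \<pi> j = i" using invol_pair[of i j] invol_pair[of j i] ij by (auto simp: insert_commute)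
      ultimately show "?g (Min P) * ?g (Max P) = (if r (Min P) = r (\<alpha> (Max P)) \<and> r (\<alpha> (Min P)) = r (Max P) then 1 else 0)"
        unfolding ij(3,4) by (auto simp: mat_def \<gamma>_def)
    qed
    finally have "(1 / of_nat CARD('n)) ^ ?p * (\<Prod>k\<in>?V. ?g k) =
       (if r 0 = b \<and> r (\<alpha> 0) = a then 1 else 0) * (((\<Prod>P\<in>pairs \<pi>. 1 / of_nat CARD('n)) *
       (\<Prod>P\<in>pairs \<pi>. if r (Min P) = r (\<alpha> (Max P)) \<and> r (\<alpha> (Min P)) = r (Max P) then 1 else 0)) *
       (\<Prod>k\<in>singles \<pi>. B k $ r k $ r (\<alpha> k)))"
      by (simp only: prod_constant mult.assoc mult.left_commute)
    then show "(1 / of_nat CARD('n)) ^ ?p * (\<Prod>k\<in>?V. ?g k) =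
       (if r 0 = b \<and> r (\<alpha> 0) = a then 1 else 0) *
      ((\<Prod>P\<in>pairs \<pi>. if r (Min P) = r (\<alpha> (Max P)) \<and> r (\<alpha> (Min P)) = r (Max P) then 1 / of_nat CARD('n) else 0) *
       (\<Prod>k\<in>singles \<pi>. B k $ r k $ r (\<alpha> k)))"
      unfolding prod.distrib[symmetric] by (simp add: if_distrib[of "\<lambda>x. _ * x"] cong: if_cong)
  qed
  finally show ?thesis .
qed

end

section \<open>Wick polynomials\<close>

text \<open>Arbitrary index sets are needed for the Wick recursion, which removes points.\<close>

definition pair_partitions :: "nat set \<Rightarrow> nat set set set" where
  "pair_partitions U = {\<pi>. partition_on U \<pi> \<and> (\<forall>B\<in>\<pi>. card B = 1 \<or> card B = 2)}"

definition wick_term :: "(nat \<Rightarrow> nat \<Rightarrow> complex) \<Rightarrow> (nat \<Rightarrow> complex) \<Rightarrow> nat set set \<Rightarrow> complex" where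
  "wick_term C Y \<pi> = (- 1) ^ card (pairs \<pi>) * (\<Prod>P\<in>pairs \<pi>. C (Min P) (Max P)) * (\<Prod>k\<in>singles \<pi>. Y k)"

text \<open>The Wick product of the \<open>Y\<^sub>k\<close> with \<open>k \<in> U\<close>, that is, their multivariate Hermite polynomial, for the covariance \<open>C\<close>.\<close>

definition wick :: "(nat \<Rightarrow> nat \<Rightarrow> complex) \<Rightarrow> (nat \<Rightarrow> complex) \<Rightarrow> nat set \<Rightarrow> complex" where
  "wick C Y U = (\<Sum>\<pi>\<in>pair_partitions U. wick_term C Y \<pi>)"

lemma finite_pair_partitions: "finite U \<Longrightarrow> finite (pair_partitions U)"
  by (rule finite_subset[OF _ finitely_many_partition_on[of U]]) (auto simp: pair_partitions_def)

lemma pair_partitions_insert_block: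
  assumes "p \<inter> U = {}" "card p = 1 \<or> card p = 2" "\<pi> \<in> pair_partitions U"
  shows "insert p \<pi> \<in> pair_partitions (p \<union> U)" "p \<notin> \<pi>"
proof -
  have "\<Union>\<pi> = U" using assms(3) by (simp add: pair_partitions_def partition_on_def)
  moreover have ne: "p \<noteq> {}" using assms(2) by auto
  ultimately show "p \<notin> \<pi>" using assms(1) by auto
  have U: "p \<union> U - p = U" using assms(1) by auto
  show "insert p \<pi> \<in> pair_partitions (p \<union> U)"
    using assms ne \<open>\<Union>\<pi> = U\<close>
    by (simp add: pair_partitions_def partition_on_insert disjnt_def U)
qed

lemma pair_partitions_remove_block:
  assumes "p \<in> \<pi>" "\<pi> \<in> pair_partitions V"
  shows "\<pi> - {p} \<in> pair_partitions (V - p)" "p \<subseteq> V"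
proof -
  have dj: "disjnt p (\<Union>(\<pi> - {p}))" using assms by (auto simp: pair_partitions_def partition_on_def disjnt_def disjoint_def)
  have "insert p (\<pi> - {p}) = \<pi>" using assms by auto
  then have "partition_on V (insert p (\<pi> - {p}))" using assms by (simp add: pair_partitions_def)
  then show "\<pi> - {p} \<in> pair_partitions (V - p)" "p \<subseteq> V"
    using assms partition_on_insert[OF dj, of V] by (auto simp: pair_partitions_def)
qed

lemma finite_pairs_singles:
  assumes "\<pi> \<in> pair_partitions U" "finite U"
  shows "finite (pairs \<pi>)" "finite (singles \<pi>)" "singles \<pi> \<subseteq> U"
proof -
  have "partition_on U \<pi>" using assms by (simp add: pair_partitions_def)
  then show "finite (pairs \<pi>)" using finite_elements[OF assms(2)] by (simp add: pairs_def)
  show "singles \<pi> \<subseteq> U" using \<open>partition_on U \<pi>\<close> by (auto simp: singles_def partition_on_def)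
  then show "finite (singles \<pi>)" using assms(2) finite_subset by blast
qed

lemma wick_term_insert_single:
  assumes "x \<notin> U" "\<pi> \<in> pair_partitions U" "finite U"
  shows "wick_term C Y (insert {x} \<pi>) = Y x * wick_term C Y \<pi>"
proof -
  have "pairs (insert {x} \<pi>) = pairs \<pi>" by (auto simp: pairs_def)
  moreover have "singles (insert {x} \<pi>) = insert x (singles \<pi>)" by (auto simp: singles_def)
  moreover have "x \<notin> singles \<pi>" using finite_pairs_singles(3)[OF assms(2,3)] assms(1) by blast
  ultimately show ?thesis using finite_pairs_singles(2)[OF assms(2,3)] by (simp add: wick_term_def)
qed

lemma wick_term_insert_pair:
  assumes "x \<noteq> l" "x \<notin> U" "l \<notin> U" "\<pi> \<in> pair_partitions U" "finite U" and sym: "C x l = C l x"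
  shows "wick_term C Y (insert {x, l} \<pi>) = - C x l * wick_term C Y \<pi>"
proof -
  have c2: "card {x, l} = 2" using assms(1) by simp
  have "pairs (insert {x, l} \<pi>) = insert {x, l} (pairs \<pi>)" using c2 by (auto simp: pairs_def)
  moreover have "singles (insert {x, l} \<pi>) = singles \<pi>" using assms(1) by (auto simp: singles_def doubleton_eq_iff)
  moreover have "{x, l} \<notin> pairs \<pi>"
    using pair_partitions_insert_block(2)[of "{x,l}" U \<pi>] assms c2 pairs_def by auto
  moreover have "C (Min {x, l}) (Max {x, l}) = C x l" using sym by (cases "x < l") (auto simp: min_def max_def)
  ultimately show ?thesis using finite_pairs_singles(1)[OF assms(4,5)] by (simp add: wick_term_def)
qed

text \<open>Sorting the partitions by the block of \<open>x\<close>: either \<open>x\<close> is a singleton or it is paired with some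
  \<open>l\<close>.\<close>

lemma wick_insert:
  assumes x: "x \<notin> U" and U: "finite U" and sym: "\<And>l. l \<in> U \<Longrightarrow> C x l = C l x"
  shows "wick C Y (insert x U) = Y x * wick C Y U - (\<Sum>l\<in>U. C x l * wick C Y (U - {l}))"
proof -
  let ?P1 = "insert {x} ` pair_partitions U"
  let ?D = "Sigma U (\<lambda>l. pair_partitions (U - {l}))"
  let ?f = "\<lambda>(l, \<pi>). insert {x, l} \<pi>"
  have nx: "x \<notin> \<Union>\<pi>" if "\<pi> \<in> pair_partitions W" "W \<subseteq> U" for \<pi> W
    using that x by (auto simp: pair_partitions_def partition_on_def)
  have Un: "pair_partitions (insert x U) = ?P1 \<union> ?f ` ?D"
  proof (intro equalityI subsetI)
    fix \<pi> assume \<pi>: "\<pi> \<in> pair_partitions (insert x U)"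
    then obtain p where p: "p \<in> \<pi>" "x \<in> p" by (auto simp: pair_partitions_def partition_on_def)
    note rem = pair_partitions_remove_block[OF p(1) \<pi>]
    have ins: "\<pi> = insert p (\<pi> - {p})" using p by auto
    have "card p = 1 \<or> card p = 2" using \<pi> p by (auto simp: pair_partitions_def)
    then show "\<pi> \<in> ?P1 \<union> ?f ` ?D"
    proof
      assume "card p = 1"
      then have px: "p = {x}" using p by (auto simp: card_1_singleton_iff)
      then have "insert x U - p = U" using x by auto
      then have "insert {x} (\<pi> - {p}) \<in> ?P1" using rem(1) by (intro imageI) simp
      moreover have "insert {x} (\<pi> - {p}) = \<pi>" using ins[symmetric] px by simp
      ultimately show ?thesis by simp
    next
      assume "card p = 2"
      then obtain l where l: "p = {x, l}" "l \<noteq> x" using p by (auto simp: card_2_iff)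
      then have "l \<in> U" "insert x U - p = U - {l}" using rem(2) x by auto
      then have "(l, \<pi> - {p}) \<in> ?D" using rem(1) by simp
      then have "?f (l, \<pi> - {p}) \<in> ?f ` ?D" by (rule imageI)
      moreover have "?f (l, \<pi> - {p}) = \<pi>" using ins[symmetric] l by simp
      ultimately show ?thesis by simp
    qed
  next
    fix \<pi> assume "\<pi> \<in> ?P1 \<union> ?f ` ?D"
    then show "\<pi> \<in> pair_partitions (insert x U)"
    proof
      assume "\<pi> \<in> ?P1"
      then obtain \<rho> where "\<pi> = insert {x} \<rho>" "\<rho> \<in> pair_partitions U" by blast
      then show ?thesis using pair_partitions_insert_block(1)[of "{x}" U \<rho>] x by simp
    next
      assume "\<pi> \<in> ?f ` ?D"
      then obtain l \<rho> where l: "\<pi> = insert {x, l} \<rho>" "l \<in> U" "\<rho> \<in> pair_partitions (U - {l})" by auto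
      then have "x \<noteq> l" using x by blast
      then have "{x, l} \<union> (U - {l}) = insert x U" "card {x, l} = 2" "{x, l} \<inter> (U - {l}) = {}" using l(2) x by auto
      then show ?thesis using pair_partitions_insert_block(1)[of "{x, l}" "U - {l}" \<rho>] l by simp
    qed
  qed
  have disj: "?P1 \<inter> ?f ` ?D = {}"
  proof (rule ccontr)
    assume "?P1 \<inter> ?f ` ?D \<noteq> {}"
    then obtain \<rho> l \<sigma> where h: "\<rho> \<in> pair_partitions U" "l \<in> U" "\<sigma> \<in> pair_partitions (U - {l})" "insert {x} \<rho> = insert {x, l} \<sigma>" by auto
    have "{x, l} \<in> insert {x} \<rho>" using h by blast
    moreover have "{x, l} \<noteq> {x}" using h x by auto
    ultimately have "{x, l} \<in> \<rho>" by blast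
    then show False using nx[OF h(1)] by blast
  qed
  have inj1: "inj_on (insert {x}) (pair_partitions U)"
  proof (rule inj_onI)
    fix \<rho> \<sigma> assume h: "\<rho> \<in> pair_partitions U" "\<sigma> \<in> pair_partitions U" "insert {x} \<rho> = insert {x} \<sigma>"
    then have "{x} \<notin> \<rho>" "{x} \<notin> \<sigma>" using nx by blast+
    then show "\<rho> = \<sigma>" using h(3) by (meson insert_ident)
  qed
  have inj2: "inj_on ?f ?D"
  proof (rule inj_onI)
    fix u v assume "u \<in> ?D" "v \<in> ?D" and eq: "?f u = ?f v"
    then obtain k \<rho> l \<sigma> where h: "u = (k, \<rho>)" "v = (l, \<sigma>)" "k \<in> U" "l \<in> U"
      "\<rho> \<in> pair_partitions (U - {k})" "\<sigma> \<in> pair_partitions (U - {l})" by auto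
    have n: "{x, k'} \<notin> \<rho>" "{x, k'} \<notin> \<sigma>" for k' using nx[OF h(5)] nx[OF h(6)] by blast+
    have e: "insert {x, k} \<rho> = insert {x, l} \<sigma>" using eq h by simp
    then have "{x, k} = {x, l}" using n by blast
    then have "k = l" by (auto simp: doubleton_eq_iff)
    then show "u = v" using h e n by (metis insert_ident)
  qed
  have fin: "finite ?D" using U finite_pair_partitions by auto
  have "wick C Y (insert x U) = (\<Sum>\<pi>\<in>?P1. wick_term C Y \<pi>) + (\<Sum>\<pi>\<in>?f ` ?D. wick_term C Y \<pi>)"
    unfolding wick_def Un by (rule sum.union_disjoint) (use U finite_pair_partitions fin disj in auto)
  also have "(\<Sum>\<pi>\<in>?P1. wick_term C Y \<pi>) = (\<Sum>\<pi>\<in>pair_partitions U. Y x * wick_term C Y \<pi>)"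
    using inj1 by (simp add: sum.reindex wick_term_insert_single[OF x _ U])
  also have "(\<Sum>\<pi>\<in>?f ` ?D. wick_term C Y \<pi>) = (\<Sum>(l, \<pi>)\<in>?D. - C x l * wick_term C Y \<pi>)"
    unfolding sum.reindex[OF inj2] comp_def
  proof (intro sum.cong refl)
    fix u assume "u \<in> ?D"
    then obtain l \<rho> where h: "u = (l, \<rho>)" "l \<in> U" "\<rho> \<in> pair_partitions (U - {l})" by auto
    then show "wick_term C Y (?f u) = (case u of (l, \<pi>) \<Rightarrow> - C x l * wick_term C Y \<pi>)"
      using wick_term_insert_pair[of x l "U - {l}" \<rho> C Y] x U sym by auto
  qed
  also have "\<dots> = (\<Sum>l\<in>U. - C x l * wick C Y (U - {l}))"
    using U finite_pair_partitions by (simp add: sum.Sigma[symmetric] wick_def sum_distrib_left del: mult_minus_left)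
  finally show ?thesis by (simp add: wick_def sum_distrib_left sum_negf)
qed

lemma wick_empty: "wick C Y {} = 1"
proof -
  have "pair_partitions {} = {{}}" by (auto simp: pair_partitions_def partition_on_empty)
  then show ?thesis by (simp add: wick_def wick_term_def pairs_def singles_def)
qed

section \<open>Expectations of Gaussian variables\<close>

text \<open>A class of variables closed under sums and products, so that the integrability of polynomials in Gaussian
  variables needs no bookkeeping of exponents.\<close>

definition all_moments :: "'a measure \<Rightarrow> ('a \<Rightarrow> complex) \<Rightarrow> bool" where
  "all_moments M f \<longleftrightarrow> f \<in> borel_measurable M \<and> (\<forall>p::nat. integrable M (\<lambda>\<omega>. norm (f \<omega>) ^ p))"

lemma all_moments_measurable: "all_moments M f \<Longrightarrow> f \<in> borel_measurable M"
  by (simp add: all_moments_def)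

lemma all_moments_integrable:
  assumes "all_moments M f" shows "integrable M f"
proof -
  have "integrable M (\<lambda>\<omega>. norm (f \<omega>) ^ 1)" using assms unfolding all_moments_def by blast
  then have "integrable M (\<lambda>\<omega>. norm (f \<omega>))" by simp
  then show ?thesis using assms all_moments_measurable integrable_norm_cancel by blast
qed

lemma all_moments_mult:
  assumes "all_moments M f" "all_moments M g"
  shows "all_moments M (\<lambda>\<omega>. f \<omega> * g \<omega>)"
  unfolding all_moments_def
proof (intro conjI allI)
  have [measurable]: "f \<in> borel_measurable M" "g \<in> borel_measurable M"
    using assms by (simp_all add: all_moments_def)
  show "(\<lambda>\<omega>. f \<omega> * g \<omega>) \<in> borel_measurable M" by measurable
  fix p :: nat
  have "integrable M (\<lambda>\<omega>. norm (f \<omega>) ^ (2 * p) + norm (g \<omega>) ^ (2 * p))"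
    using assms unfolding all_moments_def by (intro Bochner_Integration.integrable_add) blast+
  then show "integrable M (\<lambda>\<omega>. norm (f \<omega> * g \<omega>) ^ p)"
  proof (rule Bochner_Integration.integrable_bound)
    show "AE \<omega> in M. norm (norm (f \<omega> * g \<omega>) ^ p) \<le> norm (norm (f \<omega>) ^ (2 * p) + norm (g \<omega>) ^ (2 * p))"
    proof (rule AE_I2)
      fix \<omega>
      define u v where "u = norm (f \<omega>) ^ p" and "v = norm (g \<omega>) ^ p"
      have "0 \<le> u * v" by (simp add: u_def v_def)
      moreover have "2 * (u * v) \<le> u\<^sup>2 + v\<^sup>2" using zero_le_power2[of "u - v"] by (simp add: power2_diff)
      ultimately have "u * v \<le> u\<^sup>2 + v\<^sup>2" by linarith
      then show "norm (norm (f \<omega> * g \<omega>) ^ p) \<le> norm (norm (f \<omega>) ^ (2 * p) + norm (g \<omega>) ^ (2 * p))"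
        by (simp add: u_def v_def norm_mult power_mult_distrib power_mult[symmetric] mult.commute[of p])
    qed
  qed measurable
qed

lemma all_moments_add:
  assumes "all_moments M f" "all_moments M g"
  shows "all_moments M (\<lambda>\<omega>. f \<omega> + g \<omega>)"
  unfolding all_moments_def
proof (intro conjI allI)
  have [measurable]: "f \<in> borel_measurable M" "g \<in> borel_measurable M"
    using assms by (simp_all add: all_moments_def)
  show "(\<lambda>\<omega>. f \<omega> + g \<omega>) \<in> borel_measurable M" by measurable
  fix p :: nat
  have "integrable M (\<lambda>\<omega>. 2 ^ p * (norm (f \<omega>) ^ p + norm (g \<omega>) ^ p))"
    using assms unfolding all_moments_def by (intro Bochner_Integration.integrable_add integrable_mult_right) blast+
  then show "integrable M (\<lambda>\<omega>. norm (f \<omega> + g \<omega>) ^ p)"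
  proof (rule Bochner_Integration.integrable_bound)
    show "AE \<omega> in M. norm (norm (f \<omega> + g \<omega>) ^ p) \<le> norm (2 ^ p * (norm (f \<omega>) ^ p + norm (g \<omega>) ^ p))"
    proof (rule AE_I2)
      fix \<omega>
      define u v where "u = norm (f \<omega>)" and "v = norm (g \<omega>)"
      have uv: "0 \<le> u" "0 \<le> v" by (simp_all add: u_def v_def)
      have "norm (f \<omega> + g \<omega>) ^ p \<le> (2 * max u v) ^ p"
        using norm_triangle_ineq[of "f \<omega>" "g \<omega>"] by (intro power_mono) (auto simp: u_def v_def)
      also have "\<dots> = 2 ^ p * max u v ^ p" by (simp add: power_mult_distrib)
      also have "max u v ^ p \<le> u ^ p + v ^ p" using uv by (auto simp: max_def)
      finally show "norm (norm (f \<omega> + g \<omega>) ^ p) \<le> norm (2 ^ p * (norm (f \<omega>) ^ p + norm (g \<omega>) ^ p))"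
        using uv by (simp add: u_def v_def)
    qed
  qed measurable
qed

context prob_space
begin

lemma all_moments_const: "all_moments M (\<lambda>_. c)"
  by (simp add: all_moments_def)

lemma all_moments_bounded:
  assumes [measurable]: "f \<in> borel_measurable M" and "\<And>\<omega>. norm (f \<omega>) \<le> B"
  shows "all_moments M f"
  unfolding all_moments_def
proof (intro conjI allI)
  fix p :: nat
  show "integrable M (\<lambda>\<omega>. norm (f \<omega>) ^ p)"
    by (rule integrable_const_bound[where B="B ^ p"]) (auto intro!: power_mono assms(2))
qed fact

lemma all_moments_prod: "(\<And>k. k \<in> A \<Longrightarrow> all_moments M (f k)) \<Longrightarrow> all_moments M (\<lambda>\<omega>. \<Prod>k\<in>A. f k \<omega>)"
  by (induction A rule: infinite_finite_induct) (auto intro: all_moments_const all_moments_mult)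

lemma all_moments_sum: "(\<And>k. k \<in> A \<Longrightarrow> all_moments M (f k)) \<Longrightarrow> all_moments M (\<lambda>\<omega>. \<Sum>k\<in>A. f k \<omega>)"
  by (induction A rule: infinite_finite_induct) (auto intro: all_moments_const all_moments_add)

lemma all_moments_wick:
  assumes "\<And>k. k \<in> U \<Longrightarrow> all_moments M (Y k)" "finite U"
  shows "all_moments M (\<lambda>\<omega>. wick C (\<lambda>k. Y k \<omega>) U)"
  unfolding wick_def wick_term_def
  using finite_pairs_singles(3)[OF _ assms(2)]
  by (intro all_moments_sum all_moments_mult all_moments_prod all_moments_const assms(1)) blast

text \<open>The expectation of \<open>Z V\<close> is, up to the factor \<open>i\<close>, the derivative at \<open>0\<close> of the function
  \<open>\<theta> \<mapsto> E[V exp(i \<theta> Z)]\<close>.  That function is given as the restriction to the reals of a complex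
  differentiable \<open>g\<close>, so that the usual derivative rules apply to it.  Its difference quotients are
  dominated by \<open>|Z V|\<close>.\<close>

lemma derivative_under_expectation:
  fixes V :: "'a \<Rightarrow> complex" and Z :: "'a \<Rightarrow> real"
  assumes V: "integrable M V" and ZV: "integrable M (\<lambda>\<omega>. of_real (Z \<omega>) * V \<omega>)"
    and [measurable]: "Z \<in> borel_measurable M"
    and eq: "\<And>\<theta>::real. (LINT \<omega>|M. V \<omega> * iexp (\<theta> * Z \<omega>)) = g (of_real \<theta>)"
    and g: "(g has_field_derivative D) (at 0)"
  shows "(LINT \<omega>|M. of_real (Z \<omega>) * V \<omega>) = - \<i> * D"
proof -
  define \<theta> where "\<theta> n = inverse (real (Suc n))" for n
  have \<theta>: "\<theta> n \<noteq> 0" "\<theta> n > 0" for n by (simp_all add: \<theta>_def)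
  have lim: "filterlim (\<lambda>n. complex_of_real (\<theta> n)) (at 0) sequentially"
  proof (rule filterlim_atI)
    have "\<theta> \<longlonglongrightarrow> 0" unfolding \<theta>_def[abs_def] by (rule LIMSEQ_inverse_real_of_nat)
    then have "(\<lambda>n. complex_of_real (\<theta> n)) \<longlonglongrightarrow> of_real 0" by (intro tendsto_intros)
    then show "(\<lambda>n. complex_of_real (\<theta> n)) \<longlonglongrightarrow> 0" by simp
  qed (use \<theta> in auto)
  have quot: "(\<lambda>n. (f (of_real (\<theta> n)) - f 0) / of_real (\<theta> n)) \<longlonglongrightarrow> E"
    if "(f has_field_derivative E) (at 0)" for f :: "complex \<Rightarrow> complex" and E
    using filterlim_compose[OF that[unfolded DERIV_def, simplified] lim] .
  have [measurable]: "V \<in> borel_measurable M" using V by simp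
  let ?s = "\<lambda>n \<omega>. V \<omega> * ((iexp (\<theta> n * Z \<omega>) - 1) / of_real (\<theta> n))"
  have lim1: "(\<lambda>n. LINT \<omega>|M. ?s n \<omega>) \<longlonglongrightarrow> (LINT \<omega>|M. V \<omega> * (\<i> * of_real (Z \<omega>)))"
  proof (rule integral_dominated_convergence[where w="\<lambda>\<omega>. norm (of_real (Z \<omega>) * V \<omega>)"])
    show "AE \<omega> in M. (\<lambda>n. ?s n \<omega>) \<longlonglongrightarrow> V \<omega> * (\<i> * of_real (Z \<omega>))"
    proof (rule AE_I2)
      fix \<omega>
      have "((\<lambda>h. exp (\<i> * (h * of_real (Z \<omega>)))) has_field_derivative \<i> * of_real (Z \<omega>)) (at 0)"
        by (auto intro!: derivative_eq_intros)
      from tendsto_mult[OF tendsto_const[of "V \<omega>"] quot[OF this]]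
      show "(\<lambda>n. ?s n \<omega>) \<longlonglongrightarrow> V \<omega> * (\<i> * of_real (Z \<omega>))" by simp
    qed
    fix n
    show "AE \<omega> in M. norm (?s n \<omega>) \<le> norm (of_real (Z \<omega>) * V \<omega>)"
    proof (rule AE_I2)
      fix \<omega>
      have "cmod (iexp (\<theta> n * Z \<omega>) - 1) \<le> \<bar>\<theta> n * Z \<omega>\<bar>"
        using iexp_approx1[of "\<theta> n * Z \<omega>" 0] by simp
      then have "cmod (iexp (\<theta> n * Z \<omega>) - 1) / \<theta> n \<le> \<bar>Z \<omega>\<bar>"
        using \<theta>[of n] by (simp add: abs_mult field_simps)
      then have "norm (V \<omega>) * (cmod (iexp (\<theta> n * Z \<omega>) - 1) / \<theta> n) \<le> norm (V \<omega>) * \<bar>Z \<omega>\<bar>"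
        by (rule mult_left_mono) simp
      then show "norm (?s n \<omega>) \<le> norm (of_real (Z \<omega>) * V \<omega>)"
        using \<theta>[of n] by (simp add: norm_mult norm_divide mult.commute)
    qed
  qed (use ZV in \<open>auto intro: integrable_norm\<close>)
  have sn: "(LINT \<omega>|M. ?s n \<omega>) = (g (of_real (\<theta> n)) - g 0) / of_real (\<theta> n)" for n
  proof -
    have int: "integrable M (\<lambda>\<omega>. V \<omega> * iexp (\<theta> n * Z \<omega>))"
      by (rule Bochner_Integration.integrable_bound[OF V]) (auto simp: norm_mult)
    have "(LINT \<omega>|M. ?s n \<omega>) = (LINT \<omega>|M. (V \<omega> * iexp (\<theta> n * Z \<omega>) - V \<omega>) / of_real (\<theta> n))"
      by (simp add: algebra_simps diff_divide_distrib)
    also have "\<dots> = ((LINT \<omega>|M. V \<omega> * iexp (\<theta> n * Z \<omega>)) - (LINT \<omega>|M. V \<omega>)) / of_real (\<theta> n)"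
      using int V by simp
    also have "(LINT \<omega>|M. V \<omega>) = g 0" using eq[of 0] by simp
    finally show ?thesis using eq by simp
  qed
  have "(LINT \<omega>|M. V \<omega> * (\<i> * of_real (Z \<omega>))) = D"
    by (rule LIMSEQ_unique[OF lim1[unfolded sn] quot[OF g]])
  then have "\<i> * (LINT \<omega>|M. of_real (Z \<omega>) * V \<omega>) = D"
    by (subst integral_mult_right_zero[symmetric]) (simp add: ac_simps)
  then have "- \<i> * (\<i> * (LINT \<omega>|M. of_real (Z \<omega>) * V \<omega>)) = - \<i> * D" by simp
  then show ?thesis by (simp add: mult.assoc[symmetric])
qed

lemma gaussian_centered:
  assumes G: "gaussian_rv M Z" and mean: "expectation Z = 0"
  shows "all_moments M (\<lambda>\<omega>. of_real (Z \<omega>))"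
    and "(LINT \<omega>|M. iexp (Z \<omega>)) = of_real (exp (- expectation (\<lambda>\<omega>. (Z \<omega>)\<^sup>2) / 2))"
proof -
  have [measurable]: "Z \<in> borel_measurable M" using G by (simp add: gaussian_rv_def)
  consider (const) \<mu> where "AE \<omega> in M. Z \<omega> = \<mu>"
    | (normal) \<mu> \<sigma> where "0 < \<sigma>" "distributed M lborel Z (normal_density \<mu> \<sigma>)"
    using G by (auto simp: gaussian_rv_def)
  then have "all_moments M (\<lambda>\<omega>. of_real (Z \<omega>)) \<and>
    (LINT \<omega>|M. iexp (Z \<omega>)) = of_real (exp (- expectation (\<lambda>\<omega>. (Z \<omega>)\<^sup>2) / 2))"
  proof cases
    case const
    have "expectation Z = expectation (\<lambda>_. \<mu>)" by (rule integral_cong_AE) (use const in auto)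
    then have "\<mu> = 0" using mean by (simp add: prob_space)
    then have Z: "AE \<omega> in M. Z \<omega> = 0" using const by simp
    have "integrable M (\<lambda>\<omega>. norm (complex_of_real (Z \<omega>)) ^ p)" for p :: nat
    proof -
      have "integrable M (\<lambda>\<omega>. norm (complex_of_real (Z \<omega>)) ^ p) \<longleftrightarrow> integrable M (\<lambda>\<omega>. 0 ^ p :: real)"
        by (rule integrable_cong_AE) (use Z in auto)
      then show ?thesis by simp
    qed
    then have "all_moments M (\<lambda>\<omega>. of_real (Z \<omega>))" by (simp add: all_moments_def)
    moreover have "(LINT \<omega>|M. iexp (Z \<omega>)) = (LINT \<omega>|M. 1)"
      by (rule integral_cong_AE) (use Z in auto)
    moreover have "expectation (\<lambda>\<omega>. (Z \<omega>)\<^sup>2) = expectation (\<lambda>\<omega>. 0)"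
      by (rule integral_cong_AE) (use Z in auto)
    ultimately show ?thesis by (simp add: prob_space)
  next
    case normal
    note D = normal(2)
    have \<mu>: "\<mu> = 0" using normal_distributed_expectation[OF normal] mean by simp
    have var: "expectation (\<lambda>\<omega>. (Z \<omega>)\<^sup>2) = \<sigma>\<^sup>2" using normal_distributed_variance[OF normal] mean by simp
    have "integrable M (\<lambda>\<omega>. \<bar>Z \<omega>\<bar> ^ p)" for p :: nat
      using distributed_integrable[OF D, of "\<lambda>x. \<bar>x\<bar> ^ p"] integrable_normal_moment_abs[OF normal(1), of \<mu> p] \<mu>
      by simp
    then have mom: "all_moments M (\<lambda>\<omega>. of_real (Z \<omega>))" by (simp add: all_moments_def)
    have "distributed M lborel (\<lambda>\<omega>. (Z \<omega> - \<mu>) / \<sigma>) std_normal_density"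
      using D normal_standard_normal_convert[OF normal(1)] by blast
    then have "distr M lborel (\<lambda>\<omega>. Z \<omega> / \<sigma>) = std_normal_distribution"
      using distributed_distr_eq_density \<mu> by fastforce
    then have "char std_normal_distribution \<sigma> = char (distr M lborel (\<lambda>\<omega>. Z \<omega> / \<sigma>)) \<sigma>" by simp
    also have "\<dots> = (LINT \<omega>|M. iexp (Z \<omega>))"
      unfolding char_def using normal(1) by (subst integral_distr) auto
    finally have "(LINT \<omega>|M. iexp (Z \<omega>)) = of_real (exp (- (\<sigma>\<^sup>2) / 2))"
      by (simp add: char_std_normal_distribution)
    then show ?thesis using mom var by simp
  qed
  then show "all_moments M (\<lambda>\<omega>. of_real (Z \<omega>))"
    and "(LINT \<omega>|M. iexp (Z \<omega>)) = of_real (exp (- expectation (\<lambda>\<omega>. (Z \<omega>)\<^sup>2) / 2))" by auto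
qed

end

section \<open>Wick polynomials against exponentials\<close>

definition lin_comb :: "('a \<Rightarrow> real) set \<Rightarrow> ('a \<Rightarrow> real) set" where
  "lin_comb G = {\<lambda>\<omega>. \<Sum>Y\<in>F. c Y * Y \<omega> | F c. finite F \<and> F \<subseteq> G}"

lemma lin_comb_base: "Y \<in> G \<Longrightarrow> Y \<in> lin_comb G"
  unfolding lin_comb_def by (rule CollectI, rule exI[of _ "{Y}"], rule exI[of _ "\<lambda>_. 1"]) auto

lemma lin_comb_mono: "G \<subseteq> G' \<Longrightarrow> lin_comb G \<subseteq> lin_comb G'"
  unfolding lin_comb_def by blast

lemma lin_comb_add_scaled:
  assumes "Y \<in> lin_comb G" "Z \<in> lin_comb G"
  shows "(\<lambda>\<omega>. Y \<omega> + \<theta> * Z \<omega>) \<in> lin_comb G"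
proof -
  obtain F c where F: "finite F" "F \<subseteq> G" "Y = (\<lambda>\<omega>. \<Sum>X\<in>F. c X * X \<omega>)" using assms(1) by (auto simp: lin_comb_def)
  obtain F' c' where F': "finite F'" "F' \<subseteq> G" "Z = (\<lambda>\<omega>. \<Sum>X\<in>F'. c' X * X \<omega>)" using assms(2) by (auto simp: lin_comb_def)
  let ?d = "\<lambda>X. (if X \<in> F then c X else 0) + \<theta> * (if X \<in> F' then c' X else 0)"
  have "(\<Sum>X\<in>F \<union> F'. ?d X * X \<omega>) = Y \<omega> + \<theta> * Z \<omega>" for \<omega>
  proof -
    have "(\<Sum>X\<in>F \<union> F'. ?d X * X \<omega>) = (\<Sum>X\<in>F \<union> F'. (if X \<in> F then c X * X \<omega> else 0)) + \<theta> * (\<Sum>X\<in>F \<union> F'. (if X \<in> F' then c' X * X \<omega> else 0))"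
      unfolding sum_distrib_left sum.distrib[symmetric] by (intro sum.cong refl) (auto simp: algebra_simps)
    also have "(\<Sum>X\<in>F \<union> F'. (if X \<in> F then c X * X \<omega> else 0)) = Y \<omega>"
      using F(1) F'(1) by (simp add: F(3) sum.inter_restrict[symmetric] Int_absorb1)
    also have "(\<Sum>X\<in>F \<union> F'. (if X \<in> F' then c' X * X \<omega> else 0)) = Z \<omega>"
      using F(1) F'(1) by (simp add: F'(3) sum.inter_restrict[symmetric] Int_absorb1)
    finally show ?thesis .
  qed
  then have "(\<lambda>\<omega>. Y \<omega> + \<theta> * Z \<omega>) = (\<lambda>\<omega>. \<Sum>X\<in>F \<union> F'. ?d X * X \<omega>)" by simp
  then show ?thesis unfolding lin_comb_def mem_Collect_eq using F(1,2) F'(1,2)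
    by (intro exI[of _ "F \<union> F'"] exI[of _ ?d]) simp
qed

locale centered_gaussian = prob_space M for M :: "'a measure" +
  fixes G :: "('a \<Rightarrow> real) set"
  assumes gaussian: "jointly_gaussian M G" and centered: "Y \<in> G \<Longrightarrow> expectation Y = 0"
begin

lemma base_gaussian: "Y \<in> lin_comb G \<Longrightarrow> gaussian_rv M Y"
  using gaussian by (auto simp: jointly_gaussian_def lin_comb_def)

lemma base_moments: "Y \<in> G \<Longrightarrow> all_moments M (\<lambda>\<omega>. of_real (Y \<omega>))"
  using gaussian_centered(1) base_gaussian lin_comb_base centered by blast

lemma integrable_base: "Y \<in> G \<Longrightarrow> integrable M Y"
  using all_moments_integrable[OF base_moments] by (simp add: complex_of_real_integrable_eq)

lemma lin_comb_mean: "Y \<in> lin_comb G \<Longrightarrow> expectation Y = 0"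
proof -
  assume "Y \<in> lin_comb G"
  then obtain F c where F: "finite F" "F \<subseteq> G" "Y = (\<lambda>\<omega>. \<Sum>X\<in>F. c X * X \<omega>)" by (auto simp: lin_comb_def)
  then have "expectation Y = (\<Sum>X\<in>F. c X * expectation X)"
    using integrable_base by (simp add: F(3) subset_iff Bochner_Integration.integral_sum)
  also have "\<dots> = 0" using F(2) centered by (intro sum.neutral) auto
  finally show ?thesis .
qed

lemma lin_comb_moments: "Y \<in> lin_comb G \<Longrightarrow> all_moments M (\<lambda>\<omega>. of_real (Y \<omega>))"
  using gaussian_centered(1) base_gaussian lin_comb_mean by blast

lemma lin_comb_measurable: "Y \<in> lin_comb G \<Longrightarrow> Y \<in> borel_measurable M"
  using base_gaussian by (simp add: gaussian_rv_def)

lemma lin_comb_iexp: "Z \<in> lin_comb G \<Longrightarrow>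
    (LINT \<omega>|M. iexp (Z \<omega>)) = of_real (exp (- expectation (\<lambda>\<omega>. (Z \<omega>)\<^sup>2) / 2))"
  using gaussian_centered(2) base_gaussian lin_comb_mean by blast

lemma all_moments_iexp: "Z \<in> lin_comb G \<Longrightarrow> all_moments M (\<lambda>\<omega>. iexp (Z \<omega>))"
  using lin_comb_measurable by (intro all_moments_bounded[where B=1]) auto

lemma integrable_lin_mult:
  assumes "Y \<in> lin_comb G" "Z \<in> lin_comb G" shows "integrable M (\<lambda>\<omega>. Y \<omega> * Z \<omega>)"
  using all_moments_integrable[OF all_moments_mult[OF lin_comb_moments[OF assms(1)] lin_comb_moments[OF assms(2)]]]
  by (simp add: complex_of_real_integrable_eq flip: of_real_mult)

text \<open>Real and imaginary part may be correlated in an arbitrary way; entries of a Hermitian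
  matrix off the diagonal, for instance, have vanishing \<open>E[Y Y]\<close>.\<close>

definition complex_gaussian :: "('a \<Rightarrow> complex) \<Rightarrow> bool" where
  "complex_gaussian Y \<longleftrightarrow> (\<lambda>\<omega>. Re (Y \<omega>)) \<in> lin_comb G \<and> (\<lambda>\<omega>. Im (Y \<omega>)) \<in> lin_comb G"

lemma complex_gaussian_moments:
  assumes "complex_gaussian Y" shows "all_moments M Y"
proof -
  have "all_moments M (\<lambda>\<omega>. of_real (Re (Y \<omega>)) + \<i> * of_real (Im (Y \<omega>)))"
    using assms lin_comb_moments unfolding complex_gaussian_def
    by (intro all_moments_add all_moments_mult all_moments_const) auto
  then show ?thesis by (simp add: complex_eq[symmetric])
qed

lemma integrable_c_lin:
  assumes "complex_gaussian Y" "Z \<in> lin_comb G" shows "integrable M (\<lambda>\<omega>. Y \<omega> * of_real (Z \<omega>))"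
  by (intro all_moments_integrable all_moments_mult complex_gaussian_moments lin_comb_moments assms)

text \<open>The covariances entering here are \<open>E[Y\<^sub>k Y\<^sub>l]\<close> without complex conjugation, since both sides are
  complex multilinear in the \<open>Y\<^sub>k\<close>.\<close>

theorem wick_iexp:
  fixes Y :: "nat \<Rightarrow> 'a \<Rightarrow> complex" and C :: "nat \<Rightarrow> nat \<Rightarrow> complex"
  assumes "finite U" and "\<And>k. k \<in> U \<Longrightarrow> complex_gaussian (Y k)"
    and "\<And>k l. k \<in> U \<Longrightarrow> l \<in> U \<Longrightarrow> k \<noteq> l \<Longrightarrow> C k l = (LINT \<omega>|M. Y k \<omega> * Y l \<omega>)"
    and "\<zeta> \<in> lin_comb G"
  shows "(LINT \<omega>|M. wick C (\<lambda>k. Y k \<omega>) U * iexp (\<zeta> \<omega>)) =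
    (\<Prod>k\<in>U. \<i> * (LINT \<omega>|M. Y k \<omega> * of_real (\<zeta> \<omega>))) * (LINT \<omega>|M. iexp (\<zeta> \<omega>))"
  using assms
proof (induction "card U" arbitrary: U \<zeta> rule: less_induct)
  case less
  show ?case
  proof (cases "U = {}")
    case True
    then show ?thesis by (simp add: wick_empty)
  next
    case False
    then obtain x where "x \<in> U" by blast
    define W where "W = U - {x}"
    have U: "U = insert x W" "x \<notin> W" "finite W" using \<open>x \<in> U\<close> less.prems(1) by (auto simp: W_def)
    have YW: "complex_gaussian (Y k)" if "k \<in> W" for k using that less.prems(2) U by blast
    have Yx: "complex_gaussian (Y x)" using less.prems(2) U by blast
    define w where "w \<omega> = wick C (\<lambda>k. Y k \<omega>) W" for \<omega>
    define e where "e \<xi> = (LINT \<omega>|M. iexp (\<xi> \<omega>))" for \<xi> :: "'a \<Rightarrow> real"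
    define c where "c k \<xi> = (LINT \<omega>|M. Y k \<omega> * of_real (\<xi> \<omega>))" for k and \<xi> :: "'a \<Rightarrow> real"
    have IH: "(LINT \<omega>|M. wick C (\<lambda>k. Y k \<omega>) W' * iexp (\<xi> \<omega>)) = (\<Prod>k\<in>W'. \<i> * c k \<xi>) * e \<xi>"
      if "W' \<subseteq> W" "\<xi> \<in> lin_comb G" for W' \<xi>
      unfolding c_def e_def
    proof (rule less.hyps)
      show "card W' < card U" using that(1) U less.prems(1) by (intro psubset_card_mono) auto
      show "finite W'" using that(1) U(3) finite_subset by blast
      have sub: "k \<in> U" if "k \<in> W'" for k using that \<open>W' \<subseteq> W\<close> U(1) by blast
      show "complex_gaussian (Y k)" if "k \<in> W'" for k by (rule less.prems(2)[OF sub[OF that]])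
      show "C k l = (LINT \<omega>|M. Y k \<omega> * Y l \<omega>)" if "k \<in> W'" "l \<in> W'" "k \<noteq> l" for k l
        by (rule less.prems(3)[OF sub[OF that(1)] sub[OF that(2)] that(3)])
    qed fact
    have wm: "all_moments M w" unfolding w_def[abs_def]
      using YW complex_gaussian_moments U(3) by (intro all_moments_wick) auto
    note \<zeta> = less.prems(4)
    \<comment> \<open>Gaussian integration by parts, obtained by differentiating the induction hypothesis for
      \<open>\<zeta> + \<theta> Z\<close> at \<open>\<theta> = 0\<close>.\<close>
    have step: "(LINT \<omega>|M. of_real (Z \<omega>) * (w \<omega> * iexp (\<zeta> \<omega>))) =
       (\<Sum>l\<in>W. c l Z * (\<Prod>k\<in>W - {l}. \<i> * c k \<zeta>)) * e \<zeta>
        + \<i> * of_real (expectation (\<lambda>\<omega>. \<zeta> \<omega> * Z \<omega>)) * (\<Prod>k\<in>W. \<i> * c k \<zeta>) * e \<zeta>"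
      if Z: "Z \<in> lin_comb G" for Z
    proof -
      define v0 v1 v2 where "v0 = expectation (\<lambda>\<omega>. (\<zeta> \<omega>)\<^sup>2)" and "v1 = expectation (\<lambda>\<omega>. \<zeta> \<omega> * Z \<omega>)"
        and "v2 = expectation (\<lambda>\<omega>. (Z \<omega>)\<^sup>2)"
      \<comment> \<open>The value of the right-hand side of the induction hypothesis at \<open>\<zeta> + z Z\<close>, for complex \<open>z\<close>.\<close>
      define g where "g z = (\<Prod>k\<in>W. \<i> * (c k \<zeta> + z * c k Z)) *
         exp (- (of_real v0 + 2 * z * of_real v1 + z\<^sup>2 * of_real v2) / 2)" for z
      have e\<zeta>: "e \<zeta> = exp (- (of_real v0) / 2)"
        unfolding e_def v0_def using lin_comb_iexp[OF \<zeta>] by (simp flip: exp_of_real)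
      define D where "D = (\<Sum>l\<in>W. \<i> * c l Z * (\<Prod>k\<in>W - {l}. \<i> * c k \<zeta>)) * e \<zeta> - of_real v1 * (\<Prod>k\<in>W. \<i> * c k \<zeta>) * e \<zeta>"
      have "(LINT \<omega>|M. of_real (Z \<omega>) * (w \<omega> * iexp (\<zeta> \<omega>))) = - \<i> * D"
      proof (rule derivative_under_expectation)
        show "integrable M (\<lambda>\<omega>. w \<omega> * iexp (\<zeta> \<omega>))"
          by (intro all_moments_integrable all_moments_mult wm all_moments_iexp \<zeta>)
        show "integrable M (\<lambda>\<omega>. of_real (Z \<omega>) * (w \<omega> * iexp (\<zeta> \<omega>)))"
          by (intro all_moments_integrable all_moments_mult wm all_moments_iexp \<zeta> lin_comb_moments Z)
        show "Z \<in> borel_measurable M" by (rule lin_comb_measurable[OF Z])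
        show "(LINT \<omega>|M. w \<omega> * iexp (\<zeta> \<omega>) * iexp (\<theta> * Z \<omega>)) = g (of_real \<theta>)" for \<theta> :: real
        proof -
          define \<xi> where "\<xi> \<omega> = \<zeta> \<omega> + \<theta> * Z \<omega>" for \<omega>
          have \<xi>: "\<xi> \<in> lin_comb G" unfolding \<xi>_def[abs_def] by (rule lin_comb_add_scaled[OF \<zeta> Z])
          have ie: "iexp (\<zeta> \<omega>) * iexp (\<theta> * Z \<omega>) = iexp (\<xi> \<omega>)" for \<omega>
            by (simp add: \<xi>_def exp_add[symmetric] algebra_simps)
          have ck: "c k \<xi> = c k \<zeta> + of_real \<theta> * c k Z" if "k \<in> W" for k
          proof -
            have "c k \<xi> = (LINT \<omega>|M. Y k \<omega> * of_real (\<zeta> \<omega>) + of_real \<theta> * (Y k \<omega> * of_real (Z \<omega>)))"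
              unfolding c_def \<xi>_def by (simp add: algebra_simps)
            then show ?thesis unfolding c_def
              using integrable_c_lin[OF YW[OF that] \<zeta>] integrable_c_lin[OF YW[OF that] Z] by simp
          qed
          have "expectation (\<lambda>\<omega>. (\<xi> \<omega>)\<^sup>2) = expectation (\<lambda>\<omega>. (\<zeta> \<omega>)\<^sup>2 + (2 * \<theta> * (\<zeta> \<omega> * Z \<omega>) + \<theta>\<^sup>2 * (Z \<omega>)\<^sup>2))"
            by (simp add: \<xi>_def power2_sum power_mult_distrib algebra_simps)
          also have "\<dots> = v0 + (2 * \<theta> * v1 + \<theta>\<^sup>2 * v2)"
            unfolding v0_def v1_def v2_def power2_eq_square
            using integrable_lin_mult[OF \<zeta> \<zeta>] integrable_lin_mult[OF \<zeta> Z] integrable_lin_mult[OF Z Z] by simp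
          finally have "e \<xi> = of_real (exp (- (v0 + (2 * \<theta> * v1 + \<theta>\<^sup>2 * v2)) / 2))"
            unfolding e_def using lin_comb_iexp[OF \<xi>] by simp
          then have ee: "e \<xi> = exp (- (of_real v0 + 2 * of_real \<theta> * of_real v1 + (of_real \<theta>)\<^sup>2 * of_real v2) / 2)"
            by (simp add: add.assoc flip: exp_of_real)
          have "(LINT \<omega>|M. w \<omega> * iexp (\<zeta> \<omega>) * iexp (\<theta> * Z \<omega>)) = (LINT \<omega>|M. w \<omega> * iexp (\<xi> \<omega>))"
            by (simp only: mult.assoc ie)
          also have "\<dots> = (\<Prod>k\<in>W. \<i> * c k \<xi>) * e \<xi>" unfolding w_def by (rule IH) (use \<xi> in auto)
          also have "\<dots> = g (of_real \<theta>)" unfolding g_def ee using ck by simp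
          finally show ?thesis .
        qed
        have "((\<lambda>z. \<Prod>k\<in>W. \<i> * (c k \<zeta> + z * c k Z)) has_field_derivative
            (\<Sum>l\<in>W. \<i> * c l Z * (\<Prod>k\<in>W - {l}. \<i> * c k \<zeta>))) (at 0)"
          by (rule DERIV_cong, rule has_field_derivative_prod, auto intro!: derivative_eq_intros)
        moreover have "((\<lambda>z. exp (- (of_real v0 + 2 * z * of_real v1 + z\<^sup>2 * of_real v2) / 2)) has_field_derivative
            - of_real v1 * e \<zeta>) (at 0)"
          unfolding e\<zeta> by (auto intro!: derivative_eq_intros)
        ultimately show "(g has_field_derivative D) (at 0)"
          unfolding g_def[abs_def] D_def by (auto intro!: DERIV_cong[OF DERIV_mult] simp: e\<zeta>)
      qed
      then show ?thesis by (simp add: D_def v1_def sum_distrib_left sum_distrib_right algebra_simps)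
    qed
    define A B where "A \<omega> = Re (Y x \<omega>)" and "B \<omega> = Im (Y x \<omega>)" for \<omega>
    have A: "A \<in> lin_comb G" and B: "B \<in> lin_comb G" using Yx by (auto simp: complex_gaussian_def A_def[abs_def] B_def[abs_def])
    have YAB: "Y x \<omega> = of_real (A \<omega>) + \<i> * of_real (B \<omega>)" for \<omega> by (simp add: A_def B_def complex_eq[symmetric])
    have int: "integrable M (\<lambda>\<omega>. of_real (Z \<omega>) * (w \<omega> * iexp (\<zeta> \<omega>)))" if "Z \<in> lin_comb G" for Z
      by (intro all_moments_integrable all_moments_mult wm all_moments_iexp \<zeta> lin_comb_moments that)
    have "(LINT \<omega>|M. Y x \<omega> * (w \<omega> * iexp (\<zeta> \<omega>))) =
       (LINT \<omega>|M. of_real (A \<omega>) * (w \<omega> * iexp (\<zeta> \<omega>)) + \<i> * (of_real (B \<omega>) * (w \<omega> * iexp (\<zeta> \<omega>))))"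
      unfolding YAB by (simp add: algebra_simps)
    also have "\<dots> = (LINT \<omega>|M. of_real (A \<omega>) * (w \<omega> * iexp (\<zeta> \<omega>))) + \<i> * (LINT \<omega>|M. of_real (B \<omega>) * (w \<omega> * iexp (\<zeta> \<omega>)))"
      using int[OF A] int[OF B] by simp
    also have "\<dots> = (\<Sum>l\<in>W. (c l A + \<i> * c l B) * (\<Prod>k\<in>W - {l}. \<i> * c k \<zeta>)) * e \<zeta> +
       \<i> * (of_real (expectation (\<lambda>\<omega>. \<zeta> \<omega> * A \<omega>)) + \<i> * of_real (expectation (\<lambda>\<omega>. \<zeta> \<omega> * B \<omega>))) * (\<Prod>k\<in>W. \<i> * c k \<zeta>) * e \<zeta>"
      unfolding step[OF A] step[OF B] by (simp add: algebra_simps sum.distrib sum_distrib_left sum_distrib_right)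
    also have "of_real (expectation (\<lambda>\<omega>. \<zeta> \<omega> * A \<omega>)) + \<i> * of_real (expectation (\<lambda>\<omega>. \<zeta> \<omega> * B \<omega>)) = c x \<zeta>"
    proof -
      have "integrable M (\<lambda>\<omega>. complex_of_real (\<zeta> \<omega> * A \<omega>))" "integrable M (\<lambda>\<omega>. complex_of_real (\<zeta> \<omega> * B \<omega>))"
        using integrable_lin_mult \<zeta> A B by (simp_all only: complex_of_real_integrable_eq)
      then have "(LINT \<omega>|M. of_real (\<zeta> \<omega> * A \<omega>) + \<i> * of_real (\<zeta> \<omega> * B \<omega>)) =
        of_real (expectation (\<lambda>\<omega>. \<zeta> \<omega> * A \<omega>)) + \<i> * of_real (expectation (\<lambda>\<omega>. \<zeta> \<omega> * B \<omega>))"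
        by (simp del: of_real_mult)
      then show ?thesis unfolding c_def YAB by (simp add: algebra_simps)
    qed
    also have "(\<Sum>l\<in>W. (c l A + \<i> * c l B) * (\<Prod>k\<in>W - {l}. \<i> * c k \<zeta>)) = (\<Sum>l\<in>W. C x l * (\<Prod>k\<in>W - {l}. \<i> * c k \<zeta>))"
    proof (rule sum.cong[OF refl])
      fix l assume l: "l \<in> W"
      have "C x l = (LINT \<omega>|M. Y x \<omega> * Y l \<omega>)" using less.prems(3)[of x l] l U by auto
      also have "\<dots> = (LINT \<omega>|M. Y l \<omega> * of_real (A \<omega>) + \<i> * (Y l \<omega> * of_real (B \<omega>)))"
        unfolding YAB by (simp add: algebra_simps)
      also have "\<dots> = c l A + \<i> * c l B" unfolding c_def
        using integrable_c_lin[OF YW[OF l] A] integrable_c_lin[OF YW[OF l] B] by simp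
      finally show "(c l A + \<i> * c l B) * (\<Prod>k\<in>W - {l}. \<i> * c k \<zeta>) = C x l * (\<Prod>k\<in>W - {l}. \<i> * c k \<zeta>)" by simp
    qed
    finally have main: "(LINT \<omega>|M. Y x \<omega> * (w \<omega> * iexp (\<zeta> \<omega>))) =
      (\<Sum>l\<in>W. C x l * (\<Prod>k\<in>W - {l}. \<i> * c k \<zeta>)) * e \<zeta> + \<i> * c x \<zeta> * (\<Prod>k\<in>W. \<i> * c k \<zeta>) * e \<zeta>" .
    have sym: "C x l = C l x" if "l \<in> W" for l
    proof -
      have "x \<noteq> l" using that U(2) by blast
      then show ?thesis
        using less.prems(3)[of x l] less.prems(3)[of l x] that U(1) by (auto simp: mult.commute)
    qed
    have wi: "wick C y U = y x * wick C y W - (\<Sum>l\<in>W. C x l * wick C y (W - {l}))" for y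
      unfolding U(1) by (rule wick_insert[OF U(2,3)]) (rule sym)
    have wl: "all_moments M (\<lambda>\<omega>. wick C (\<lambda>k. Y k \<omega>) (W - {l}))" for l
      using YW complex_gaussian_moments U(3) by (intro all_moments_wick) auto
    have "(LINT \<omega>|M. wick C (\<lambda>k. Y k \<omega>) U * iexp (\<zeta> \<omega>)) = (LINT \<omega>|M. Y x \<omega> * (w \<omega> * iexp (\<zeta> \<omega>)) -
       (\<Sum>l\<in>W. C x l * (wick C (\<lambda>k. Y k \<omega>) (W - {l}) * iexp (\<zeta> \<omega>))))"
      unfolding wi w_def by (simp add: algebra_simps sum_distrib_left)
    also have "\<dots> = (LINT \<omega>|M. Y x \<omega> * (w \<omega> * iexp (\<zeta> \<omega>))) -
       (\<Sum>l\<in>W. C x l * (LINT \<omega>|M. wick C (\<lambda>k. Y k \<omega>) (W - {l}) * iexp (\<zeta> \<omega>)))"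
    proof -
      have i1: "integrable M (\<lambda>\<omega>. Y x \<omega> * (w \<omega> * iexp (\<zeta> \<omega>)))"
        by (intro all_moments_integrable all_moments_mult wm all_moments_iexp \<zeta> complex_gaussian_moments Yx)
      have i2: "integrable M (\<lambda>\<omega>. C x l * (wick C (\<lambda>k. Y k \<omega>) (W - {l}) * iexp (\<zeta> \<omega>)))" for l
        by (intro all_moments_integrable all_moments_mult wl all_moments_iexp \<zeta> all_moments_const)
      show ?thesis using i1 i2 by (simp add: Bochner_Integration.integral_sum)
    qed
    also have "(\<Sum>l\<in>W. C x l * (LINT \<omega>|M. wick C (\<lambda>k. Y k \<omega>) (W - {l}) * iexp (\<zeta> \<omega>))) =
      (\<Sum>l\<in>W. C x l * (\<Prod>k\<in>W - {l}. \<i> * c k \<zeta>)) * e \<zeta>"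
      using \<zeta> by (simp add: IH sum_distrib_right mult.assoc)
    finally have "(LINT \<omega>|M. wick C (\<lambda>k. Y k \<omega>) U * iexp (\<zeta> \<omega>)) = \<i> * c x \<zeta> * (\<Prod>k\<in>W. \<i> * c k \<zeta>) * e \<zeta>"
      unfolding main by simp
    then show ?thesis using U by (simp add: c_def e_def)
  qed
qed

end

section \<open>Uniqueness of Fourier transforms\<close>

context prob_space
begin

lemma integrable_mult_iexp:
  fixes V :: "'a \<Rightarrow> complex"
  assumes "integrable M V" and [measurable]: "Z \<in> borel_measurable M"
  shows "integrable M (\<lambda>\<omega>. V \<omega> * iexp (Z \<omega>))"
  by (rule Bochner_Integration.integrable_bound[OF assms(1)])
     (use assms(1) in \<open>auto simp: norm_mult\<close>)

text \<open>Unless both vanish almost surely, \<open>V\<close> and \<open>W\<close> become, after normalization, densities of two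
  probability measures under which \<open>Z\<close> has the same characteristic function.\<close>

lemma fourier_unique_nonneg:
  fixes V W Z :: "'a \<Rightarrow> real"
  assumes V: "integrable M V" "\<And>\<omega>. 0 \<le> V \<omega>" and W: "integrable M W" "\<And>\<omega>. 0 \<le> W \<omega>"
    and [measurable]: "Z \<in> borel_measurable M" "B \<in> sets borel"
    and eq: "\<And>a. (LINT \<omega>|M. of_real (V \<omega>) * iexp (a * Z \<omega>)) = (LINT \<omega>|M. of_real (W \<omega>) * iexp (a * Z \<omega>))"
  shows "(LINT \<omega>|M. V \<omega> * indicator B (Z \<omega>)) = (LINT \<omega>|M. W \<omega> * indicator B (Z \<omega>))"
proof -
  have [measurable]: "V \<in> borel_measurable M" "W \<in> borel_measurable M" using V W by auto
  define c where "c = expectation V"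
  have "complex_of_real c = complex_of_real (expectation W)" using eq[of 0] by (simp add: c_def)
  then have cW: "c = expectation W" by simp
  have "0 \<le> c" unfolding c_def using V(2) by simp
  then consider "c = 0" | "0 < c" by linarith
  then show ?thesis
  proof cases
    case 1
    then have "AE \<omega> in M. V \<omega> = 0" "AE \<omega> in M. W \<omega> = 0"
      using integral_nonneg_eq_0_iff_AE[OF V(1)] integral_nonneg_eq_0_iff_AE[OF W(1)] V(2) W(2) cW c_def by auto
    then show ?thesis by (intro integral_cong_AE) auto
  next
    case 2
    define \<mu> where "\<mu> U = distr (density M (\<lambda>\<omega>. ennreal (U \<omega> / c))) borel Z" for U :: "'a \<Rightarrow> real"
    have prob: "real_distribution (\<mu> U)" and ch: "char (\<mu> U) a = (LINT \<omega>|M. of_real (U \<omega>) * iexp (a * Z \<omega>)) / c"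
      and meas: "measure (\<mu> U) B = (LINT \<omega>|M. U \<omega> * indicator B (Z \<omega>)) / c"
      if U: "integrable M U" "\<And>\<omega>. 0 \<le> U \<omega>" "expectation U = c" for U a
    proof -
      have [measurable]: "U \<in> borel_measurable M" using U by auto
      have nn: "(\<integral>\<^sup>+\<omega>. ennreal (U \<omega> / c) \<partial>M) = 1"
        using U 2 by (subst nn_integral_eq_integral) auto
      interpret D: prob_space "density M (\<lambda>\<omega>. ennreal (U \<omega> / c))"
        by (rule prob_spaceI) (simp add: emeasure_density nn cong: nn_integral_cong)
      have Zm: "Z \<in> borel_measurable (density M (\<lambda>\<omega>. ennreal (U \<omega> / c)))" by simp
      show "real_distribution (\<mu> U)" unfolding \<mu>_def real_distribution_def real_distribution_axioms_def
        using D.prob_space_distr[OF Zm] by simp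
      have "char (\<mu> U) a = (LINT \<omega>|density M (\<lambda>\<omega>. ennreal (U \<omega> / c)). iexp (a * Z \<omega>))"
        unfolding \<mu>_def char_def by (subst integral_distr[OF Zm]) auto
      also have "\<dots> = (LINT \<omega>|M. (U \<omega> / c) *\<^sub>R iexp (a * Z \<omega>))"
        using U 2 by (subst integral_density) auto
      also have "\<dots> = (LINT \<omega>|M. of_real (U \<omega>) * iexp (a * Z \<omega>) / c)"
        by (simp add: scaleR_conv_of_real)
      finally show "char (\<mu> U) a = (LINT \<omega>|M. of_real (U \<omega>) * iexp (a * Z \<omega>)) / c" by simp
      have "measure (\<mu> U) B = measure (density M (\<lambda>\<omega>. ennreal (U \<omega> / c))) (Z -` B \<inter> space M)"
        unfolding \<mu>_def by (subst measure_distr[OF Zm]) auto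
      also have "\<dots> = (LINT \<omega>|density M (\<lambda>\<omega>. ennreal (U \<omega> / c)). indicator (Z -` B \<inter> space M) \<omega>)"
        by simp
      also have "\<dots> = (LINT \<omega>|M. (U \<omega> / c) *\<^sub>R indicator (Z -` B \<inter> space M) \<omega>)"
        using U 2 by (subst integral_density) auto
      also have "\<dots> = (LINT \<omega>|M. U \<omega> * indicator B (Z \<omega>) / c)"
        by (intro Bochner_Integration.integral_cong) (auto simp: indicator_def)
      finally show "measure (\<mu> U) B = (LINT \<omega>|M. U \<omega> * indicator B (Z \<omega>)) / c" by simp
    qed
    have "\<mu> V = \<mu> W"
      by (rule Levy_uniqueness) (use prob ch V W cW c_def eq in \<open>auto simp: fun_eq_iff\<close>)
    then have "(LINT \<omega>|M. V \<omega> * indicator B (Z \<omega>)) / c = (LINT \<omega>|M. W \<omega> * indicator B (Z \<omega>)) / c"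
      using meas[of V] meas[of W] V W cW c_def by metis
    then show ?thesis using 2 by simp
  qed
qed

lemma fourier_unique_real:
  fixes V Z :: "'a \<Rightarrow> real"
  assumes V: "integrable M V" and [measurable]: "Z \<in> borel_measurable M" "B \<in> sets borel"
    and eq: "\<And>a. (LINT \<omega>|M. of_real (V \<omega>) * iexp (a * Z \<omega>)) = 0"
  shows "(LINT \<omega>|M. V \<omega> * indicator B (Z \<omega>)) = 0"
proof -
  define P N where "P \<omega> = max 0 (V \<omega>)" and "N \<omega> = max 0 (- V \<omega>)" for \<omega>
  have VPN: "V \<omega> = P \<omega> - N \<omega>" for \<omega> by (simp add: P_def N_def)
  have P: "integrable M P" "\<And>\<omega>. 0 \<le> P \<omega>" and N: "integrable M N" "\<And>\<omega>. 0 \<le> N \<omega>"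
    using V by (auto simp: P_def[abs_def] N_def[abs_def])
  have int: "integrable M (\<lambda>\<omega>. complex_of_real (U \<omega>) * iexp (a * Z \<omega>))" if "integrable M U" for U a
    using that by (intro integrable_mult_iexp) auto
  have intB: "integrable M (\<lambda>\<omega>. U \<omega> * indicator B (Z \<omega>))" if "integrable M U" for U :: "'a \<Rightarrow> real"
    by (rule Bochner_Integration.integrable_bound[OF that]) (use that in \<open>auto simp: indicator_def\<close>)
  have "(LINT \<omega>|M. of_real (P \<omega>) * iexp (a * Z \<omega>)) = (LINT \<omega>|M. of_real (N \<omega>) * iexp (a * Z \<omega>))" for a
  proof -
    have "0 = (LINT \<omega>|M. of_real (P \<omega>) * iexp (a * Z \<omega>) - of_real (N \<omega>) * iexp (a * Z \<omega>))"
      using eq[of a] unfolding VPN by (simp add: left_diff_distrib)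
    also have "\<dots> = (LINT \<omega>|M. of_real (P \<omega>) * iexp (a * Z \<omega>)) - (LINT \<omega>|M. of_real (N \<omega>) * iexp (a * Z \<omega>))"
      by (rule Bochner_Integration.integral_diff[OF int[OF P(1)] int[OF N(1)]])
    finally show ?thesis by simp
  qed
  then have "(LINT \<omega>|M. P \<omega> * indicator B (Z \<omega>)) = (LINT \<omega>|M. N \<omega> * indicator B (Z \<omega>))"
    by (intro fourier_unique_nonneg P N) auto
  moreover have "(LINT \<omega>|M. V \<omega> * indicator B (Z \<omega>)) = (LINT \<omega>|M. P \<omega> * indicator B (Z \<omega>)) - (LINT \<omega>|M. N \<omega> * indicator B (Z \<omega>))"
    unfolding VPN left_diff_distrib by (rule Bochner_Integration.integral_diff[OF intB[OF P(1)] intB[OF N(1)]])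
  ultimately show ?thesis by simp
qed

lemma integrable_mult_indicator_comp:
  fixes V :: "'a \<Rightarrow> complex"
  assumes "integrable M V" and [measurable]: "Z \<in> borel_measurable M" "B \<in> sets borel"
  shows "integrable M (\<lambda>\<omega>. V \<omega> * indicator B (Z \<omega>))"
  by (rule Bochner_Integration.integrable_bound[OF assms(1)])
     (use assms(1) in \<open>auto simp: indicator_def\<close>)

text \<open>Complex conjugation exchanges the frequencies \<open>a\<close> and \<open>-a\<close>; hence the Fourier transform also vanishes
  for the real and for the imaginary part of \<open>V\<close>.\<close>

lemma fourier_unique_complex:
  fixes V :: "'a \<Rightarrow> complex" and Z :: "'a \<Rightarrow> real"
  assumes V: "integrable M V" and Z[measurable]: "Z \<in> borel_measurable M" and B[measurable]: "B \<in> sets borel"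
    and eq: "\<And>a. (LINT \<omega>|M. V \<omega> * iexp (a * Z \<omega>)) = 0"
  shows "(LINT \<omega>|M. V \<omega> * indicator B (Z \<omega>)) = 0"
proof -
  have int: "integrable M (\<lambda>\<omega>. V \<omega> * iexp (a * Z \<omega>))" for a
    by (intro integrable_mult_iexp V) simp
  have eqc: "(LINT \<omega>|M. cnj (V \<omega>) * iexp (a * Z \<omega>)) = 0" for a
  proof -
    have "(LINT \<omega>|M. cnj (V \<omega>) * iexp (a * Z \<omega>)) = (LINT \<omega>|M. cnj (V \<omega> * iexp ((- a) * Z \<omega>)))"
      by (simp add: exp_cnj)
    also have "\<dots> = cnj (LINT \<omega>|M. V \<omega> * iexp ((- a) * Z \<omega>))" by (rule Bochner_Integration.integral_cnj)
    finally show ?thesis using eq[of "- a"] by simp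
  qed
  have Vc: "integrable M (\<lambda>\<omega>. cnj (V \<omega>))" using V by simp
  have intc: "integrable M (\<lambda>\<omega>. cnj (V \<omega>) * iexp (a * Z \<omega>))" for a
    by (intro integrable_mult_iexp Vc) simp
  have ri: "Re (z * indicator B x) = Re z * indicator B x" "Im (z * indicator B x) = Im z * indicator B x" for z and x :: real
    by (auto simp: indicator_def)
  have re: "of_real (Re z) = (z + cnj z) / 2" and im: "of_real (Im z) = (z - cnj z) * (- \<i> / 2)" for z
    by (auto simp: complex_eq_iff)
  have "(LINT \<omega>|M. of_real (Re (V \<omega>)) * iexp (a * Z \<omega>)) = 0" for a
  proof -
    have "(LINT \<omega>|M. of_real (Re (V \<omega>)) * iexp (a * Z \<omega>)) = (LINT \<omega>|M. (V \<omega> * iexp (a * Z \<omega>) + cnj (V \<omega>) * iexp (a * Z \<omega>)) / 2)"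
      unfolding re by (simp add: algebra_simps)
    then show ?thesis using eq eqc int intc by simp
  qed
  then have "(LINT \<omega>|M. Re (V \<omega>) * indicator B (Z \<omega>)) = 0"
    using V by (intro fourier_unique_real) auto
  moreover have "(LINT \<omega>|M. of_real (Im (V \<omega>)) * iexp (a * Z \<omega>)) = 0" for a
  proof -
    have "(LINT \<omega>|M. of_real (Im (V \<omega>)) * iexp (a * Z \<omega>)) = (LINT \<omega>|M. (V \<omega> * iexp (a * Z \<omega>) - cnj (V \<omega>) * iexp (a * Z \<omega>)) * (- \<i> / 2))"
      unfolding im by (simp add: algebra_simps)
    then show ?thesis using eq eqc int intc by simp
  qed
  then have "(LINT \<omega>|M. Im (V \<omega>) * indicator B (Z \<omega>)) = 0"
    using V by (intro fourier_unique_real) auto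
  moreover have "Re (LINT \<omega>|M. V \<omega> * indicator B (Z \<omega>)) = (LINT \<omega>|M. Re (V \<omega>) * indicator B (Z \<omega>))"
    using integral_Re[OF integrable_mult_indicator_comp[OF V Z B]] by (simp only: ri)
  moreover have "Im (LINT \<omega>|M. V \<omega> * indicator B (Z \<omega>)) = (LINT \<omega>|M. Im (V \<omega>) * indicator B (Z \<omega>))"
    using integral_Im[OF integrable_mult_indicator_comp[OF V Z B]] by (simp only: ri)
  ultimately show ?thesis by (simp add: complex_eq_iff)
qed

text \<open>The exponential factors are replaced by indicators one variable at a time: the factors not yet
  replaced, and the indicators already introduced, are absorbed into the weight \<open>V\<close>.
  In this way the one-dimensional uniqueness theorem suffices.\<close>

lemma fourier_unique_multi:
  fixes V :: "'a \<Rightarrow> complex"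
  assumes "finite F" "integrable M V" "\<And>Y. Y \<in> F \<Longrightarrow> Y \<in> borel_measurable M" "\<And>Y. Y \<in> F \<Longrightarrow> B Y \<in> sets borel"
    and "\<And>c. (LINT \<omega>|M. V \<omega> * iexp (\<Sum>Y\<in>F. c Y * Y \<omega>)) = 0"
  shows "(LINT \<omega>|M. V \<omega> * (\<Prod>Y\<in>F. indicator (B Y) (Y \<omega> :: real))) = 0"
  using assms
proof (induction F arbitrary: V rule: finite_induct)
  case empty
  then show ?case by simp
next
  case (insert Y F)
  have [measurable]: "Y \<in> borel_measurable M" "B Y \<in> sets borel" using insert.prems by auto
  have Fm[measurable]: "X \<in> borel_measurable M" if "X \<in> F" for X using insert.prems that by auto
  have "(LINT \<omega>|M. (V \<omega> * indicator (B Y) (Y \<omega>)) * (\<Prod>X\<in>F. indicator (B X) (X \<omega>))) = 0"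
  proof (rule insert.IH)
    show "integrable M (\<lambda>\<omega>. V \<omega> * indicator (B Y) (Y \<omega>))"
      by (intro integrable_mult_indicator_comp insert.prems) auto
    show "(LINT \<omega>|M. V \<omega> * indicator (B Y) (Y \<omega>) * iexp (\<Sum>X\<in>F. c X * X \<omega>)) = 0" for c
    proof -
      have "(LINT \<omega>|M. (V \<omega> * iexp (\<Sum>X\<in>F. c X * X \<omega>)) * indicator (B Y) (Y \<omega>)) = 0"
      proof (rule fourier_unique_complex)
        show "integrable M (\<lambda>\<omega>. V \<omega> * iexp (\<Sum>X\<in>F. c X * X \<omega>))"
          by (rule integrable_mult_iexp[OF insert.prems(1)])
            (intro borel_measurable_sum borel_measurable_times borel_measurable_const Fm)
        fix a
        have "(\<Sum>X\<in>insert Y F. (c(Y := a)) X * X \<omega>) = a * Y \<omega> + (\<Sum>X\<in>F. c X * X \<omega>)" for \<omega>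
        proof -
          have "(\<Sum>X\<in>F. (c(Y := a)) X * X \<omega>) = (\<Sum>X\<in>F. c X * X \<omega>)"
            using insert.hyps(2) by (intro sum.cong) auto
          then show ?thesis using insert.hyps by simp
        qed
        then have "iexp (\<Sum>X\<in>insert Y F. (c(Y := a)) X * X \<omega>) = iexp (\<Sum>X\<in>F. c X * X \<omega>) * iexp (a * Y \<omega>)" for \<omega>
          by (simp only: of_real_add distrib_left exp_add mult.commute)
        then show "(LINT \<omega>|M. V \<omega> * iexp (\<Sum>X\<in>F. c X * X \<omega>) * iexp (a * Y \<omega>)) = 0"
          using insert.prems(4)[of "c(Y := a)"] by (simp only: mult.assoc)
      qed auto
      then show ?thesis by (simp only: mult.assoc mult.commute mult.left_commute)
    qed
  qed (use insert.prems in auto)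
  then show ?case using insert.hyps by (simp add: mult.assoc)
qed

lemma fourier_unique_sigma:
  fixes V :: "'a \<Rightarrow> complex" and G :: "('a \<Rightarrow> real) set"
  assumes V: "integrable M V" and G: "\<And>Y. Y \<in> G \<Longrightarrow> Y \<in> borel_measurable M"
    and eq: "\<And>\<zeta>. \<zeta> \<in> lin_comb G \<Longrightarrow> (LINT \<omega>|M. V \<omega> * iexp (\<zeta> \<omega>)) = 0"
    and A: "A \<in> sigma_sets (space M) {Y -` B \<inter> space M | Y B. Y \<in> G \<and> B \<in> sets borel}"
  shows "(LINT \<omega>|M. indicator A \<omega> *\<^sub>R V \<omega>) = 0"
proof -
  define E where "E = {{\<omega> \<in> space M. \<forall>Y\<in>F. Y \<omega> \<in> B Y} | F B. finite F \<and> F \<subseteq> G \<and> (\<forall>Y\<in>F. B Y \<in> sets borel)}"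
  have sets_M: "{\<omega> \<in> space M. \<forall>Y\<in>F. Y \<omega> \<in> B Y} \<in> sets M" if "finite F" "F \<subseteq> G" "\<forall>Y\<in>F. B Y \<in> sets borel" for F B
  proof (rule sets.sets_Collect_finite_All[OF _ that(1)])
    fix Y assume "Y \<in> F"
    then have "Y -` B Y \<inter> space M \<in> sets M" using that G by (intro measurable_sets[of Y M borel]) auto
    moreover have "Y -` B Y \<inter> space M = {\<omega> \<in> space M. Y \<omega> \<in> B Y}" by auto
    ultimately show "{\<omega> \<in> space M. Y \<omega> \<in> B Y} \<in> sets M" by simp
  qed
  have sub: "sigma_sets (space M) E \<subseteq> sets M"
    by (rule sets.sigma_sets_subset) (use sets_M in \<open>auto simp: E_def\<close>)
  have gen: "{Y -` B \<inter> space M | Y B. Y \<in> G \<and> B \<in> sets borel} \<subseteq> E"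
  proof
    fix S assume "S \<in> {Y -` B \<inter> space M | Y B. Y \<in> G \<and> B \<in> sets borel}"
    then obtain Y B where "S = Y -` B \<inter> space M" "Y \<in> G" "B \<in> sets borel" by blast
    then show "S \<in> E" unfolding E_def mem_Collect_eq
      by (intro exI[of _ "{Y}"] exI[of _ "\<lambda>_. B"]) auto
  qed
  have AE: "A \<in> sigma_sets (space M) E" using sigma_sets_mono'[OF gen] A by blast
  have stable: "Int_stable E"
  proof (rule Int_stableI)
    fix S T assume "S \<in> E" "T \<in> E"
    then obtain F B F' B' where h: "S = {\<omega> \<in> space M. \<forall>Y\<in>F. Y \<omega> \<in> B Y}" "finite F" "F \<subseteq> G" "\<forall>Y\<in>F. B Y \<in> sets borel"
      "T = {\<omega> \<in> space M. \<forall>Y\<in>F'. Y \<omega> \<in> B' Y}" "finite F'" "F' \<subseteq> G" "\<forall>Y\<in>F'. B' Y \<in> sets borel"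
      unfolding E_def by blast
    let ?B = "\<lambda>Y. (if Y \<in> F then B Y else UNIV) \<inter> (if Y \<in> F' then B' Y else UNIV)"
    have "S \<inter> T = {\<omega> \<in> space M. \<forall>Y\<in>F \<union> F'. Y \<omega> \<in> ?B Y}" unfolding h(1,5) by auto
    then show "S \<inter> T \<in> E" unfolding E_def mem_Collect_eq using h
      by (intro exI[of _ "F \<union> F'"] exI[of _ ?B]) auto
  qed
  have ind_int: "integrable M (\<lambda>\<omega>. indicator S \<omega> *\<^sub>R V \<omega>)" if "S \<in> sets M" for S
    using that V by (rule integrable_mult_indicator)
  have basic: "(LINT \<omega>|M. indicator S \<omega> *\<^sub>R V \<omega>) = 0" if "S \<in> E" for S
  proof -
    from that have "\<exists>F B. S = {\<omega> \<in> space M. \<forall>Y\<in>F. Y \<omega> \<in> B Y} \<and> finite F \<and> F \<subseteq> G \<and> (\<forall>Y\<in>F. B Y \<in> sets borel)"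
      unfolding E_def mem_Collect_eq .
    then obtain F B where h: "S = {\<omega> \<in> space M. \<forall>Y\<in>F. Y \<omega> \<in> B Y}" "finite F" "F \<subseteq> G" "\<forall>Y\<in>F. B Y \<in> sets borel"
      by (elim exE conjE) (rule that)
    have "(LINT \<omega>|M. V \<omega> * (\<Prod>Y\<in>F. indicator (B Y) (Y \<omega>))) = 0"
    proof (rule fourier_unique_multi[OF h(2) V])
      show "(LINT \<omega>|M. V \<omega> * iexp (\<Sum>Y\<in>F. c Y * Y \<omega>)) = 0" for c
        by (rule eq) (use h(2,3) in \<open>auto simp: lin_comb_def\<close>)
    qed (use h G in auto)
    moreover have "indicator S \<omega> *\<^sub>R V \<omega> = V \<omega> * (\<Prod>Y\<in>F. indicator (B Y) (Y \<omega>))" if "\<omega> \<in> space M" for \<omega>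
    proof (cases "\<omega> \<in> S")
      case True
      then show ?thesis by (simp add: h(1))
    next
      case False
      then have "\<exists>Y\<in>F. Y \<omega> \<notin> B Y" using that h(1) by blast
      then obtain Y where "Y \<in> F" "Y \<omega> \<notin> B Y" by blast
      then have "(\<Prod>Y\<in>F. indicator (B Y) (Y \<omega>)) = (0 :: complex)" using h(2) by (intro prod_zero) (auto intro!: bexI[of _ Y])
      then show ?thesis using False by simp
    qed
    ultimately show ?thesis by (simp cong: Bochner_Integration.integral_cong)
  qed
  have EP: "E \<subseteq> Pow (space M)" by (auto simp: E_def)
  have whole: "(LINT \<omega>|M. V \<omega>) = 0"
  proof -
    have "(\<lambda>_. 0) \<in> lin_comb G" unfolding lin_comb_def by (rule CollectI, rule exI[of _ "{}"]) auto
    from eq[OF this] show ?thesis by simp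
  qed
  show ?thesis using stable EP AE
  proof (induction rule: sigma_sets_induct_disjoint)
    case (compl S)
    then have S: "S \<in> sets M" using sub by blast
    have "(LINT \<omega>|M. indicator (space M - S) \<omega> *\<^sub>R V \<omega>) = (LINT \<omega>|M. V \<omega> - indicator S \<omega> *\<^sub>R V \<omega>)"
      by (intro Bochner_Integration.integral_cong) (auto simp: indicator_def)
    also have "\<dots> = (LINT \<omega>|M. V \<omega>) - (LINT \<omega>|M. indicator S \<omega> *\<^sub>R V \<omega>)"
      by (rule Bochner_Integration.integral_diff[OF V ind_int[OF S]])
    finally show ?case using compl whole by simp
  next
    case (union S)
    then have S: "S i \<in> sets M" for i using sub by blast
    have "set_lebesgue_integral M (\<Union>i. S i) V = suminf (\<lambda>i. set_lebesgue_integral M (S i) V)"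
    proof (rule lebesgue_integral_countable_add)
      show "set_integrable M (\<Union>i. S i) V" unfolding set_integrable_def using S by (intro ind_int) auto
      show "S i \<inter> S j = {}" if "i \<noteq> j" for i j using union.hyps(1) that by (auto simp: disjoint_family_on_def)
    qed (rule S)
    then show ?case using union.IH by (simp add: set_lebesgue_integral_def)
  qed (use basic in auto)
qed

end

section \<open>The martingale property\<close>

lemma partitions12_eq: "partitions12 n = pair_partitions {1..n}"
  by (simp add: partitions12_def pair_partitions_def)

text \<open>The covariance in this Wick polynomial is that of the entries \<open>(r i, r (\<alpha> i))\<close> and \<open>(r j, r (\<alpha> j))\<close>
  of an \<open>N \<times> N\<close> Hermitian Gaussian matrix with variance parameter \<open>v\<close>.\<close>

definition wick_entry :: "complex^'n^'n \<Rightarrow> complex \<Rightarrow> nat \<Rightarrow> (nat \<Rightarrow> nat) \<Rightarrow> (nat \<Rightarrow> 'n) \<Rightarrow> complex" where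
  "wick_entry A v n \<alpha> r = wick (\<lambda>i j. if r i = r (\<alpha> j) \<and> r (\<alpha> i) = r j then v / of_nat CARD('n) else 0)
     (\<lambda>k. A $ r k $ r (\<alpha> k)) {1..n}"

text \<open>Once the sums over pairings and over index assignments are exchanged, the sum over pairings for a
  fixed assignment \<open>r\<close> is the Wick polynomial of the entries selected by \<open>r\<close>.\<close>

lemma hermite_trace_entry:
  fixes X :: "(real \<Rightarrow> real) \<Rightarrow> 'a \<Rightarrow> complex^'n^'n"
  assumes \<alpha>: "\<alpha> permutes {0..n}"
  shows "hermite_trace X n \<alpha> (\<lambda>_. h) \<omega> $ a $ b =
    (\<Sum>r \<in> {0..n} \<rightarrow>\<^sub>E UNIV. (if r 0 = b \<and> r (\<alpha> 0) = a then 1 else 0) *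
       wick_entry (X h \<omega>) (of_real (L2_inner h h)) n \<alpha> r)"
proof -
  let ?\<delta> = "\<lambda>r. (if r 0 = b \<and> r (\<alpha> 0) = a then 1 else 0) :: complex"
  let ?C = "\<lambda>r i j. if r i = r (\<alpha> j) \<and> r (\<alpha> i) = r j then complex_of_real (L2_inner h h) / of_nat CARD('n) else 0"
  let ?Y = "\<lambda>r k. X h \<omega> $ r k $ r (\<alpha> k)"
  have "hermite_trace X n \<alpha> (\<lambda>_. h) \<omega> $ a $ b =
    (\<Sum>\<pi>\<in>partitions12 n. of_real ((- 1) ^ card (pairs \<pi>) * L2_inner h h ^ card (pairs \<pi>)) *
       Tr_alg (n - 2 * card (pairs \<pi>)) (contraction (1 / real CARD('n)) n \<pi> \<alpha>) (\<lambda>k. X h \<omega>) $ a $ b)"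
    unfolding hermite_trace_def sum_component vector_scaleR_component by (simp add: scaleR_conv_of_real)
  also have "\<dots> = (\<Sum>\<pi>\<in>partitions12 n. \<Sum>r \<in> {0..n} \<rightarrow>\<^sub>E UNIV. ?\<delta> r * wick_term (?C r) (?Y r) \<pi>)"
  proof (rule sum.cong[OF refl])
    fix \<pi> assume \<pi>: "\<pi> \<in> partitions12 n"
    let ?d = "\<lambda>r P. if r (Min P) = r (\<alpha> (Max P)) \<and> r (\<alpha> (Min P)) = r (Max P) then 1 / of_nat CARD('n) else (0 :: complex)"
    have prodC: "(\<Prod>P\<in>pairs \<pi>. ?C r (Min P) (Max P)) = of_real (L2_inner h h ^ card (pairs \<pi>)) * (\<Prod>P\<in>pairs \<pi>. ?d r P)" for r :: "nat \<Rightarrow> 'n"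
    proof -
      have "(\<Prod>P\<in>pairs \<pi>. ?C r (Min P) (Max P)) = (\<Prod>P\<in>pairs \<pi>. of_real (L2_inner h h) * ?d r P)"
        by (intro prod.cong refl) simp
      then show ?thesis by (simp add: prod.distrib)
    qed
    show "of_real ((- 1) ^ card (pairs \<pi>) * L2_inner h h ^ card (pairs \<pi>)) *
       Tr_alg (n - 2 * card (pairs \<pi>)) (contraction (1 / real CARD('n)) n \<pi> \<alpha>) (\<lambda>k. X h \<omega>) $ a $ b =
       (\<Sum>r \<in> {0..n} \<rightarrow>\<^sub>E UNIV. ?\<delta> r * wick_term (?C r) (?Y r) \<pi>)"
      unfolding Tr_contraction_entry[OF \<pi> \<alpha>, of "\<lambda>_. X h \<omega>"] sum_distrib_left wick_term_def prodC
      by (intro sum.cong refl) simp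
  qed
  also have "\<dots> = (\<Sum>r \<in> {0..n} \<rightarrow>\<^sub>E UNIV. \<Sum>\<pi>\<in>partitions12 n. ?\<delta> r * wick_term (?C r) (?Y r) \<pi>)"
    by (rule sum.swap)
  also have "\<dots> = (\<Sum>r \<in> {0..n} \<rightarrow>\<^sub>E UNIV. ?\<delta> r * wick_entry (X h \<omega>) (of_real (L2_inner h h)) n \<alpha> r)"
    by (simp add: wick_entry_def wick_def partitions12_eq sum_distrib_left)
  finally show ?thesis .
qed

lemma vec_measurable_iff:
  fixes f :: "'a \<Rightarrow> ('b::euclidean_space)^'n"
  shows "f \<in> borel_measurable M \<longleftrightarrow> (\<forall>i. (\<lambda>\<omega>. f \<omega> $ i) \<in> borel_measurable M)"
proof (intro iffI allI)
  fix i assume "f \<in> borel_measurable M"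
  then show "(\<lambda>\<omega>. f \<omega> $ i) \<in> borel_measurable M"
    by (rule measurable_compose) (intro borel_measurable_continuous_onI continuous_on_component continuous_on_id)
next
  assume f: "\<forall>i. (\<lambda>\<omega>. f \<omega> $ i) \<in> borel_measurable M"
  show "f \<in> borel_measurable M"
  proof (subst borel_measurable_euclidean_space, rule ballI)
    fix x :: "'b^'n" assume "x \<in> Basis"
    then obtain i u where x: "x = axis i u" by (auto simp: Basis_vec_def)
    show "(\<lambda>\<omega>. f \<omega> \<bullet> x) \<in> borel_measurable M"
      unfolding x inner_axis using f by (intro borel_measurable_inner borel_measurable_const) blast
  qed
qed

lemma matrix_measurable_entry:
  fixes f :: "'a \<Rightarrow> complex^'n^'n"
  shows "f \<in> borel_measurable M \<longleftrightarrow> (\<forall>i j. (\<lambda>\<omega>. f \<omega> $ i $ j) \<in> borel_measurable M)"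
  by (simp only: vec_measurable_iff[of f] vec_measurable_iff[of "\<lambda>\<omega>. f \<omega> $ i" for i])

lemma matrix_measurable_iff:
  fixes f :: "'a \<Rightarrow> complex^'n^'n"
  shows "f \<in> borel_measurable M \<longleftrightarrow> (\<forall>i j. (\<lambda>\<omega>. Re (f \<omega> $ i $ j)) \<in> borel_measurable M \<and> (\<lambda>\<omega>. Im (f \<omega> $ i $ j)) \<in> borel_measurable M)"
  unfolding matrix_measurable_entry borel_measurable_complex_iff ..

lemma wick_entry_measurable:
  fixes f :: "'a \<Rightarrow> complex^'n^'n"
  assumes "f \<in> borel_measurable M"
  shows "(\<lambda>\<omega>. wick_entry (f \<omega>) v n \<alpha> r) \<in> borel_measurable M"
  using assms unfolding wick_entry_def wick_def wick_term_def matrix_measurable_entry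
  by (intro borel_measurable_sum borel_measurable_times borel_measurable_const borel_measurable_prod) auto

lemma L2_upto_sub: "L2_upto t \<subseteq> L2_Rplus"
  by (auto simp: L2_upto_def)

lemma L2_upto_mono: "s \<le> t \<Longrightarrow> L2_upto s \<subseteq> L2_upto t"
  unfolding L2_upto_def by (auto elim!: eventually_mono)

lemma indicator_L2: "0 \<le> t \<Longrightarrow> (indicator {0..t} :: real \<Rightarrow> real) \<in> L2_upto t"
proof -
  assume "0 \<le> t"
  let ?L = "lebesgue_on {0::real..}"
  have S: "{0..t} \<in> sets ?L" by (auto simp: sets_restrict_space_iff)
  have "emeasure ?L {0..t} = emeasure lebesgue {0..t}"
    by (rule emeasure_restrict_space) auto
  then have fin: "emeasure ?L {0..t} < \<infinity>" using \<open>0 \<le> t\<close> by simp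
  have sq: "(indicator {0..t} x :: real)\<^sup>2 = indicator {0..t} x" for x :: real by (simp add: indicator_def)
  have "integrable ?L (indicator {0..t} :: real \<Rightarrow> real)" using S fin by (rule integrable_real_indicator)
  then have "(indicator {0..t} :: real \<Rightarrow> real) \<in> L2_Rplus"
    unfolding L2_Rplus_def mem_Collect_eq sq using S by (intro conjI borel_measurable_indicator)
  then show ?thesis by (simp add: L2_upto_def)
qed

text \<open>The reason for the martingale property: a function supported in \<open>[0,s]\<close> does not see the
  increment of the indicator after time \<open>s\<close>.\<close>

lemma L2_inner_indicator_past:
  assumes "0 \<le> s" "s \<le> t" "h \<in> L2_upto s"
  shows "L2_inner (indicator {0..t}) h = L2_inner (indicator {0..s}) h"
  unfolding L2_inner_def
proof (rule integral_cong_AE)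
  let ?L = "lebesgue_on {0::real..}"
  have [measurable]: "h \<in> borel_measurable ?L" using assms(3) by (simp add: L2_upto_def L2_Rplus_def)
  have S: "(indicator {0..u} :: real \<Rightarrow> real) \<in> borel_measurable ?L" for u
    by (rule borel_measurable_indicator) (auto simp: sets_restrict_space_iff)
  show "(\<lambda>x. indicator {0..t} x * h x) \<in> borel_measurable ?L" "(\<lambda>x. indicator {0..s} x * h x) \<in> borel_measurable ?L"
    by (intro borel_measurable_times S; simp)+
  have "AE x in ?L. s < x \<longrightarrow> h x = 0" using assms(3) by (simp add: L2_upto_def)
  then show "AE x in ?L. indicator {0..t} x * h x = indicator {0..s} x * h x"
    by eventually_elim (use assms in \<open>auto simp: indicator_def\<close>)
qed

lemma (in prob_space) gaussian_rv_integrable: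
  assumes "gaussian_rv M Z" shows "integrable M Z"
proof -
  have [measurable]: "Z \<in> borel_measurable M" using assms by (simp add: gaussian_rv_def)
  consider (const) \<mu> where "AE \<omega> in M. Z \<omega> = \<mu>"
    | (normal) \<mu> \<sigma> where "0 < \<sigma>" "distributed M lborel Z (normal_density \<mu> \<sigma>)"
    using assms by (auto simp: gaussian_rv_def)
  then show ?thesis
  proof cases
    case const
    then have "integrable M Z \<longleftrightarrow> integrable M (\<lambda>\<omega>. \<mu>)" by (intro integrable_cong_AE) auto
    then show ?thesis by simp
  next
    case normal
    then show ?thesis
      using distributed_integrable_var[OF normal(2)] integrable_normal_moment_nz_1[OF normal(1)] by simp
  qed
qed

context hermitian_gaussian_process
begin

definition real_entries :: "(real \<Rightarrow> real) set \<Rightarrow> ('a \<Rightarrow> real) set" where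
  "real_entries H = {(\<lambda>\<omega>. Re (X h \<omega> $ i $ j)) | h i j. h \<in> H} \<union> {(\<lambda>\<omega>. Im (X h \<omega> $ i $ j)) | h i j. h \<in> H}"

lemma Re_entry: "h \<in> H \<Longrightarrow> (\<lambda>\<omega>. Re (X h \<omega> $ i $ j)) \<in> real_entries H"
  and Im_entry: "h \<in> H \<Longrightarrow> (\<lambda>\<omega>. Im (X h \<omega> $ i $ j)) \<in> real_entries H"
  unfolding real_entries_def by blast+

lemma entries_mono: "H \<subseteq> H' \<Longrightarrow> real_entries H \<subseteq> real_entries H'"
  unfolding real_entries_def by blast

lemma entries_gaussian: "jointly_gaussian M (real_entries L2_Rplus)"
  using X_gaussian by (simp add: real_entries_def)

lemma entry_integrable: "Y \<in> real_entries L2_Rplus \<Longrightarrow> integrable M Y"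
proof (rule gaussian_rv_integrable)
  assume "Y \<in> real_entries L2_Rplus"
  then have "gaussian_rv M (\<lambda>\<omega>. \<Sum>Z\<in>{Y}. 1 * Z \<omega>)"
    using entries_gaussian unfolding jointly_gaussian_def
    by (elim allE[of _ "{Y}"] allE[of _ "\<lambda>_. 1"]) simp
  then show "gaussian_rv M Y" by simp
qed

lemma X_entry_integrable: "h \<in> L2_Rplus \<Longrightarrow> integrable M (\<lambda>\<omega>. X h \<omega> $ i $ j)"
proof -
  assume "h \<in> L2_Rplus"
  then have "integrable M (\<lambda>\<omega>. complex_of_real (Re (X h \<omega> $ i $ j)) + \<i> * complex_of_real (Im (X h \<omega> $ i $ j)))"
    using entry_integrable[OF Re_entry] entry_integrable[OF Im_entry]
    by (intro Bochner_Integration.integrable_add integrable_mult_right) (simp_all add: complex_of_real_integrable_eq)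
  then show ?thesis by (simp flip: complex_eq)
qed

sublocale G: centered_gaussian M "real_entries L2_Rplus"
proof
  show "jointly_gaussian M (real_entries L2_Rplus)" by (rule entries_gaussian)
  fix Y assume "Y \<in> real_entries L2_Rplus"
  then consider h i j where "h \<in> L2_Rplus" "Y = (\<lambda>\<omega>. Re (X h \<omega> $ i $ j))"
    | h i j where "h \<in> L2_Rplus" "Y = (\<lambda>\<omega>. Im (X h \<omega> $ i $ j))" by (auto simp: real_entries_def)
  then show "expectation Y = 0"
  proof cases
    case 1 then show ?thesis using integral_Re[OF X_entry_integrable] X_centered by simp
  next
    case 2 then show ?thesis using integral_Im[OF X_entry_integrable] X_centered by simp
  qed
qed

lemma X_complex_gaussian: "h \<in> L2_Rplus \<Longrightarrow> G.complex_gaussian (\<lambda>\<omega>. X h \<omega> $ i $ j)"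
  unfolding G.complex_gaussian_def by (intro conjI lin_comb_base Re_entry Im_entry)

lemma X_mult_integrable: "f \<in> L2_Rplus \<Longrightarrow> g \<in> L2_Rplus \<Longrightarrow> integrable M (\<lambda>\<omega>. X f \<omega> $ i $ j * X g \<omega> $ k $ l)"
  by (intro all_moments_integrable all_moments_mult G.complex_gaussian_moments X_complex_gaussian)

text \<open>Up to null sets, real and imaginary parts of an entry are combinations of that entry and the
  transposed one, so that the bilinear covariance determines all correlations with them.\<close>

lemma covariance_entry:
  assumes f: "f \<in> L2_Rplus" and h: "h \<in> L2_Rplus"
  shows "(LINT \<omega>|M. X f \<omega> $ i $ j * of_real (Re (X h \<omega> $ k $ l))) =
     ((LINT \<omega>|M. X f \<omega> $ i $ j * X h \<omega> $ k $ l) + (LINT \<omega>|M. X f \<omega> $ i $ j * X h \<omega> $ l $ k)) / 2"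
    and "(LINT \<omega>|M. X f \<omega> $ i $ j * of_real (Im (X h \<omega> $ k $ l))) =
     ((LINT \<omega>|M. X f \<omega> $ i $ j * X h \<omega> $ k $ l) - (LINT \<omega>|M. X f \<omega> $ i $ j * X h \<omega> $ l $ k)) / (2 * \<i>)"
proof -
  have ints: "integrable M (\<lambda>\<omega>. X f \<omega> $ i $ j * X h \<omega> $ k $ l)" "integrable M (\<lambda>\<omega>. X f \<omega> $ i $ j * X h \<omega> $ l $ k)"
    using X_mult_integrable[OF f h] by auto
  have ent: "(\<lambda>\<omega>. X g \<omega> $ k' $ l') \<in> borel_measurable M" if "g \<in> L2_Rplus" for g k' l'
    using X_measurable[OF that] matrix_measurable_entry by blast
  have m[measurable]: "(\<lambda>\<omega>. X f \<omega> $ i $ j) \<in> borel_measurable M" "(\<lambda>\<omega>. X h \<omega> $ k $ l) \<in> borel_measurable M"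
     "(\<lambda>\<omega>. X h \<omega> $ l $ k) \<in> borel_measurable M" by (intro ent f h)+
  have herm: "AE \<omega> in M. X h \<omega> $ l $ k = cnj (X h \<omega> $ k $ l)"
    using X_hermitian[OF h] by eventually_elim (unfold hermitian_def, blast)
  have re: "of_real (Re z) = (z + cnj z) / 2" and im: "of_real (Im z) = (z - cnj z) / (2 * \<i>)" for z
    by (auto simp: complex_eq_iff Re_divide Im_divide power2_eq_square)
  have "(LINT \<omega>|M. X f \<omega> $ i $ j * of_real (Re (X h \<omega> $ k $ l))) =
     (LINT \<omega>|M. (X f \<omega> $ i $ j * X h \<omega> $ k $ l + X f \<omega> $ i $ j * X h \<omega> $ l $ k) / 2)"
  proof (rule integral_cong_AE)
    show "AE \<omega> in M. X f \<omega> $ i $ j * of_real (Re (X h \<omega> $ k $ l)) =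
      (X f \<omega> $ i $ j * X h \<omega> $ k $ l + X f \<omega> $ i $ j * X h \<omega> $ l $ k) / 2"
      using herm by eventually_elim (simp add: re algebra_simps)
  qed (use m in measurable)
  then show "(LINT \<omega>|M. X f \<omega> $ i $ j * of_real (Re (X h \<omega> $ k $ l))) =
     ((LINT \<omega>|M. X f \<omega> $ i $ j * X h \<omega> $ k $ l) + (LINT \<omega>|M. X f \<omega> $ i $ j * X h \<omega> $ l $ k)) / 2"
    using ints by simp
  have "(LINT \<omega>|M. X f \<omega> $ i $ j * of_real (Im (X h \<omega> $ k $ l))) =
     (LINT \<omega>|M. (X f \<omega> $ i $ j * X h \<omega> $ k $ l - X f \<omega> $ i $ j * X h \<omega> $ l $ k) / (2 * \<i>))"
  proof (rule integral_cong_AE)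
    show "AE \<omega> in M. X f \<omega> $ i $ j * of_real (Im (X h \<omega> $ k $ l)) =
      (X f \<omega> $ i $ j * X h \<omega> $ k $ l - X f \<omega> $ i $ j * X h \<omega> $ l $ k) / (2 * \<i>)"
      using herm by eventually_elim (simp only: im right_diff_distrib times_divide_eq_right)
  qed (use m in measurable)
  then show "(LINT \<omega>|M. X f \<omega> $ i $ j * of_real (Im (X h \<omega> $ k $ l))) =
     ((LINT \<omega>|M. X f \<omega> $ i $ j * X h \<omega> $ k $ l) - (LINT \<omega>|M. X f \<omega> $ i $ j * X h \<omega> $ l $ k)) / (2 * \<i>)"
    using ints by simp
qed

lemma covariance_past:
  assumes f: "f \<in> L2_Rplus" "g \<in> L2_Rplus" and H: "H \<subseteq> L2_Rplus"
    and eq: "\<And>h. h \<in> H \<Longrightarrow> L2_inner f h = L2_inner g h"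
    and \<zeta>: "\<zeta> \<in> lin_comb (real_entries H)"
  shows "(LINT \<omega>|M. X f \<omega> $ i $ j * of_real (\<zeta> \<omega>)) = (LINT \<omega>|M. X g \<omega> $ i $ j * of_real (\<zeta> \<omega>))"
proof -
  obtain F c where F: "finite F" "F \<subseteq> real_entries H" "\<zeta> = (\<lambda>\<omega>. \<Sum>Y\<in>F. c Y * Y \<omega>)"
    using \<zeta> by (auto simp: lin_comb_def)
  have sub: "real_entries H \<subseteq> real_entries L2_Rplus" by (rule entries_mono[OF H])
  have expand: "(LINT \<omega>|M. X u \<omega> $ i $ j * of_real (\<zeta> \<omega>)) = (\<Sum>Y\<in>F. of_real (c Y) * (LINT \<omega>|M. X u \<omega> $ i $ j * of_real (Y \<omega>)))"
    if "u \<in> L2_Rplus" for u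
  proof -
    have "(LINT \<omega>|M. X u \<omega> $ i $ j * of_real (\<zeta> \<omega>)) = (LINT \<omega>|M. (\<Sum>Y\<in>F. of_real (c Y) * (X u \<omega> $ i $ j * of_real (Y \<omega>))))"
      unfolding F(3) by (simp add: sum_distrib_left algebra_simps)
    also have "\<dots> = (\<Sum>Y\<in>F. LINT \<omega>|M. of_real (c Y) * (X u \<omega> $ i $ j * of_real (Y \<omega>)))"
    proof (rule Bochner_Integration.integral_sum)
      fix Y assume "Y \<in> F"
      then have "Y \<in> lin_comb (real_entries L2_Rplus)" using F(2) sub lin_comb_base by blast
      then show "integrable M (\<lambda>\<omega>. of_real (c Y) * (X u \<omega> $ i $ j * of_real (Y \<omega>)))"
        by (intro integrable_mult_right G.integrable_c_lin X_complex_gaussian that)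
    qed
    finally show ?thesis by simp
  qed
  have "(LINT \<omega>|M. X f \<omega> $ i $ j * of_real (Y \<omega>)) = (LINT \<omega>|M. X g \<omega> $ i $ j * of_real (Y \<omega>))" if "Y \<in> F" for Y
  proof -
    have Y: "Y \<in> real_entries H" using that F(2) by blast
    have cov: "(LINT \<omega>|M. X f \<omega> $ i $ j * X h \<omega> $ k $ l) = (LINT \<omega>|M. X g \<omega> $ i $ j * X h \<omega> $ k $ l)"
      if "h \<in> H" for h k l
      using X_covariance[OF f(1)] X_covariance[OF f(2)] that H eq by (simp add: subset_iff)
    consider h k l where "h \<in> H" "Y = (\<lambda>\<omega>. Re (X h \<omega> $ k $ l))"
      | h k l where "h \<in> H" "Y = (\<lambda>\<omega>. Im (X h \<omega> $ k $ l))" using Y by (auto simp: real_entries_def)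
    then show ?thesis
    proof cases
      case 1
      then have "h \<in> L2_Rplus" using H by blast
      show ?thesis unfolding 1(2) covariance_entry[OF f(1) \<open>h \<in> L2_Rplus\<close>] covariance_entry[OF f(2) \<open>h \<in> L2_Rplus\<close>] cov[OF 1(1)] by (rule refl)
    next
      case 2
      then have "h \<in> L2_Rplus" using H by blast
      show ?thesis unfolding 2(2) covariance_entry[OF f(1) \<open>h \<in> L2_Rplus\<close>] covariance_entry[OF f(2) \<open>h \<in> L2_Rplus\<close>] cov[OF 2(1)] by (rule refl)
    qed
  qed
  then show ?thesis using expand[OF f(1)] expand[OF f(2)] by simp
qed

lemma wick_entry_moments:
  "h \<in> L2_Rplus \<Longrightarrow> all_moments M (\<lambda>\<omega>. wick_entry (X h \<omega>) v n \<alpha> r)"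
  unfolding wick_entry_def by (intro all_moments_wick G.complex_gaussian_moments X_complex_gaussian) auto

lemma wick_entry_iexp:
  assumes h: "h \<in> L2_Rplus" and \<zeta>: "\<zeta> \<in> lin_comb (real_entries L2_Rplus)"
  shows "(LINT \<omega>|M. wick_entry (X h \<omega>) (of_real (L2_inner h h)) n \<alpha> r * iexp (\<zeta> \<omega>)) =
    (\<Prod>k\<in>{1..n}. \<i> * (LINT \<omega>|M. X h \<omega> $ r k $ r (\<alpha> k) * of_real (\<zeta> \<omega>))) * (LINT \<omega>|M. iexp (\<zeta> \<omega>))"
  unfolding wick_entry_def
proof (rule G.wick_iexp[where Y="\<lambda>k \<omega>. X h \<omega> $ r k $ r (\<alpha> k)"])
  show "(if r k = r (\<alpha> l) \<and> r (\<alpha> k) = r l then of_real (L2_inner h h) / of_nat CARD('n) else 0) =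
    (LINT \<omega>|M. X h \<omega> $ r k $ r (\<alpha> k) * X h \<omega> $ r l $ r (\<alpha> l))" for k l
    by (simp add: X_covariance[OF h h])
qed (use \<zeta> X_complex_gaussian[OF h] in auto)

lemma space_filtration: "space (natural_filtration M X t) = space M"
  unfolding natural_filtration_def by (rule space_measure_of) auto

lemma sets_filtration: "sets (natural_filtration M X t) =
    sigma_sets (space M) {X h -` B \<inter> space M | h B. h \<in> L2_upto t \<and> B \<in> sets borel}"
  unfolding natural_filtration_def by (rule sets_measure_of) auto

lemma X_measurable_filtration: "h \<in> L2_upto t \<Longrightarrow> X h \<in> borel_measurable (natural_filtration M X t)"
proof (rule measurableI)
  fix B :: "(complex^'n^'n) set" assume "h \<in> L2_upto t" "B \<in> sets borel"
  then show "X h -` B \<inter> space (natural_filtration M X t) \<in> sets (natural_filtration M X t)"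
    unfolding sets_filtration space_filtration by (intro sigma_sets.Basic) blast
qed (simp add: space_filtration)

lemma subalgebra_filtration: "subalgebra M (natural_filtration M X t)"
  unfolding subalgebra_def sets_filtration space_filtration
proof (intro conjI refl sets.sigma_sets_subset subsetI)
  fix S assume "S \<in> {X h -` B \<inter> space M | h B. h \<in> L2_upto t \<and> B \<in> sets borel}"
  then show "S \<in> sets M" using X_measurable L2_upto_sub measurable_sets by blast
qed

lemma filtration_mono: "s \<le> t \<Longrightarrow> subalgebra (natural_filtration M X t) (natural_filtration M X s)"
  unfolding subalgebra_def sets_filtration space_filtration
  using L2_upto_mono by (intro conjI refl sigma_sets_mono') blast

lemma filtration_generated_by_entries:
  "sets (natural_filtration M X t) \<subseteq>
    sigma_sets (space M) {Y -` B \<inter> space M | Y B. Y \<in> real_entries (L2_upto t) \<and> B \<in> sets borel}"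
proof -
  define \<Sigma> where "\<Sigma> = sigma (space M) {Y -` B \<inter> space M | Y B. Y \<in> real_entries (L2_upto t) \<and> B \<in> sets borel}"
  have sp: "space \<Sigma> = space M" unfolding \<Sigma>_def by (rule space_measure_of) auto
  have se: "sets \<Sigma> = sigma_sets (space M) {Y -` B \<inter> space M | Y B. Y \<in> real_entries (L2_upto t) \<and> B \<in> sets borel}"
    unfolding \<Sigma>_def by (rule sets_measure_of) auto
  have ent: "Y \<in> borel_measurable \<Sigma>" if "Y \<in> real_entries (L2_upto t)" for Y
  proof (rule measurableI)
    fix B :: "real set" assume "B \<in> sets borel"
    then show "Y -` B \<inter> space \<Sigma> \<in> sets \<Sigma>" unfolding sp se using that by (intro sigma_sets.Basic) blast
  qed simp
  have X: "X h \<in> borel_measurable \<Sigma>" if "h \<in> L2_upto t" for h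
    unfolding matrix_measurable_iff using ent Re_entry Im_entry that by blast
  have "{X h -` B \<inter> space M | h B. h \<in> L2_upto t \<and> B \<in> sets borel} \<subseteq> sets \<Sigma>"
    using measurable_sets[OF X] sp by auto
  then have "sigma_sets (space \<Sigma>) {X h -` B \<inter> space M | h B. h \<in> L2_upto t \<and> B \<in> sets borel} \<subseteq> sets \<Sigma>"
    by (rule sets.sigma_sets_subset)
  then show ?thesis unfolding sets_filtration se sp .
qed

theorem hermite_trace_martingale:
  assumes \<alpha>: "\<alpha> permutes {0..n}"
  shows "matrix_martingale M {0..} (natural_filtration M X) (\<lambda>t. hermite_trace X n \<alpha> (\<lambda>_. indicator {0..t}))"
proof -
  define I where "I t = (indicator {0..t} :: real \<Rightarrow> real)" for t
  define v where "v t = complex_of_real (L2_inner (I t) (I t))" for t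
  define H where "H t = hermite_trace X n \<alpha> (\<lambda>_. I t)" for t
  have It: "I t \<in> L2_upto t" if "0 \<le> t" for t unfolding I_def using that by (rule indicator_L2)
  then have IL: "I t \<in> L2_Rplus" if "0 \<le> t" for t using that L2_upto_sub by blast
  have entry: "H t \<omega> $ a $ b = (\<Sum>r \<in> {0..n} \<rightarrow>\<^sub>E UNIV. (if r 0 = b \<and> r (\<alpha> 0) = a then 1 else 0) *
       wick_entry (X (I t) \<omega>) (v t) n \<alpha> r)" for t \<omega> a b
    unfolding H_def v_def by (rule hermite_trace_entry[OF \<alpha>])
  have adapted: "H t \<in> borel_measurable (natural_filtration M X t)" if "0 \<le> t" for t
    unfolding matrix_measurable_entry entry
    by (intro allI borel_measurable_sum borel_measurable_times borel_measurable_const wick_entry_measurable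
        X_measurable_filtration It that)
  have mom: "all_moments M (\<lambda>\<omega>. H t \<omega> $ a $ b)" if "0 \<le> t" for t a b
    unfolding entry
    by (intro all_moments_sum all_moments_mult all_moments_const wick_entry_moments IL that)
  then have int: "integrable M (\<lambda>\<omega>. H t \<omega> $ a $ b)" if "0 \<le> t" for t a b
    using that all_moments_integrable by blast
  have cond: "AE \<omega> in M. matrix_cond_exp M (natural_filtration M X s) (H t) \<omega> = H s \<omega>"
    if s: "0 \<le> s" and st: "s \<le> t" for s t
  proof -
    let ?F = "natural_filtration M X s"
    have t: "0 \<le> t" using s st by simp
    interpret F: finite_measure_subalgebra M ?F
      using subalgebra_filtration by unfold_locales
    have sub: "real_entries (L2_upto s) \<subseteq> real_entries L2_Rplus"
      by (rule entries_mono[OF L2_upto_sub])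
    have orth: "(LINT \<omega>|M. indicator A \<omega> *\<^sub>R (H t \<omega> $ a $ b - H s \<omega> $ a $ b)) = 0" if A: "A \<in> sets ?F" for A a b
    proof (rule fourier_unique_sigma[where G="real_entries (L2_upto s)"])
      show "integrable M (\<lambda>\<omega>. H t \<omega> $ a $ b - H s \<omega> $ a $ b)" using int s t by simp
      show "Y \<in> borel_measurable M" if "Y \<in> real_entries (L2_upto s)" for Y
        using that sub lin_comb_base G.lin_comb_measurable by blast
      show "A \<in> sigma_sets (space M) {Y -` B \<inter> space M | Y B. Y \<in> real_entries (L2_upto s) \<and> B \<in> sets borel}"
        using A filtration_generated_by_entries by blast
      fix \<zeta> assume \<zeta>: "\<zeta> \<in> lin_comb (real_entries (L2_upto s))"
      then have \<zeta>': "\<zeta> \<in> lin_comb (real_entries L2_Rplus)" using lin_comb_mono[OF sub] by blast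
      have expand: "(LINT \<omega>|M. H u \<omega> $ a $ b * iexp (\<zeta> \<omega>)) = (\<Sum>r \<in> {0..n} \<rightarrow>\<^sub>E UNIV. (if r 0 = b \<and> r (\<alpha> 0) = a then 1 else 0) *
         ((\<Prod>k\<in>{1..n}. \<i> * (LINT \<omega>|M. X (I u) \<omega> $ r k $ r (\<alpha> k) * of_real (\<zeta> \<omega>))) * (LINT \<omega>|M. iexp (\<zeta> \<omega>))))"
        if u: "0 \<le> u" for u
      proof -
        have "(LINT \<omega>|M. H u \<omega> $ a $ b * iexp (\<zeta> \<omega>)) = (LINT \<omega>|M. (\<Sum>r \<in> {0..n} \<rightarrow>\<^sub>E UNIV. (if r 0 = b \<and> r (\<alpha> 0) = a then 1 else 0) *
          (wick_entry (X (I u) \<omega>) (v u) n \<alpha> r * iexp (\<zeta> \<omega>))))"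
          unfolding entry by (simp only: sum_distrib_right mult.assoc)
        also have "\<dots> = (\<Sum>r \<in> {0..n} \<rightarrow>\<^sub>E UNIV. LINT \<omega>|M. (if r 0 = b \<and> r (\<alpha> 0) = a then 1 else 0) *
          (wick_entry (X (I u) \<omega>) (v u) n \<alpha> r * iexp (\<zeta> \<omega>)))"
          by (intro Bochner_Integration.integral_sum all_moments_integrable all_moments_mult all_moments_const
              wick_entry_moments IL u G.all_moments_iexp \<zeta>')
        also have "\<dots> = (\<Sum>r \<in> {0..n} \<rightarrow>\<^sub>E UNIV. (if r 0 = b \<and> r (\<alpha> 0) = a then 1 else 0) *
          (LINT \<omega>|M. wick_entry (X (I u) \<omega>) (v u) n \<alpha> r * iexp (\<zeta> \<omega>)))"
          by (intro sum.cong refl integral_mult_right_zero)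
        finally show ?thesis unfolding v_def wick_entry_iexp[OF IL[OF u] \<zeta>'] .
      qed
      have cov: "(LINT \<omega>|M. X (I t) \<omega> $ i $ j * of_real (\<zeta> \<omega>)) = (LINT \<omega>|M. X (I s) \<omega> $ i $ j * of_real (\<zeta> \<omega>))" for i j
        by (rule covariance_past[OF IL[OF t] IL[OF s] L2_upto_sub _ \<zeta>])
          (use L2_inner_indicator_past[OF s st] in \<open>simp add: I_def\<close>)
      have "(LINT \<omega>|M. (H t \<omega> $ a $ b - H s \<omega> $ a $ b) * iexp (\<zeta> \<omega>)) =
        (LINT \<omega>|M. H t \<omega> $ a $ b * iexp (\<zeta> \<omega>)) - (LINT \<omega>|M. H s \<omega> $ a $ b * iexp (\<zeta> \<omega>))"
        unfolding left_diff_distrib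
        by (intro Bochner_Integration.integral_diff all_moments_integrable all_moments_mult mom s t G.all_moments_iexp \<zeta>')
      also have "\<dots> = 0" unfolding expand[OF s] expand[OF t] cov by simp
      finally show "(LINT \<omega>|M. (H t \<omega> $ a $ b - H s \<omega> $ a $ b) * iexp (\<zeta> \<omega>)) = 0" .
    qed
    have proj: "(LINT \<omega>:A|M. L (H t \<omega> $ a $ b)) = (LINT \<omega>:A|M. L (H s \<omega> $ a $ b))"
      if A: "A \<in> sets ?F" and L: "bounded_linear L" for A a b and L :: "complex \<Rightarrow> real"
    proof -
      interpret L: bounded_linear L by (rule L)
      have AM: "A \<in> sets M" using A subalgebra_filtration by (auto simp: subalgebra_def)
      have i: "integrable M (\<lambda>\<omega>. indicator A \<omega> *\<^sub>R (H t \<omega> $ a $ b - H s \<omega> $ a $ b))"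
        using AM int s t by (intro integrable_mult_indicator Bochner_Integration.integrable_diff) auto
      have iL: "set_integrable M A (\<lambda>\<omega>. L (H u \<omega> $ a $ b))" if "0 \<le> u" for u
        unfolding set_integrable_def using AM integrable_bounded_linear[OF L int[OF that]] by (intro integrable_mult_indicator) auto
      have "0 = L (LINT \<omega>|M. indicator A \<omega> *\<^sub>R (H t \<omega> $ a $ b - H s \<omega> $ a $ b))" using orth[OF A] by (simp add: L.zero)
      also have "\<dots> = (LINT \<omega>:A|M. L (H t \<omega> $ a $ b) - L (H s \<omega> $ a $ b))"
        unfolding set_lebesgue_integral_def integral_bounded_linear[OF L i, symmetric] by (simp add: L.scaleR L.diff)
      also have "\<dots> = (LINT \<omega>:A|M. L (H t \<omega> $ a $ b)) - (LINT \<omega>:A|M. L (H s \<omega> $ a $ b))"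
        by (rule set_integral_diff(2)[OF iL[OF t] iL[OF s]])
      finally show ?thesis by simp
    qed
    have ce: "AE \<omega> in M. real_cond_exp M ?F (\<lambda>\<omega>. L (H t \<omega> $ a $ b)) \<omega> = L (H s \<omega> $ a $ b)"
      if L: "bounded_linear L" for a b and L :: "complex \<Rightarrow> real"
    proof (rule F.real_cond_exp_charact[OF proj[OF _ L]])
      show "integrable M (\<lambda>\<omega>. L (H t \<omega> $ a $ b))" "integrable M (\<lambda>\<omega>. L (H s \<omega> $ a $ b))"
        by (intro integrable_bounded_linear[OF L] int s t)+
      have "(\<lambda>\<omega>. H s \<omega> $ a $ b) \<in> borel_measurable ?F" using adapted[OF s] by (simp add: matrix_measurable_entry)
      then show "(\<lambda>\<omega>. L (H s \<omega> $ a $ b)) \<in> borel_measurable ?F"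
        by (rule measurable_compose)
          (intro borel_measurable_continuous_onI linear_continuous_on L)
    qed
    have "AE \<omega> in M. \<forall>a b. complex_cond_exp M ?F (\<lambda>\<omega>. H t \<omega> $ a $ b) \<omega> = H s \<omega> $ a $ b"
    proof (intro eventually_all_finite)
      fix a b
      show "AE \<omega> in M. complex_cond_exp M ?F (\<lambda>\<omega>. H t \<omega> $ a $ b) \<omega> = H s \<omega> $ a $ b"
        using ce[OF bounded_linear_Re, of a b] ce[OF bounded_linear_Im, of a b]
        by eventually_elim (simp add: complex_cond_exp_def complex_eq_iff)
    qed
    then show ?thesis
      by eventually_elim (simp add: matrix_cond_exp_def vec_eq_iff)
  qed
  have "matrix_martingale M {0..} (natural_filtration M X) H"
    unfolding matrix_martingale_def
    using subalgebra_filtration filtration_mono adapted int cond by (intro conjI ballI allI impI) auto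
  then show ?thesis by (simp only: H_def[abs_def] I_def)
qed

end

theorem mainTheorem14:
  fixes M :: "'a measure"
    and X :: "(real \<Rightarrow> real) \<Rightarrow> 'a \<Rightarrow> complex^'n^'n"
    and n :: nat and \<alpha> :: "nat \<Rightarrow> nat"
  assumes "hermitian_gaussian_process M X"
    and "\<alpha> \<in> S0 n"
  shows "matrix_martingale M {0..} (natural_filtration M X)
           (\<lambda>t. hermite_trace X n \<alpha> (\<lambda>_. indicator {0..t}))"
  using hermitian_gaussian_process.hermite_trace_martingale[OF assms(1)] assms(2) by (simp add: S0_def)

end
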